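(* Let $m\ge 1$. (i) Let $\Omega\subset\mathbb{R}^m$ be open with $0<|\Omega|<\infty$, and suppose that the Dirichlet Laplacian on $\Omega$ satisfies the strong Hardy inequality with constant $c_\Omega\in(0,\infty)$. Then $$\frac{1}{2m\,\mathfrak{c}_m\,c_\Omega}\,\frac{\|d_\Omega^2\|_1}{|\Omega|\,\|d_\Omega^2\|_\infty}\;\le\;\Phi(\Omega)\;\le\; c_\Omega\, j_{(m-2)/2}^2\,\frac{\|d_\Omega^2\|_1}{|\Omega|\,\|d_\Omega^2\|_\infty}.$$ (ii) Let $(\Omega_n)_{n\in\mathbb{N}}$ be a sequence of open sets in $\mathbb{R}^m$ with $0<|\Omega_n|<\infty$ for all $n$, such that for each $n$ the Dirichlet Laplacian on $\Omega_n$ satisfies the strong Hardy inequality with constant $c_{\Omega_n}$, and suppose $\sup\{c_{\Omega_n}:n\in\mathbb{N}\}<\infty$. If $(\eta_n)$ is a sequence of strictly positive real numbers such that $$\lim_{n\to\infty}\frac{|\{d_{\Omega_n}\ge\eta_n\}|}{|\Omega_n|}=0\qquad\text{and}\qquad \lim_{n\to\infty}\frac{\eta_n^2\,|\Omega_n|}{\int_{\{d_{\Omega_n}\ge\eta_n\}}d_{\Omega_n}^2}=0,$$ then $(v_{\Omega_n})$ localises along the sequence $A_n=\{x\in\Omega_n: d_{\Omega_n}(x)\ge\eta_n\}$. (iii) Let $(\Omega_n)_{n\in\mathbb{N}}$ be a sequence of open sets in $\mathbb{R}^m$ with $0<|\Omega_n|<\infty$ for all $n$, such that for each $n$ the Dirichlet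 Laplacian on $\Omega_n$ satisfies the strong Hardy inequality with constant $c_{\Omega_n}$, and suppose $\sup\{c_{\Omega_n}:n\in\mathbb{N}\}<\infty$. If every sequence $(A_n)$ of measurable sets $A_n\subset\Omega_n$, $n\in\mathbb{N}$, with $\lim_{n\to\infty}|A_n|/|\Omega_n|=0$ satisfies $$\lim_{n\to\infty}\frac{\int_{A_n}d_{\Omega_n}^2}{\int_{\Omega_n}d_{\Omega_n}^2}=0,$$ then $(v_{\Omega_n})$ does not localise.
   Context: $|\cdot|$ denotes Lebesgue measure and $\|\cdot\|_p$ the $L^p$ norm, $1\le p\le\infty$, on the relevant set. For an open set $\Omega\subset\mathbb{R}^m$ with $0<|\Omega|<\infty$: - The torsion function $v_\Omega$ is the unique (weak) solution of $-\Delta v=1$, $v\in H_0^1(\Omega)$. - $\lambda_1(\Omega)=\inf\{\|\nabla\varphi\|_2^2/\|\varphi\|_2^2:\varphi\in H_0^1(\Omega)\setminus\{0\}\}$ is the first eigenvalue of the Dirichlet Laplacian. - $d_\Omega(x)=\inf\{|x-y|:y\in\mathbb{R}^m\setminus\Omega\}$, $x\in\Omega$, is the distance to the boundary, and $\{d_\Omega\ge\eta\}=\{x\in\Omega:d_\Omega(x)\ge\eta\}$. - The Dirichlet Laplacian on $\Omega$ satisfies the strong Hardy inequality with constant $c_\Omega\in(0,\infty)$ if $\|\nabla w\|_2^2\ge \frac{1}{c_\Omega}\int_\Omega \frac{w^2}{d_\Omega^2}$ for all $w\in C_c^\infty(\Omega)$. - The efficiency of $v_\Omega$ is $\Phi(\Omega)=\dfrac{\|v_\Omega\|_1}{|\Omega|\,\|v_\Omega\|_\infty}$.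 The constant $\mathfrak{c}_m$ is $\mathfrak{c}_m=\sup\{\lambda_1(\Omega)\|v_\Omega\|_\infty:\Omega\text{ open in }\mathbb{R}^m,\ 0<|\Omega|<\infty\}$, which is finite. $j_\nu$ is the first positive zero of the Bessel function $J_\nu$ (so $j_{(m-2)/2}^2$ is the first Dirichlet eigenvalue of the unit ball of $\mathbb{R}^m$; for $m=1$, $j_{-1/2}=\pi/2$). Localisation: for a sequence $(\Omega_n)$ of open sets in $\mathbb{R}^m$ with $0<|\Omega_n|<\infty$, let $\mathfrak{A}((\Omega_n))$ be the set of all sequences $(A_n)$ of measurable sets with $A_n\subset\Omega_n$ for all $n$ and $\lim_{n\to\infty}|A_n|/|\Omega_n|=0$, and let $$\kappa=\sup\Big\{\limsup_{n\to\infty}\frac{\int_{A_n}v_{\Omega_n}}{\|v_{\Omega_n}\|_1}:(A_n)\in\mathfrak{A}((\Omega_n))\Big\}.$$ $(v_{\Omega_n})$ localises if $\kappa=1$, and does not localise if $\kappa=0$. $(v_{\Omega_n})$ localises along $(A_n)$ if $(A_n)\in\mathfrak{A}((\Omega_n))$ and $\limsup_{n\to\infty}\int_{A_n}v_{\Omega_n}/\|v_{\Omega_n}\|_1=1$ (so that in particular $\kappa=1$). *)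

theory Defs
  imports "HOL-Analysis.Analysis" "HOL-Probability.Essential_Supremum"
begin

section \<open>Norms\<close>

text \<open>
  Norms take values in \<^typ>\<open>ennreal\<close>, so that no integrability or boundedness is tacitly needed
  for them to have their usual meaning.
\<close>

definition L1_norm :: "'a::euclidean_space set \<Rightarrow> ('a \<Rightarrow> real) \<Rightarrow> ennreal" where
  "L1_norm S f = (\<integral>\<^sup>+x. ennreal \<bar>f x\<bar> \<partial>lebesgue_on S)"

definition L2_norm_sq :: "'a::euclidean_space set \<Rightarrow> ('a \<Rightarrow> 'b::real_normed_vector) \<Rightarrow> ennreal" where
  "L2_norm_sq S f = (\<integral>\<^sup>+x. ennreal ((norm (f x))\<^sup>2) \<partial>lebesgue_on S)"

definition Linf_norm :: "'a::euclidean_space set \<Rightarrow> ('a \<Rightarrow> real) \<Rightarrow> ennreal" where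
  "Linf_norm S f = esssup (lebesgue_on S) (\<lambda>x. ennreal \<bar>f x\<bar>)"

definition L2_space :: "'a::euclidean_space set \<Rightarrow> ('a \<Rightarrow> 'b::euclidean_space) set" where
  "L2_space S = {f \<in> borel_measurable (lebesgue_on S). L2_norm_sq S f < \<infinity>}"


section \<open>Test functions\<close>

definition partial_deriv :: "'a::euclidean_space \<Rightarrow> ('a \<Rightarrow> real) \<Rightarrow> 'a \<Rightarrow> real" where
  "partial_deriv b f x = frechet_derivative f (at x) b"

definition grad :: "('a::euclidean_space \<Rightarrow> real) \<Rightarrow> 'a \<Rightarrow> 'a" where
  "grad f x = (\<Sum>b\<in>Basis. partial_deriv b f x *\<^sub>R b)"

primrec cont_diff :: "nat \<Rightarrow> ('a::euclidean_space \<Rightarrow> real) \<Rightarrow> bool" where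
  "cont_diff 0 f \<longleftrightarrow> continuous_on UNIV f"
| "cont_diff (Suc k) f \<longleftrightarrow>
     (\<forall>x. f differentiable (at x)) \<and> (\<forall>b\<in>Basis. cont_diff k (partial_deriv b f))"

text \<open>\<open>C\<^sub>c\<^sup>\<infinity>(\<Omega>)\<close>, its elements being extended by zero to the whole space.\<close>

definition test_functions :: "'a::euclidean_space set \<Rightarrow> ('a \<Rightarrow> real) set" where
  "test_functions \<Omega> = {\<phi>. (\<forall>k. cont_diff k \<phi>) \<and>
     compact (closure {x. \<phi> x \<noteq> 0}) \<and> closure {x. \<phi> x \<noteq> 0} \<subseteq> \<Omega>}"


section \<open>Sobolev spaces\<close>

text \<open>
  Elements of \<open>L\<^sup>2(\<Omega>)\<close> and \<open>H\<^sup>1(\<Omega>)\<close> are represented by functions on the whole space of which only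
  the values almost everywhere in \<open>\<Omega>\<close> matter.  The weak gradient is unique almost everywhere in
  \<open>\<Omega>\<close>, and everything below depends only on this equivalence class.
\<close>

definition is_weak_gradient ::
  "'a::euclidean_space set \<Rightarrow> ('a \<Rightarrow> real) \<Rightarrow> ('a \<Rightarrow> 'a) \<Rightarrow> bool" where
  "is_weak_gradient \<Omega> u g \<longleftrightarrow> g \<in> L2_space \<Omega> \<and>
     (\<forall>\<phi>\<in>test_functions \<Omega>. \<forall>b\<in>Basis.
        (\<integral>x. u x * partial_deriv b \<phi> x \<partial>lebesgue_on \<Omega>) = - (\<integral>x. (g x \<bullet> b) * \<phi> x \<partial>lebesgue_on \<Omega>))"

definition H1 :: "'a::euclidean_space set \<Rightarrow> ('a \<Rightarrow> real) set" where
  "H1 \<Omega> = {u \<in> L2_space \<Omega>. \<exists>g. is_weak_gradient \<Omega> u g}"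

definition weak_grad :: "'a::euclidean_space set \<Rightarrow> ('a \<Rightarrow> real) \<Rightarrow> 'a \<Rightarrow> 'a" where
  "weak_grad \<Omega> u = (SOME g. is_weak_gradient \<Omega> u g)"

definition H10 :: "'a::euclidean_space set \<Rightarrow> ('a \<Rightarrow> real) set" where
  "H10 \<Omega> = {u \<in> H1 \<Omega>. \<exists>\<phi>. (\<forall>n. \<phi> n \<in> test_functions \<Omega>) \<and>
     (\<lambda>n::nat. L2_norm_sq \<Omega> (\<lambda>x. \<phi> n x - u x)
           + L2_norm_sq \<Omega> (\<lambda>x. grad (\<phi> n) x - weak_grad \<Omega> u x)) \<longlonglongrightarrow> 0}"


section \<open>The Dirichlet Laplacian\<close>

definition first_eigenvalue :: "'a::euclidean_space set \<Rightarrow> ennreal" where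
  "first_eigenvalue \<Omega> =
     (INF \<phi> \<in> {\<phi> \<in> H10 \<Omega>. L2_norm_sq \<Omega> \<phi> \<noteq> 0}. L2_norm_sq \<Omega> (weak_grad \<Omega> \<phi>) / L2_norm_sq \<Omega> \<phi>)"

definition is_torsion_function :: "'a::euclidean_space set \<Rightarrow> ('a \<Rightarrow> real) \<Rightarrow> bool" where
  "is_torsion_function \<Omega> v \<longleftrightarrow> v \<in> H10 \<Omega> \<and>
     (\<forall>\<phi>\<in>test_functions \<Omega>.
        (\<integral>x. weak_grad \<Omega> v x \<bullet> grad \<phi> x \<partial>lebesgue_on \<Omega>) = (\<integral>x. \<phi> x \<partial>lebesgue_on \<Omega>))"

text \<open>
  A representative of the torsion function; for \<open>\<Omega>\<close> open of finite measure it exists and is unique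
  up to equality almost everywhere in \<open>\<Omega>\<close>.
\<close>

definition torsion :: "'a::euclidean_space set \<Rightarrow> 'a \<Rightarrow> real" where
  "torsion \<Omega> = (SOME v. is_torsion_function \<Omega> v)"

definition bdry_dist :: "'a::euclidean_space set \<Rightarrow> 'a \<Rightarrow> real" where
  "bdry_dist \<Omega> x = infdist x (- \<Omega>)"

definition strong_hardy :: "'a::euclidean_space set \<Rightarrow> real \<Rightarrow> bool" where
  "strong_hardy \<Omega> c \<longleftrightarrow> 0 < c \<and>
     (\<forall>w\<in>test_functions \<Omega>. L2_norm_sq \<Omega> (grad w) \<ge>
        ennreal (1 / c) * (\<integral>\<^sup>+x. ennreal ((w x)\<^sup>2 / (bdry_dist \<Omega> x)\<^sup>2) \<partial>lebesgue_on \<Omega>))"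

definition efficiency :: "'a::euclidean_space set \<Rightarrow> ennreal" where
  "efficiency \<Omega> =
     L1_norm \<Omega> (torsion \<Omega>) / (emeasure lebesgue \<Omega> * Linf_norm \<Omega> (torsion \<Omega>))"

definition admissible :: "'a::euclidean_space set \<Rightarrow> bool" where
  "admissible \<Omega> \<longleftrightarrow> open \<Omega> \<and> 0 < emeasure lebesgue \<Omega> \<and> emeasure lebesgue \<Omega> < \<infinity>"

text \<open>The constant depends on the dimension only, which is carried by the type argument.\<close>

definition torsion_const :: "'a::euclidean_space itself \<Rightarrow> ennreal" where
  "torsion_const _ =
     (SUP \<Omega> \<in> {\<Omega> :: 'a set. admissible \<Omega>}. first_eigenvalue \<Omega> * Linf_norm \<Omega> (torsion \<Omega>))"


section \<open>Bessel functions\<close>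

text \<open>
  Meaningful for \<open>x > 0\<close>; \<^const>\<open>rGamma\<close> is the reciprocal of the Gamma function.
\<close>

definition bessel_J :: "real \<Rightarrow> real \<Rightarrow> real" where
  "bessel_J \<nu> x =
     (\<Sum>k. (-1) ^ k / fact k * rGamma (real k + \<nu> + 1) * (x / 2) powr (2 * real k + \<nu>))"

definition bessel_zero :: "real \<Rightarrow> real" where
  "bessel_zero \<nu> = (LEAST x. 0 < x \<and> bessel_J \<nu> x = 0)"


section \<open>Localisation\<close>

definition vanishing_seqs :: "(nat \<Rightarrow> 'a::euclidean_space set) \<Rightarrow> (nat \<Rightarrow> 'a set) set" where
  "vanishing_seqs \<Omega> = {A. (\<forall>n. A n \<in> sets lebesgue \<and> A n \<subseteq> \<Omega> n) \<and>
     (\<lambda>n. emeasure lebesgue (A n) / emeasure lebesgue (\<Omega> n)) \<longlonglongrightarrow> 0}"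

definition mass_limsup ::
  "(nat \<Rightarrow> 'a::euclidean_space set) \<Rightarrow> (nat \<Rightarrow> 'a set) \<Rightarrow> ereal" where
  "mass_limsup \<Omega> A = limsup (\<lambda>n. ereal (\<integral>x. torsion (\<Omega> n) x \<partial>lebesgue_on (A n))
                                 / enn2ereal (L1_norm (\<Omega> n) (torsion (\<Omega> n))))"

definition kappa :: "(nat \<Rightarrow> 'a::euclidean_space set) \<Rightarrow> ereal" where
  "kappa \<Omega> = (SUP A \<in> vanishing_seqs \<Omega>. mass_limsup \<Omega> A)"

definition localises_along ::
  "(nat \<Rightarrow> 'a::euclidean_space set) \<Rightarrow> (nat \<Rightarrow> 'a set) \<Rightarrow> bool" where
  "localises_along \<Omega> A \<longleftrightarrow> A \<in> vanishing_seqs \<Omega> \<and> mass_limsup \<Omega> A = 1"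

definition not_localises :: "(nat \<Rightarrow> 'a::euclidean_space set) \<Rightarrow> bool" where
  "not_localises \<Omega> \<longleftrightarrow> kappa \<Omega> = 0"

end

theory Submission
  imports Defs "HOL-Real_Asymp.Real_Asymp"
begin

text \<open>
  Write \<open>v\<close> for the torsion function and \<open>d\<close> for the distance to the boundary.  Comparing \<open>v\<close> with
  \<open>(r\<^sup>2 - \<bar>y - x\<bar>\<^sup>2) / (2 m)\<close> on the balls contained in \<open>\<Omega>\<close> gives \<open>v \<ge> d\<^sup>2 / (2 m)\<close> almost everywhere.
  Conversely, Hardy's inequality for \<open>v\<close> and \<open>\<parallel>\<nabla>v\<parallel>\<^sup>2 = \<integral> v\<close> give \<open>\<integral> v\<^sup>2 / d\<^sup>2 \<le> c \<integral> v\<close>, so that by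
  Cauchy-Schwarz \<open>(\<integral>\<^sub>A v)\<^sup>2 \<le> c (\<integral>\<^sub>\<Omega> v) (\<integral>\<^sub>A d\<^sup>2)\<close> for every measurable \<open>A \<subseteq> \<Omega>\<close>.  The two
  localisation criteria are read off from these bounds, and so is the estimate of the efficiency,
  using \<open>1 / \<lambda>\<^sub>1 \<le> c \<parallel>d\<^sup>2\<parallel>\<^sub>\<infinity>\<close> for the lower bound and \<open>2 m \<le> j\<^sup>2\<close> for the upper one.
\<close>

section \<open>Test functions\<close>

text \<open>\<open>torsion\<close> and \<open>weak_grad\<close> are choices, so nothing can be said
  about them before existence, and for the weak gradient uniqueness almost everywhere, is proved.
  Hardy's inequality serves here too: the ball of radius d(x) about x lies in a set of finite
  volume, so d is bounded and Hardy's inequality implies a Poincare inequality, which makes the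
  Dirichlet energy bounded below and its minimising sequences converge. Statements on H10 are proved
  for test functions and carried over by L2 limits and Fatou's lemma.

  The paraboloid is the torsion function of the ball, whence the factor 2m. Its comparison with v
  holds off a null set that depends on the ball, so the pointwise bound by d^2 must be drawn from
  countably many balls.

  The bound 2m \<le> j^2 is the case \<nu> = (m-2)/2 of 4(\<nu>+1) \<le> j_\<nu>^2, read off from
  two terms of an alternating series. As \<open>bessel_zero\<close> is a \<open>LEAST\<close> over
  the reals, a zero has to be produced and a smallest one shown to exist.

  For the first localisation criterion the Cauchy-Schwarz bound is applied to the complement of A_n,
  where d is small.\<close>

lemma partial_deriv_eq:
  "(f has_derivative f') (at x) \<Longrightarrow> partial_deriv b f x = f' b"
  unfolding partial_deriv_def using frechet_derivative_at by metis

lemma has_derivative_frechet: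
  "f differentiable (at x) \<Longrightarrow> (f has_derivative frechet_derivative f (at x)) (at x)"
  by (simp add: frechet_derivative_works)

lemma grad_inner_Basis: "b \<in> Basis \<Longrightarrow> grad f x \<bullet> b = partial_deriv b f x"
  by (simp add: grad_def inner_sum_left inner_Basis if_distrib[of "(*) _"] cong: if_cong)

lemma grad_inner: "grad f x \<bullet> z = (\<Sum>b\<in>Basis. partial_deriv b f x * (z \<bullet> b))"
  by (simp add: grad_def inner_sum_left) (simp add: inner_commute)

text \<open>The recursion for \<open>Suc k\<close> records differentiability and the derivatives but
  not the lower order itself. The product rule multiplies derivatives by undifferentiated factors,
  so the lower order is needed there.\<close>

lemma cont_diff_SucD: "cont_diff (Suc k) f \<Longrightarrow> cont_diff k f"
proof (induction k arbitrary: f)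
  case 0
  then have "f differentiable (at x)" for x by simp
  then show ?case
    by (simp add: continuous_at_imp_continuous_on differentiable_imp_continuous_within)
next
  case (Suc k)
  then show ?case by (metis cont_diff.simps(2))
qed

lemma cont_diff_const: "cont_diff k (\<lambda>x. c)"
proof (induction k arbitrary: c)
  case (Suc k)
  have "partial_deriv b (\<lambda>x. c) = (\<lambda>x. 0)" for b :: 'a
    by (rule ext) (simp add: partial_deriv_def)
  then show ?case using Suc by simp
qed simp

lemma partial_deriv_add:
  assumes "f differentiable (at x)" "g differentiable (at x)"
  shows "partial_deriv b (\<lambda>x. f x + g x) x = partial_deriv b f x + partial_deriv b g x"
  unfolding partial_deriv_def
  by (subst frechet_derivative_at[symmetric,
        OF has_derivative_add[OF assms[THEN has_derivative_frechet]]]) simp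

lemma partial_deriv_mult:
  assumes "f differentiable (at x)" "g differentiable (at x)"
  shows "partial_deriv b (\<lambda>x. f x * g x) x = f x * partial_deriv b g x + partial_deriv b f x * g x"
  unfolding partial_deriv_def
  by (subst frechet_derivative_at[symmetric,
        OF has_derivative_mult[OF assms[THEN has_derivative_frechet]]]) simp

lemma cont_diff_add: "cont_diff k f \<Longrightarrow> cont_diff k g \<Longrightarrow> cont_diff k (\<lambda>x. f x + g x)"
proof (induction k arbitrary: f g)
  case 0
  then show ?case by (simp add: continuous_on_add)
next
  case (Suc k)
  have "partial_deriv b (\<lambda>x. f x + g x) = (\<lambda>x. partial_deriv b f x + partial_deriv b g x)" for b
    using Suc.prems by (intro ext partial_deriv_add) auto
  then show ?case using Suc by simp
qed

lemma cont_diff_mult: "cont_diff k f \<Longrightarrow> cont_diff k g \<Longrightarrow> cont_diff k (\<lambda>x. f x * g x)"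
proof (induction k arbitrary: f g)
  case 0
  then show ?case by (simp add: continuous_on_mult)
next
  case (Suc k)
  have "partial_deriv b (\<lambda>x. f x * g x)
      = (\<lambda>x. f x * partial_deriv b g x + partial_deriv b f x * g x)" for b
    using Suc.prems by (intro ext partial_deriv_mult) auto
  then show ?case using Suc cont_diff_SucD[OF Suc.prems(1)] cont_diff_SucD[OF Suc.prems(2)]
    by (simp add: cont_diff_add)
qed

lemma cont_diff_cmult: "cont_diff k f \<Longrightarrow> cont_diff k (\<lambda>x. c * f x)"
  by (intro cont_diff_mult cont_diff_const)

lemma cont_diff_diff: "cont_diff k f \<Longrightarrow> cont_diff k g \<Longrightarrow> cont_diff k (\<lambda>x. f x - g x)"
  using cont_diff_add[of k f "\<lambda>x. (-1) * g x"] cont_diff_cmult[of k g "-1"] by simp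

lemma cont_diff_sum:
  "(\<And>i. i \<in> I \<Longrightarrow> cont_diff k (f i)) \<Longrightarrow> cont_diff k (\<lambda>x. \<Sum>i\<in>I. f i x)"
  by (induction I rule: infinite_finite_induct) (auto intro: cont_diff_add cont_diff_const)

lemma cont_diff_prod:
  "(\<And>i. i \<in> I \<Longrightarrow> cont_diff k (f i)) \<Longrightarrow> cont_diff k (\<lambda>x. \<Prod>i\<in>I. f i x)"
  by (induction I rule: infinite_finite_induct) (auto intro: cont_diff_mult cont_diff_const)

lemma cont_diff_inner: "cont_diff k (\<lambda>x. x \<bullet> z)"
proof (cases k)
  case (Suc l)
  have "partial_deriv b (\<lambda>x. x \<bullet> z) = (\<lambda>x. b \<bullet> z)" for b
    by (rule ext, rule partial_deriv_eq) (auto intro!: derivative_eq_intros)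
  then show ?thesis using Suc by (simp add: cont_diff_const)
qed (auto intro!: continuous_intros)

lemma dist_sq_Basis: "(dist y x)\<^sup>2 = (\<Sum>b\<in>Basis. (y \<bullet> b - x \<bullet> b) * (y \<bullet> b - x \<bullet> b))"
  for x y :: "'a::euclidean_space"
  by (simp add: dist_norm power2_norm_eq_inner) (subst euclidean_inner, simp add: inner_diff_left)

lemma cont_diff_dist_sq: "cont_diff k (\<lambda>y. (dist y x)\<^sup>2)"
  unfolding dist_sq_Basis
  by (intro cont_diff_sum cont_diff_mult cont_diff_diff cont_diff_inner cont_diff_const)

text \<open>
  These functions vanish on the negative half-line, and their derivatives are linear combinations of
  functions of the same family, which gives smoothness by induction.
\<close>

definition flat :: "nat \<Rightarrow> real \<Rightarrow> real" where
  "flat j t = (if t > 0 then exp (- 1 / t) / t ^ j else 0)"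

lemma flat_nonneg: "0 \<le> flat j t"
  by (simp add: flat_def)

text \<open>The inequality (1 + x/n)^n \<le> exp x with x = 1/t and n = j + 2 bounds exp(-1/t) by (n
  t)^n, and dividing by t^j leaves t^2. A quadratic bound is what makes the difference quotient at 0
  tend to 0.\<close>

lemma flat_le: "\<bar>flat j t\<bar> \<le> real (j + 2) ^ (j + 2) * t\<^sup>2"
proof (cases "t > 0")
  case True
  have "(1 / (real (j + 2) * t)) ^ (j + 2) \<le> (1 + 1 / t / real (j + 2)) ^ (j + 2)"
    using True by (intro power_mono) (auto simp: field_simps)
  also have "\<dots> \<le> exp (1 / t)"
    using True by (intro exp_ge_one_plus_x_over_n_power_n) (auto intro: order_trans[of _ 0])
  finally have "1 / (real (j + 2) * t) ^ (j + 2) \<le> exp (1 / t)"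
    by (simp only: power_divide power_one)
  moreover have "0 < (real (j + 2) * t) ^ (j + 2)"
    using True by (intro zero_less_power) simp
  ultimately have "1 \<le> exp (1 / t) * (real (j + 2) * t) ^ (j + 2)"
    by (metis pos_divide_le_eq)
  then have "exp (- 1 / t) \<le> (real (j + 2) * t) ^ (j + 2)"
    using True by (simp add: exp_minus field_simps del: power_Suc)
  also have "\<dots> = real (j + 2) ^ (j + 2) * t\<^sup>2 * t ^ j"
    by (simp only: power_mult_distrib power_add mult_ac)
  finally have "exp (- 1 / t) / t ^ j \<le> real (j + 2) ^ (j + 2) * t\<^sup>2"
    using True by (simp only: pos_divide_le_eq zero_less_power)
  then show ?thesis
    using True by (simp add: flat_def)
qed (simp add: flat_def)

lemma flat_has_real_derivative:
  "(flat j has_real_derivative flat (j + 2) t - real j * flat (j + 1) t) (at t)"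
proof -
  consider "t > 0" | "t < 0" | "t = 0" by linarith
  then show ?thesis
  proof cases
    case 1
    have pow: "((\<lambda>t. t ^ j) has_real_derivative real j * t ^ j / t) (at t)"
      using 1 DERIV_pow[of j t] by (cases j) auto
    have eq: "((\<lambda>t. exp (- 1 / t) / t ^ j) has_real_derivative
        flat (j + 2) t - real j * flat (j + 1) t) (at t)"
    proof (rule DERIV_cong[OF DERIV_divide[OF _ pow]])
      show "((\<lambda>t. exp (- 1 / t)) has_real_derivative exp (- 1 / t) / t\<^sup>2) (at t)"
        using 1 by (auto intro!: derivative_eq_intros simp: power2_eq_square)
    qed (use 1 in \<open>auto simp: flat_def field_simps power2_eq_square\<close>)
    have ev: "eventually (\<lambda>s. s > 0) (nhds t)"
      using 1 by (intro eventually_nhds_in_open[of "{0<..}", simplified]) auto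
    have "eventually (\<lambda>s. flat j s = exp (- 1 / s) / s ^ j) (nhds t)"
      using ev by eventually_elim (simp add: flat_def)
    from DERIV_cong_ev[OF refl this refl] eq show ?thesis by blast
  next
    case 2
    have ev: "eventually (\<lambda>s. s < 0) (nhds t)"
      using 2 by (intro eventually_nhds_in_open[of "{..<0}", simplified]) auto
    have "eventually (\<lambda>s. flat j s = 0) (nhds t)"
      using ev by eventually_elim (simp add: flat_def)
    then have "(flat j has_real_derivative 0) (at t)"
      using DERIV_cong_ev[OF refl _ refl, of "flat j" "\<lambda>s. 0" t] by simp
    then show ?thesis using 2 by (simp add: flat_def)
  next
    \<comment> \<open>Here \<open>flat j 0 = 0\<close>, and \<open>flat_le\<close> bounds the
      difference quotient by a multiple of the absolute value of h; both terms of the claimed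
      derivative vanish at 0.\<close>
    case 3
    have "((\<lambda>h. flat j h / h) \<longlongrightarrow> 0) (at 0)"
    proof (rule Lim_null_comparison)
      have "norm (flat j h / h) \<le> real (j + 2) ^ (j + 2) * \<bar>h\<bar>" for h
      proof (cases "h = 0")
        case False
        have "\<bar>flat j h\<bar> \<le> real (j + 2) ^ (j + 2) * \<bar>h\<bar> * \<bar>h\<bar>"
          using flat_le[of j h] by (simp only: mult.assoc power2_eq_square abs_mult_self_eq)
        then show ?thesis
          using False by (simp only: real_norm_def abs_divide) (simp add: pos_divide_le_eq)
      qed simp
      then show "eventually (\<lambda>h. norm (flat j h / h) \<le> real (j + 2) ^ (j + 2) * \<bar>h\<bar>) (at (0::real))"
        by simp
      show "((\<lambda>h. real (j + 2) ^ (j + 2) * \<bar>h\<bar>) \<longlongrightarrow> 0) (at (0::real))"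
        by (auto intro!: tendsto_eq_intros)
    qed
    then show ?thesis using 3 by (simp add: DERIV_def flat_def)
  qed
qed

lemma flat_has_derivative_comp:
  assumes "u differentiable (at x)"
  shows "((\<lambda>x. flat j (u x)) has_derivative
     (\<lambda>h. (flat (j + 2) (u x) - real j * flat (j + 1) (u x)) * frechet_derivative u (at x) h)) (at x)"
  using has_derivative_compose[OF has_derivative_frechet[OF assms]
      flat_has_real_derivative[of j "u x", unfolded has_field_derivative_def]] .

lemma partial_deriv_flat:
  assumes "u differentiable (at x)"
  shows "partial_deriv b (\<lambda>x. flat j (u x)) x
    = (flat (j + 2) (u x) - real j * flat (j + 1) (u x)) * partial_deriv b u x"
  using partial_deriv_eq[OF flat_has_derivative_comp[OF assms]] by (simp add: partial_deriv_def)

lemma continuous_flat: "isCont (flat j) t"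
  using flat_has_real_derivative DERIV_isCont by blast

lemma cont_diff_flat: "(\<And>k. cont_diff k u) \<Longrightarrow> cont_diff k (\<lambda>x. flat j (u x))"
proof (induction k arbitrary: j)
  case 0
  then have "continuous_on UNIV u" by (metis cont_diff.simps(1))
  then show ?case
    by (auto simp: continuous_on_eq_continuous_at intro!: isCont_o2[OF _ continuous_flat])
next
  case (Suc k)
  have d: "u differentiable (at x)" for x
    using Suc.prems[of "Suc 0"] by simp
  have "cont_diff k (\<lambda>x. (flat (j + 2) (u x) - real j * flat (j + 1) (u x)) * partial_deriv b u x)"
    if "b \<in> Basis" for b
    using Suc.prems[of "Suc k"] that
    by (intro cont_diff_mult cont_diff_diff cont_diff_const Suc.IH[OF Suc.prems]) auto
  moreover have "(\<lambda>x. flat j (u x)) differentiable (at x)" for x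
    using flat_has_derivative_comp[OF d] unfolding differentiable_def by blast
  moreover have "partial_deriv b (\<lambda>x. flat j (u x))
      = (\<lambda>x. (flat (j + 2) (u x) - real j * flat (j + 1) (u x)) * partial_deriv b u x)" for b
    by (rule ext) (rule partial_deriv_flat[OF d])
  ultimately show ?case by simp
qed

text \<open>The derivative of \<open>flat 0\<close> is \<open>flat 2\<close>, so this makes
  \<open>flat 0\<close> a nondecreasing truncation with slope at most 1, as the comparison argument
  requires. With s = 1/t the claim is s^2 \<le> exp s, the square of s \<le> exp(s/2), which follows
  from the quadratic Taylor bound.\<close>

lemma flat_2_le_1: "flat 2 t \<le> 1"
proof (cases "t > 0")
  case True
  have "exp (1/t/2) \<ge> 1 + 1/t/2 + (1/t/2)\<^sup>2 / 2"
    using True by (intro exp_lower_Taylor_quadratic) auto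
  moreover have "1 + s + s\<^sup>2 / 2 \<ge> 2 * s" for s :: real
    using sum_squares_bound[of 1 s] zero_le_power2[of "s-1"] by (simp add: power2_eq_square algebra_simps)
  from this[of "1/t/2"] have "1 / t \<le> 1 + 1/t/2 + (1/t/2)\<^sup>2 / 2"
    by simp
  ultimately have "1 / t \<le> exp (1/t/2)"
    by (rule order_trans[rotated])
  then have "(1 / t)\<^sup>2 \<le> (exp (1/t/2))\<^sup>2"
    using True by (intro power_mono) auto
  also have "\<dots> = exp (1 / t)"
    by (simp flip: exp_double)
  finally show ?thesis
    using True by (simp add: flat_def exp_minus power_divide field_simps)
qed (simp add: flat_def)

section \<open>Membership in and closure properties of the space of test functions\<close>

lemma test_functionsI:
  assumes "\<And>k. cont_diff k \<phi>" "compact K" "K \<subseteq> \<Omega>" "\<And>x. x \<notin> K \<Longrightarrow> \<phi> x = 0"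
  shows "\<phi> \<in> test_functions \<Omega>"
proof -
  have "closure {x. \<phi> x \<noteq> 0} \<subseteq> K"
    using assms(4) by (intro closure_minimal compact_imp_closed[OF assms(2)]) blast
  moreover from this have "compact (closure {x. \<phi> x \<noteq> 0})"
    using compact_Int_closed[OF assms(2) closed_closure[of "{x. \<phi> x \<noteq> 0}"]]
    by (simp only: inf.absorb2)
  ultimately show ?thesis
    using assms(1,3) unfolding test_functions_def by simp
qed

lemma test_functionsE:
  assumes "\<phi> \<in> test_functions \<Omega>"
  obtains K where "compact K" "K \<subseteq> \<Omega>" "\<And>x. x \<notin> K \<Longrightarrow> \<phi> x = 0"
proof
  show "compact (closure {x. \<phi> x \<noteq> 0})" "closure {x. \<phi> x \<noteq> 0} \<subseteq> \<Omega>"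
    using assms unfolding test_functions_def by blast+
  show "\<phi> x = 0" if "x \<notin> closure {x. \<phi> x \<noteq> 0}" for x
    using that subsetD[OF closure_subset, of x "{x. \<phi> x \<noteq> 0}"] by (cases "\<phi> x = 0") simp_all
qed

lemma test_cont_diff: "\<phi> \<in> test_functions \<Omega> \<Longrightarrow> cont_diff k \<phi>"
  by (simp add: test_functions_def)

lemma test_differentiable: "\<phi> \<in> test_functions \<Omega> \<Longrightarrow> \<phi> differentiable (at x)"
  using test_cont_diff[of \<phi> \<Omega> "Suc 0"] by simp

lemma test_continuous: "\<phi> \<in> test_functions \<Omega> \<Longrightarrow> continuous_on UNIV \<phi>"
  using test_cont_diff[of \<phi> \<Omega> 0] by simp

lemma test_eq_0: "\<phi> \<in> test_functions \<Omega> \<Longrightarrow> x \<notin> \<Omega> \<Longrightarrow> \<phi> x = 0"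
  by (metis test_functionsE subsetD)

lemma test_zero: "(\<lambda>x. 0) \<in> test_functions \<Omega>"
  by (rule test_functionsI[of _ "{}"]) (auto simp: cont_diff_const)

lemma test_smooth_mult:
  assumes "\<phi> \<in> test_functions \<Omega>" "\<And>k. cont_diff k f"
  shows "(\<lambda>x. f x * \<phi> x) \<in> test_functions \<Omega>"
proof -
  obtain K where "compact K" "K \<subseteq> \<Omega>" "\<And>x. x \<notin> K \<Longrightarrow> \<phi> x = 0"
    using assms(1) by (metis test_functionsE)
  then show ?thesis
    by (intro test_functionsI[of _ K] cont_diff_mult assms test_cont_diff[OF assms(1)]) auto
qed

lemma test_cmult: "\<phi> \<in> test_functions \<Omega> \<Longrightarrow> (\<lambda>x. c * \<phi> x) \<in> test_functions \<Omega>"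
  by (rule test_smooth_mult) (auto simp: cont_diff_const)

lemma test_add:
  assumes "\<phi> \<in> test_functions \<Omega>" "\<psi> \<in> test_functions \<Omega>"
  shows "(\<lambda>x. \<phi> x + \<psi> x) \<in> test_functions \<Omega>"
proof -
  obtain K where K: "compact K" "K \<subseteq> \<Omega>" "\<And>x. x \<notin> K \<Longrightarrow> \<phi> x = 0"
    using assms(1) by (metis test_functionsE)
  obtain L where L: "compact L" "L \<subseteq> \<Omega>" "\<And>x. x \<notin> L \<Longrightarrow> \<psi> x = 0"
    using assms(2) by (metis test_functionsE)
  show ?thesis
    by (rule test_functionsI[of _ "K \<union> L"])
       (use K L assms in \<open>auto intro!: cont_diff_add intro: test_cont_diff\<close>)
qed

lemma test_diff:
  "\<phi> \<in> test_functions \<Omega> \<Longrightarrow> \<psi> \<in> test_functions \<Omega> \<Longrightarrow> (\<lambda>x. \<phi> x - \<psi> x) \<in> test_functions \<Omega>"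
  using test_add[of \<phi> \<Omega> "\<lambda>x. (-1) * \<psi> x"] test_cmult[of \<psi> \<Omega> "-1"] by simp

lemma test_partial_deriv:
  assumes "\<phi> \<in> test_functions \<Omega>" "b \<in> Basis"
  shows "partial_deriv b \<phi> \<in> test_functions \<Omega>"
proof -
  obtain K where K: "compact K" "K \<subseteq> \<Omega>" "\<And>x. x \<notin> K \<Longrightarrow> \<phi> x = 0"
    using assms(1) by (metis test_functionsE)
  show ?thesis
  proof (rule test_functionsI)
    show "cont_diff k (partial_deriv b \<phi>)" for k
      using test_cont_diff[OF assms(1), of "Suc k"] assms(2) by simp
    fix x assume "x \<notin> K"
    then have "(\<phi> has_derivative (\<lambda>h. 0)) (at x)"
      using K(3) compact_imp_closed[OF K(1)]
      by (intro has_derivative_transform_within_open[OF has_derivative_const, where s = "- K"])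
        (simp_all add: open_Compl)
    then show "partial_deriv b \<phi> x = 0"
      by (simp add: partial_deriv_eq)
  qed (use K in auto)
qed

lemma grad_add_cmult:
  assumes "\<phi> \<in> test_functions \<Omega>" "\<psi> \<in> test_functions \<Omega>"
  shows "grad (\<lambda>x. \<phi> x + t * \<psi> x) x = grad \<phi> x + t *\<^sub>R grad \<psi> x"
proof -
  have "partial_deriv b (\<lambda>x. \<phi> x + t * \<psi> x) x = partial_deriv b \<phi> x + t * partial_deriv b \<psi> x" for b
    using test_differentiable[OF assms(1)] test_differentiable[OF assms(2)]
      test_differentiable[OF test_cmult[OF assms(2)]]
    by (simp add: partial_deriv_add partial_deriv_mult) (simp add: partial_deriv_def)
  then show ?thesis
    by (simp add: grad_def scaleR_left_distrib sum.distrib scaleR_sum_right)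
qed

lemma test_bounded:
  assumes "\<phi> \<in> test_functions \<Omega>"
  obtains B where "0 \<le> B" "\<And>x. \<bar>\<phi> x\<bar> \<le> B"
proof -
  obtain K where K: "compact K" "K \<subseteq> \<Omega>" "\<And>x. x \<notin> K \<Longrightarrow> \<phi> x = 0"
    using assms(1) by (metis test_functionsE)
  have "bounded (\<phi> ` K)"
    using K(1) continuous_on_subset[OF test_continuous[OF assms]]
    by (intro compact_imp_bounded compact_continuous_image) auto
  then obtain B where "\<And>x. x \<in> K \<Longrightarrow> \<bar>\<phi> x\<bar> \<le> B"
    by (auto simp: bounded_iff)
  then have "\<bar>\<phi> x\<bar> \<le> max B 0" for x
    using K(3)[of x] by (cases "x \<in> K") (auto simp: le_max_iff_disj)
  then show ?thesis by (intro that[of "max B 0"]) auto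
qed

section \<open>Integrals of test functions and integration by parts\<close>

lemma test_measurable:
  "\<phi> \<in> test_functions \<Omega> \<Longrightarrow> \<phi> \<in> borel_measurable borel"
  by (intro borel_measurable_continuous_onI test_continuous)

lemma borel_imp_lebesgue_on:
  "f \<in> borel_measurable borel \<Longrightarrow> f \<in> borel_measurable (lebesgue_on S)"
  by (simp add: measurable_completion measurable_restrict_space1)

text \<open>A test function vanishes off \<Omega> and is Borel, so neither restricting to \<Omega>
  nor completing the measure changes its integral. Translation invariance can then be used on
  \<open>lborel\<close>.\<close>

lemma test_integral:
  fixes \<phi> :: "'a::euclidean_space \<Rightarrow> real"
  assumes "\<phi> \<in> test_functions \<Omega>" "\<Omega> \<in> sets lebesgue"
  shows "integrable lborel \<phi>" "integrable (lebesgue_on \<Omega>) \<phi>"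
    "(\<integral>x. \<phi> x \<partial>lebesgue_on \<Omega>) = (\<integral>x. \<phi> x \<partial>lborel)"
proof -
  obtain K where K: "compact K" "K \<subseteq> \<Omega>" "\<And>x. x \<notin> K \<Longrightarrow> \<phi> x = 0"
    using assms(1) by (metis test_functionsE)
  have eq: "(\<lambda>x. indicator K x *\<^sub>R \<phi> x) = \<phi>"
    by (intro ext) (auto simp: indicator_def K(3))
  have "integrable lborel (\<lambda>x. indicator K x *\<^sub>R \<phi> x)"
    using K(1) continuous_on_subset[OF test_continuous[OF assms(1)]]
    by (intro borel_integrable_compact) auto
  then show i: "integrable lborel \<phi>" unfolding eq .
  have eq2: "(\<lambda>x. indicat_real \<Omega> x * \<phi> x) = \<phi>"
    by (intro ext) (auto simp: indicator_def test_eq_0[OF assms(1)])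
  have il: "integrable lebesgue \<phi>" "(\<integral>x. \<phi> x \<partial>lebesgue) = (\<integral>x. \<phi> x \<partial>lborel)"
    using i test_measurable[OF assms(1)] by (auto simp: integrable_completion integral_completion)
  show "integrable (lebesgue_on \<Omega>) \<phi>"
    using assms(2) il by (simp add: integrable_restrict_space eq2)
  show "(\<integral>x. \<phi> x \<partial>lebesgue_on \<Omega>) = (\<integral>x. \<phi> x \<partial>lborel)"
    using assms(2) il by (simp add: integral_restrict_space eq2)
qed

text \<open>By translation invariance each difference quotient of \<open>\<phi>\<close> in direction
  b has integral 0. The quotients converge pointwise to the derivative and are dominated by a
  constant on a fixed ball, so the limit has integral 0 as well.\<close>

lemma integral_partial_deriv:
  fixes \<phi> :: "'a::euclidean_space \<Rightarrow> real"
  assumes \<phi>: "\<phi> \<in> test_functions \<Omega>" and "\<Omega> \<in> sets lebesgue" "b \<in> Basis"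
  shows "(\<integral>x. partial_deriv b \<phi> x \<partial>lebesgue_on \<Omega>) = 0"
proof -
  let ?d = "partial_deriv b \<phi>"
  let ?h = "\<lambda>n. 1 / real (Suc n)"
  define q where "q = (\<lambda>n x. (\<phi> (?h n *\<^sub>R b + x) - \<phi> x) / ?h n)"
  note d = test_partial_deriv[OF \<phi> \<open>b \<in> Basis\<close>]
  obtain B where B: "0 \<le> B" "\<And>x. \<bar>?d x\<bar> \<le> B"
    using d by (metis test_bounded)
  obtain K where K: "compact K" "K \<subseteq> \<Omega>" "\<And>x. x \<notin> K \<Longrightarrow> \<phi> x = 0"
    using \<phi> by (metis test_functionsE)
  obtain R where R: "\<And>x. x \<in> K \<Longrightarrow> norm x \<le> R"
    using compact_imp_bounded[OF K(1)] unfolding bounded_iff by metis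
  have line: "((\<lambda>s. \<phi> (s *\<^sub>R b + x)) has_real_derivative ?d (s *\<^sub>R b + x)) (at s)" for s x
  proof -
    have "((\<lambda>s. \<phi> (s *\<^sub>R b + x)) has_derivative
        (\<lambda>h. frechet_derivative \<phi> (at (s *\<^sub>R b + x)) (h *\<^sub>R b))) (at s)"
      by (rule has_derivative_compose[OF _ has_derivative_frechet[OF test_differentiable[OF \<phi>]]])
         (auto intro!: derivative_eq_intros)
    moreover have "frechet_derivative \<phi> (at (s *\<^sub>R b + x)) (h *\<^sub>R b) = ?d (s *\<^sub>R b + x) * h" for h
      using linear_cmul[OF linear_frechet_derivative[OF test_differentiable[OF \<phi>]]]
      by (simp add: partial_deriv_def mult.commute)
    ultimately show ?thesis
      by (simp add: has_field_derivative_def)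
  qed
  have lim: "(\<lambda>n. q n x) \<longlonglongrightarrow> ?d x" for x
  proof -
    have A: "((\<lambda>h. (\<phi> ((0 + h) *\<^sub>R b + x) - \<phi> (0 *\<^sub>R b + x)) / h) \<longlongrightarrow> ?d x) (at 0)"
      using line[of x 0] unfolding DERIV_def by simp
    have B: "filterlim ?h (at 0) sequentially"
      using LIMSEQ_inverse_real_of_nat
      by (auto simp: filterlim_at inverse_eq_divide)
    show ?thesis
      using filterlim_compose[OF A B] unfolding q_def by simp
  qed
  \<comment> \<open>The steps have length at most 1, so outside the ball of radius R + 1 both x and
    its translate miss K; inside, the mean value theorem bounds the quotient by the supremum of the
    derivative.\<close>
  have bound: "norm (q n x) \<le> indicator (cball 0 (R + 1)) x *\<^sub>R B" for n x
  proof (cases "x \<in> cball 0 (R + 1)")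
    case True
    have "\<exists>z. 0 < z \<and> z < ?h n \<and> \<phi> (?h n *\<^sub>R b + x) - \<phi> (0 *\<^sub>R b + x) = (?h n - 0) * ?d (z *\<^sub>R b + x)"
      by (rule MVT2) (auto intro: line)
    then obtain z where "\<phi> (?h n *\<^sub>R b + x) - \<phi> x = ?h n * ?d (z *\<^sub>R b + x)"
      by auto
    then have "q n x = ?d (z *\<^sub>R b + x)" unfolding q_def by simp
    then show ?thesis using True B by simp
  next
    case False
    have "norm (?h n *\<^sub>R b) \<le> 1" using \<open>b \<in> Basis\<close> by simp
    then have "norm x \<le> norm (?h n *\<^sub>R b + x) + 1"
      using norm_triangle_ineq4[of "?h n *\<^sub>R b + x" "?h n *\<^sub>R b"]
      unfolding add_diff_cancel_left' by linarith
    moreover have "R + 1 < norm x" using False by simp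
    ultimately have "x \<notin> K" "?h n *\<^sub>R b + x \<notin> K"
      using R[of x] R[of "?h n *\<^sub>R b + x"] by linarith+
    then have "\<phi> x = 0" "\<phi> (?h n *\<^sub>R b + x) = 0"
      using K(3) by blast+
    then show ?thesis using False unfolding q_def by simp
  qed
  have i: "integrable lborel \<phi>" and m: "\<phi> \<in> borel_measurable borel"
    using test_integral[OF \<phi> assms(2)] test_measurable[OF \<phi>] by auto
  have sh: "integrable lborel (\<lambda>x. \<phi> (c + x))" "(\<integral>x. \<phi> (c + x) \<partial>lborel) = (\<integral>x. \<phi> x \<partial>lborel)" for c
  proof -
    have "integrable (distr lborel borel ((+) c)) \<phi>"
      using i by (simp add: lborel_distr_plus)
    then show "integrable lborel (\<lambda>x. \<phi> (c + x))"
      using m by (simp add: integrable_distr_eq)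
    have "(\<integral>x. \<phi> x \<partial>lborel) = (\<integral>x. \<phi> x \<partial>distr lborel borel ((+) c))"
      by (simp add: lborel_distr_plus)
    also have "\<dots> = (\<integral>x. \<phi> (c + x) \<partial>lborel)"
      using m by (simp add: integral_distr)
    finally show "(\<integral>x. \<phi> (c + x) \<partial>lborel) = (\<integral>x. \<phi> x \<partial>lborel)" by simp
  qed
  have q0: "(\<integral>x. q n x \<partial>lborel) = 0" for n
    unfolding q_def using sh i by simp
  have "(\<lambda>n. \<integral>x. q n x \<partial>lborel) \<longlonglongrightarrow> (\<integral>x. ?d x \<partial>lborel)"
  proof (rule integral_dominated_convergence)
    show "?d \<in> borel_measurable lborel" using test_measurable[OF d] by simp
    show "q n \<in> borel_measurable lborel" for n
      unfolding q_def using m by measurable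
    show "integrable lborel (\<lambda>x. indicator (cball (0::'a) (R + 1)) x *\<^sub>R B)"
      by (rule borel_integrable_compact) auto
    show "AE x in lborel. (\<lambda>n. q n x) \<longlonglongrightarrow> ?d x"
      using lim by simp
    show "AE x in lborel. norm (q n x) \<le> indicator (cball 0 (R + 1)) x *\<^sub>R B" for n
      using bound by (intro AE_I2)
  qed
  then have "(\<integral>x. ?d x \<partial>lborel) = 0"
    by (simp only: q0 LIMSEQ_const_iff)
  then show ?thesis
    using test_integral(3)[OF d assms(2)] by simp
qed

text \<open>The product with a test function is again a test function, so its derivative integrates
  to 0. The factor f may be any smooth function: below it is an approximant in H10 or the
  paraboloid.\<close>

lemma integral_by_parts:
  fixes \<phi> f :: "'a::euclidean_space \<Rightarrow> real"
  assumes \<phi>: "\<phi> \<in> test_functions \<Omega>" and f: "\<And>k. cont_diff k f" and "\<Omega> \<in> sets lebesgue" "b \<in> Basis"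
  shows "(\<integral>x. f x * partial_deriv b \<phi> x \<partial>lebesgue_on \<Omega>)
       = - (\<integral>x. partial_deriv b f x * \<phi> x \<partial>lebesgue_on \<Omega>)"
proof -
  have pf: "cont_diff k (partial_deriv b f)" for k
    using f[of "Suc k"] \<open>b \<in> Basis\<close> by simp
  have df: "f differentiable (at x)" for x
    using f[of "Suc 0"] by simp
  have "partial_deriv b (\<lambda>x. f x * \<phi> x)
      = (\<lambda>x. f x * partial_deriv b \<phi> x + partial_deriv b f x * \<phi> x)"
    by (intro ext partial_deriv_mult df test_differentiable[OF \<phi>])
  then have "0 = (\<integral>x. f x * partial_deriv b \<phi> x + partial_deriv b f x * \<phi> x \<partial>lebesgue_on \<Omega>)"
    using integral_partial_deriv[OF test_smooth_mult[OF \<phi> f] assms(3,4)] by simp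
  also have "\<dots> = (\<integral>x. f x * partial_deriv b \<phi> x \<partial>lebesgue_on \<Omega>)
      + (\<integral>x. partial_deriv b f x * \<phi> x \<partial>lebesgue_on \<Omega>)"
    by (intro Bochner_Integration.integral_add test_integral(2)[OF _ assms(3)] test_smooth_mult
        test_partial_deriv \<phi> f pf assms(4))
  finally show ?thesis by simp
qed

text \<open>
  With \<open>U\<close> the union of countably many balls, the approximants are \<open>1 - \<Prod>(1 - g\<^sub>i)\<close> for bumps \<open>g\<^sub>i\<close>
  on the balls.
\<close>

lemma open_indicator_limit_test:
  fixes U :: "'a::euclidean_space set"
  assumes "open U" "U \<subseteq> \<Omega>"
  obtains \<psi> where "\<And>n::nat. \<psi> n \<in> test_functions \<Omega>" "\<And>n x. 0 \<le> \<psi> n x" "\<And>n x. \<psi> n x \<le> 1"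
    "\<And>x. (\<lambda>n. \<psi> n x) \<longlonglongrightarrow> indicator U x"
proof -
  define F where "F = {ball x r | x r. cball x r \<subseteq> U}"
  have UF: "\<Union>F = U"
  proof
    show "\<Union>F \<subseteq> U" unfolding F_def using ball_subset_cball by blast
    show "U \<subseteq> \<Union>F"
    proof
      fix x assume "x \<in> U"
      then obtain e where e: "e > 0" "cball x e \<subseteq> U"
        using \<open>open U\<close> open_contains_cball by blast
      then have "ball x e \<in> F" "x \<in> ball x e" by (auto simp: F_def)
      then show "x \<in> \<Union>F" by blast
    qed
  qed
  obtain F' where F': "F' \<subseteq> F" "countable F'" "\<Union>F' = U"
  proof (rule Lindelof[of F])
    show "open S" if "S \<in> F" for S
      using that unfolding F_def by (auto simp: open_ball)
  qed (use UF in metis)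
  \<comment> \<open>The empty ball, obtained from radius -1, is adjoined so that the countable
    family is nonempty and can be enumerated by the naturals.\<close>
  have "{} \<in> F"
    unfolding F_def by (intro CollectI exI[of _ "0::'a"] exI[of _ "-1"]) (simp add: ball_empty)
  define B where "B = from_nat_into (insert {} F')"
  have B: "range B = insert {} F'"
    unfolding B_def using F'(2) by (intro range_from_nat_into) auto
  have "\<forall>i. \<exists>x r. B i = ball x r \<and> cball x r \<subseteq> U"
  proof
    fix i
    have "B i \<in> insert {} F'" using B rangeI[of B i] by simp
    then have "B i \<in> F" using subsetD[OF F'(1)] \<open>{} \<in> F\<close> by (metis insertE)
    then show "\<exists>x r. B i = ball x r \<and> cball x r \<subseteq> U" unfolding F_def by simp
  qed
  then obtain x r where "\<forall>i. B i = ball (x i) (r i) \<and> cball (x i) (r i) \<subseteq> U"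
    unfolding choice_iff by blast
  then have xr: "\<And>i. B i = ball (x i) (r i)" "\<And>i. cball (x i) (r i) \<subseteq> U"
    by simp_all
  have UB: "(\<Union>i. ball (x i) (r i)) = U"
    using B F'(3) by (simp flip: xr(1))
  \<comment> \<open>The bumps use the square of the radius, and the square of a negative radius
    would turn an empty ball into a nonempty one; hence the truncation at 0.\<close>
  define s where "s = (\<lambda>i. max 0 (r i))"
  have sball: "ball (x i) (r i) = ball (x i) (s i)" for i
    by (cases "r i \<le> 0") (auto simp: s_def max_def)
  \<comment> \<open>The factor n drives exp(-1/(n u)) to 1 wherever u > 0, that is in the open ball,
    while off the ball the argument is nonpositive and the bump is 0.\<close>
  define g where "g = (\<lambda>n i y. flat 0 (real n * ((s i)\<^sup>2 - (dist y (x i))\<^sup>2)))"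
  define \<psi> where "\<psi> = (\<lambda>n y. 1 - (\<Prod>i\<le>n. 1 - g n i y))"
  have g: "0 \<le> g n i y" "g n i y \<le> 1" for n i y
    by (auto simp: g_def flat_def)
  have g0: "g n i y = 0" if "y \<notin> ball (x i) (r i)" for n i y
  proof -
    have "s i \<le> dist y (x i)" using that unfolding sball by (simp add: dist_commute)
    then have "(s i)\<^sup>2 \<le> (dist y (x i))\<^sup>2" by (intro power_mono) (auto simp: s_def)
    then have "real n * ((s i)\<^sup>2 - (dist y (x i))\<^sup>2) \<le> 0"
      by (intro mult_nonneg_nonpos) auto
    then show ?thesis unfolding g_def flat_def by simp
  qed
  show thesis
  proof
    fix n
    show "\<psi> n \<in> test_functions \<Omega>"
    proof (rule test_functionsI)
      show "cont_diff k (\<psi> n)" for k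
        unfolding \<psi>_def g_def
        by (intro cont_diff_diff cont_diff_prod cont_diff_flat cont_diff_mult cont_diff_const
            cont_diff_dist_sq)
      show "compact (\<Union>i\<le>n. cball (x i) (r i))" by (intro compact_UN) auto
      show "(\<Union>i\<le>n. cball (x i) (r i)) \<subseteq> \<Omega>" using xr(2) assms(2) by blast
      fix y assume "y \<notin> (\<Union>i\<le>n. cball (x i) (r i))"
      then have "g n i y = 0" if "i \<le> n" for i
        using that ball_subset_cball by (intro g0) blast
      then show "\<psi> n y = 0" by (simp add: \<psi>_def)
    qed
    show "0 \<le> \<psi> n y" "\<psi> n y \<le> 1" for y
      using g by (auto simp: \<psi>_def intro!: prod_le_1 prod_nonneg)
  next
    fix y
    show "(\<lambda>n. \<psi> n y) \<longlonglongrightarrow> indicator U y"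
    proof (cases "y \<in> U")
      case False
      then have "g n i y = 0" for n i
        using UB by (intro g0) blast
      then show ?thesis using False by (simp add: \<psi>_def)
    next
      case True
      then obtain j where j: "y \<in> ball (x j) (s j)" using UB sball by blast
      then have "dist y (x j) < s j" by (simp add: dist_commute)
      then have pos: "0 < (s j)\<^sup>2 - (dist y (x j))\<^sup>2"
        by (simp add: power_strict_mono)
      have le: "(\<Prod>i\<le>n. 1 - g n i y) \<le> 1 - g n j y" if "j \<le> n" for n
      proof -
        have "(\<Prod>i\<le>n. 1 - g n i y) = (1 - g n j y) * (\<Prod>i\<in>{..n} - {j}. 1 - g n i y)"
          using that by (intro prod.remove) auto
        also have "\<dots> \<le> (1 - g n j y) * 1"
          using g by (intro mult_left_mono prod_le_1) auto
        finally show ?thesis by simp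
      qed
      have lower: "(\<lambda>n. g n j y) \<longlonglongrightarrow> 1"
      proof (rule Lim_transform_eventually)
        show "eventually (\<lambda>n. exp (- (inverse ((s j)\<^sup>2 - (dist y (x j))\<^sup>2)) * inverse (real n)) = g n j y) sequentially"
          using eventually_gt_at_top[of 0]
          by eventually_elim (use pos in \<open>auto simp: g_def flat_def divide_inverse mult.commute\<close>)
        have "(\<lambda>n. - (inverse ((s j)\<^sup>2 - (dist y (x j))\<^sup>2)) * inverse (real n)) \<longlonglongrightarrow> - (inverse ((s j)\<^sup>2 - (dist y (x j))\<^sup>2)) * 0"
          by (intro tendsto_intros lim_inverse_n)
        then show "(\<lambda>n. exp (- (inverse ((s j)\<^sup>2 - (dist y (x j))\<^sup>2)) * inverse (real n))) \<longlonglongrightarrow> 1"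
          using tendsto_exp by fastforce
      qed
      have ge: "eventually (\<lambda>n. g n j y \<le> \<psi> n y) sequentially"
        using eventually_ge_at_top[of j]
        by eventually_elim (use le in \<open>force simp: \<psi>_def\<close>)
      have upper: "eventually (\<lambda>n. \<psi> n y \<le> 1) sequentially"
        by (simp add: \<psi>_def prod_nonneg g(2))
      have "(\<lambda>n. \<psi> n y) \<longlonglongrightarrow> 1"
        by (rule tendsto_sandwich[OF ge upper lower tendsto_const])
      then show ?thesis using True by simp
    qed
  qed
qed

text \<open>The fundamental lemma of the calculus of variations. Dominated convergence along the
  approximants of indicators gives integral 0 over every open set, Dynkin's theorem extends this to
  all Borel sets, and a function with all these integrals zero vanishes almost everywhere.\<close>

lemma AE_eq_0_if_test_orthogonal:
  fixes f :: "'a::euclidean_space \<Rightarrow> real"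
  assumes "open \<Omega>" and f: "integrable (lebesgue_on \<Omega>) f"
    and orth: "\<And>\<phi>. \<phi> \<in> test_functions \<Omega> \<Longrightarrow> (\<integral>x. f x * \<phi> x \<partial>lebesgue_on \<Omega>) = 0"
  shows "AE x in lebesgue_on \<Omega>. f x = 0"
proof -
  have \<Omega>: "\<Omega> \<in> sets lebesgue" using \<open>open \<Omega>\<close> by auto
  have fm: "f \<in> borel_measurable (lebesgue_on \<Omega>)" using f by simp
  have int_open: "(\<integral>x. indicator U x * f x \<partial>lebesgue_on \<Omega>) = 0" if "open U" for U
  proof -
    obtain \<psi> where \<psi>: "\<And>n::nat. \<psi> n \<in> test_functions \<Omega>" "\<And>n x. 0 \<le> \<psi> n x" "\<And>n x. \<psi> n x \<le> 1"
      "\<And>x. (\<lambda>n. \<psi> n x) \<longlonglongrightarrow> indicator (U \<inter> \<Omega>) x"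
      by (rule open_indicator_limit_test[of "U \<inter> \<Omega>" \<Omega>]) (use \<open>open U\<close> \<open>open \<Omega>\<close> in auto)
    have "(\<lambda>n. \<integral>x. f x * \<psi> n x \<partial>lebesgue_on \<Omega>)
        \<longlonglongrightarrow> (\<integral>x. f x * indicator (U \<inter> \<Omega>) x \<partial>lebesgue_on \<Omega>)"
    proof (rule integral_dominated_convergence)
      have "indicat_real (U \<inter> \<Omega>) \<in> borel_measurable (lebesgue_on \<Omega>)"
        using that \<open>open \<Omega>\<close>
        by (intro borel_imp_lebesgue_on borel_measurable_indicator borel_open open_Int)
      then show "(\<lambda>x. f x * indicator (U \<inter> \<Omega>) x) \<in> borel_measurable (lebesgue_on \<Omega>)"
        using fm by simp
      show "(\<lambda>x. f x * \<psi> n x) \<in> borel_measurable (lebesgue_on \<Omega>)" for n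
        using fm borel_imp_lebesgue_on[OF test_measurable[OF \<psi>(1)[of n]], of \<Omega>] by simp
      show "integrable (lebesgue_on \<Omega>) (\<lambda>x. \<bar>f x\<bar>)" using f by simp
      show "AE x in lebesgue_on \<Omega>. (\<lambda>n. f x * \<psi> n x) \<longlonglongrightarrow> f x * indicator (U \<inter> \<Omega>) x"
        by (intro AE_I2 tendsto_intros \<psi>(4))
      show "AE x in lebesgue_on \<Omega>. norm (f x * \<psi> n x) \<le> \<bar>f x\<bar>" for n
        using \<psi>(2,3)[of n] by (intro AE_I2) (simp add: abs_mult mult_left_le)
    qed
    then have "(\<integral>x. f x * indicator (U \<inter> \<Omega>) x \<partial>lebesgue_on \<Omega>) = 0"
      by (simp only: orth[OF \<psi>(1)] LIMSEQ_const_iff)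
    also have "(\<integral>x. f x * indicator (U \<inter> \<Omega>) x \<partial>lebesgue_on \<Omega>) = (\<integral>x. indicator U x * f x \<partial>lebesgue_on \<Omega>)"
      by (intro Bochner_Integration.integral_cong) (auto simp: indicator_def)
    finally show ?thesis .
  qed
  define F where "F = (\<lambda>x. indicat_real \<Omega> x * f x)"
  have F: "integrable lebesgue F"
    using f \<Omega> unfolding F_def by (simp add: integrable_restrict_space)
  then obtain F' where F'm: "F' \<in> borel_measurable lborel" and FF: "AE x in lborel. F x = F' x"
    using completion_ex_borel_measurable_real[of F lborel] by auto
  then have FF': "AE x in lebesgue. F x = F' x" by (simp add: AE_completion)
  have F'ml: "F' \<in> borel_measurable lebesgue" using F'm by (simp add: measurable_completion)
  have "integrable lebesgue F'"
    using F FF' F'ml by (metis (no_types) borel_measurable_integrable integrable_cong_AE)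
  then have F': "integrable lborel F'"
    using F'm by (simp add: integrable_completion)
  have F'_open: "(\<integral>x\<in>U. F' x \<partial>lborel) = 0" if "open U" for U
  proof -
    have m: "(\<lambda>x. indicator U x *\<^sub>R F' x) \<in> borel_measurable lborel" using that F'm by simp
    have "(\<integral>x\<in>U. F' x \<partial>lborel) = (\<integral>x. indicator U x *\<^sub>R F' x \<partial>lebesgue)"
      unfolding set_lebesgue_integral_def using m by (simp add: integral_completion)
    also have "\<dots> = (\<integral>x. indicator \<Omega> x *\<^sub>R (indicator U x * f x) \<partial>lebesgue)"
    proof (rule integral_cong_AE)
      show "(\<lambda>x. indicator U x *\<^sub>R F' x) \<in> borel_measurable lebesgue" using m by (simp add: measurable_completion)
      have "U \<in> sets lebesgue" using that by auto
      then have "indicat_real U \<in> borel_measurable lebesgue" by simp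
      moreover have "F \<in> borel_measurable lebesgue" using F by simp
      ultimately have "(\<lambda>x. indicator U x * F x) \<in> borel_measurable lebesgue" by simp
      then show "(\<lambda>x. indicator \<Omega> x *\<^sub>R (indicator U x * f x)) \<in> borel_measurable lebesgue"
        by (simp add: F_def mult_ac)
      show "AE x in lebesgue. indicat_real U x *\<^sub>R F' x = indicat_real \<Omega> x *\<^sub>R (indicat_real U x * f x)"
        using FF' by eventually_elim (auto simp: F_def)
    qed
    also have "\<dots> = (\<integral>x. indicator U x * f x \<partial>lebesgue_on \<Omega>)"
      using \<Omega> by (simp add: integral_restrict_space)
    finally show ?thesis using int_open[OF that] by simp
  qed
  have F'_zero: "(\<integral>x\<in>A. F' x \<partial>lborel) = 0" if "A \<in> sets borel" for A
  proof -
    have stable: "Int_stable {S::'a set. open S}" by (auto simp: Int_stable_def)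
    have sub: "{S::'a set. open S} \<subseteq> Pow UNIV" by simp
    have "A \<in> sigma_sets UNIV {S. open S}"
      using that unfolding borel_def by simp
    from stable sub this show ?thesis
    proof (induction A rule: sigma_sets_induct_disjoint)
      case (compl A)
      then have "A \<in> sets lborel" by (simp add: borel_def)
      have 1: "set_integrable lborel S F'" if "S \<in> sets lborel" for S
        unfolding set_integrable_def using F' that by (intro integrable_mult_indicator)
      have "(\<integral>x\<in>(UNIV - A) \<union> A. F' x \<partial>lborel) = (\<integral>x\<in>UNIV - A. F' x \<partial>lborel) + (\<integral>x\<in>A. F' x \<partial>lborel)"
        using \<open>A \<in> sets lborel\<close> by (intro set_integral_Un 1) auto
      then show ?case using compl F'_open[of UNIV] by simp
    next
      case (union A)
      have m: "A i \<in> sets lborel" for i using union(2) by (auto simp: borel_def)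
      have "(\<integral>x\<in>(\<Union>i. A i). F' x \<partial>lborel) = (\<Sum>i. (\<integral>x\<in>A i. F' x \<partial>lborel))"
      proof (rule lebesgue_integral_countable_add)
        show "i \<noteq> j \<Longrightarrow> A i \<inter> A j = {}" for i j
          using union(1) by (auto simp: disjoint_family_on_def)
        show "set_integrable lborel (\<Union> (range A)) F'"
          unfolding set_integrable_def using F' m by (intro integrable_mult_indicator) auto
      qed (use m in auto)
      then show ?case using union(3) by simp
    qed (auto simp: F'_open)
  qed
  have "AE x in lborel. F' x = 0"
    by (rule density_unique_real[OF F', of "\<lambda>x. 0"]) (auto simp: F'_zero)
  then have "AE x in lebesgue. F x = 0"
    using FF' by (auto dest: AE_completion elim: eventually_elim2)
  then show ?thesis
    using \<Omega> unfolding F_def by (simp add: AE_restrict_space_iff) (auto elim: eventually_mono)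
qed


section \<open>Square-integrable functions\<close>

text \<open>The real-valued counterpart of \<open>L2_space\<close>, for an arbitrary measure:
  expanding squares involves subtraction, for which the extended norms are unsuitable.\<close>

definition sq_int :: "'a measure \<Rightarrow> ('a \<Rightarrow> 'b::euclidean_space) \<Rightarrow> bool" where
  "sq_int M f \<longleftrightarrow> f \<in> borel_measurable M \<and> integrable M (\<lambda>x. (norm (f x))\<^sup>2)"

lemma sq_intD: "sq_int M f \<Longrightarrow> f \<in> borel_measurable M" "sq_int M f \<Longrightarrow> integrable M (\<lambda>x. (norm (f x))\<^sup>2)"
  by (auto simp: sq_int_def)

lemma L2_space_iff: "f \<in> L2_space S \<longleftrightarrow> sq_int (lebesgue_on S) f"
  by (auto simp: L2_space_def L2_norm_sq_def sq_int_def integrable_iff_bounded)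

lemma L2_norm_sq_eq:
  "sq_int (lebesgue_on S) f \<Longrightarrow> L2_norm_sq S f = ennreal (\<integral>x. (norm (f x))\<^sup>2 \<partial>lebesgue_on S)"
  unfolding L2_norm_sq_def sq_int_def by (auto intro: nn_integral_eq_integral)

lemma sq_int_inner:
  assumes f: "sq_int M f" and g: "sq_int M g"
  shows "integrable M (\<lambda>x. f x \<bullet> g x)"
proof (rule Bochner_Integration.integrable_bound)
  show "integrable M (\<lambda>x. (norm (f x))\<^sup>2 + (norm (g x))\<^sup>2)"
    using f g by (intro Bochner_Integration.integrable_add sq_intD)
  show "(\<lambda>x. f x \<bullet> g x) \<in> borel_measurable M"
    using f g by (intro borel_measurable_inner sq_intD)
  show "AE x in M. norm (f x \<bullet> g x) \<le> norm ((norm (f x))\<^sup>2 + (norm (g x))\<^sup>2)"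
  proof (rule AE_I2)
    fix x
    have "norm (f x \<bullet> g x) \<le> norm (f x) * norm (g x)"
      using Cauchy_Schwarz_ineq2 by simp
    also have "\<dots> \<le> (norm (f x))\<^sup>2 + (norm (g x))\<^sup>2"
      using sum_squares_bound[of "norm (f x)" "norm (g x)"]
        mult_nonneg_nonneg[OF norm_ge_zero[of "f x"] norm_ge_zero[of "g x"]] by linarith
    finally show "norm (f x \<bullet> g x) \<le> norm ((norm (f x))\<^sup>2 + (norm (g x))\<^sup>2)" by simp
  qed
qed

lemma sq_int_scaleR: "sq_int M f \<Longrightarrow> sq_int M (\<lambda>x. c *\<^sub>R f x)"
  by (auto simp: sq_int_def power_mult_distrib)

lemma sq_int_add:
  assumes f: "sq_int M f" and g: "sq_int M g"
  shows "sq_int M (\<lambda>x. f x + g x)"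
proof -
  have "(\<lambda>x. (norm (f x + g x))\<^sup>2) = (\<lambda>x. (norm (f x))\<^sup>2 + 2 * (f x \<bullet> g x) + (norm (g x))\<^sup>2)"
    by (simp add: power2_norm_eq_inner algebra_simps inner_commute)
  moreover have "integrable M (\<lambda>x. (norm (f x))\<^sup>2 + 2 * (f x \<bullet> g x) + (norm (g x))\<^sup>2)"
    using f g by (intro Bochner_Integration.integrable_add integrable_mult_right sq_int_inner sq_intD)
  ultimately show ?thesis
    using sq_intD(1)[OF f] sq_intD(1)[OF g] by (simp add: sq_int_def)
qed

lemma sq_int_diff: "sq_int M f \<Longrightarrow> sq_int M g \<Longrightarrow> sq_int M (\<lambda>x. f x - g x)"
  using sq_int_add[of M f "\<lambda>x. (-1) *\<^sub>R g x"] sq_int_scaleR[of M g "-1"] by simp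

lemma integral_norm_add_sq:
  assumes f: "sq_int M f" and g: "sq_int M g"
  shows "(\<integral>x. (norm (f x + t *\<^sub>R g x))\<^sup>2 \<partial>M)
    = (\<integral>x. (norm (f x))\<^sup>2 \<partial>M) + 2 * t * (\<integral>x. f x \<bullet> g x \<partial>M) + t\<^sup>2 * (\<integral>x. (norm (g x))\<^sup>2 \<partial>M)"
proof -
  have "(\<lambda>x. (norm (f x + t *\<^sub>R g x))\<^sup>2)
      = (\<lambda>x. (norm (f x))\<^sup>2 + (2 * t) * (f x \<bullet> g x) + t\<^sup>2 * (norm (g x))\<^sup>2)"
    unfolding power2_norm_eq_inner
    by (simp add: inner_add_left inner_add_right inner_commute power2_eq_square algebra_simps)
  then show ?thesis
    using sq_int_inner[OF f g] sq_intD(2)[OF f] sq_intD(2)[OF g]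
    by (simp add: Bochner_Integration.integral_add Bochner_Integration.integrable_add)
qed

text \<open>Evaluate at the minimum t = -b/c; for c = 0 an affine function is nonnegative only if
  its slope vanishes. Besides Cauchy-Schwarz this serves the Euler-Lagrange equation, where a = 0
  forces b = 0.\<close>

lemma nonneg_quadratic_imp_discrim:
  fixes a b c :: real
  assumes "\<And>t. 0 \<le> a + 2 * t * b + t\<^sup>2 * c" "0 \<le> c"
  shows "b\<^sup>2 \<le> a * c"
proof (cases "c = 0")
  case True
  show ?thesis
  proof (cases "b = 0")
    case False
    with assms(1)[of "- (a + 1) / (2 * b)"] True have "0 \<le> a + (- (2 * a) - 2) / 2" by simp
    then have False by (simp add: field_simps)
    then show ?thesis ..
  qed (use True in simp)
next
  case False
  have "0 \<le> (a + 2 * (- b / c) * b + (- b / c)\<^sup>2 * c) * c"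
    using assms by (intro mult_nonneg_nonneg) 
  also have "\<dots> = a * c - b\<^sup>2"
    using False by (simp add: field_simps power2_eq_square)
  finally show ?thesis by simp
qed

lemma Cauchy_Schwarz_integral:
  assumes f: "sq_int M f" and g: "sq_int M g"
  shows "(\<integral>x. f x \<bullet> g x \<partial>M)\<^sup>2 \<le> (\<integral>x. (norm (f x))\<^sup>2 \<partial>M) * (\<integral>x. (norm (g x))\<^sup>2 \<partial>M)"
proof (rule nonneg_quadratic_imp_discrim)
  show "0 \<le> (\<integral>x. (norm (f x))\<^sup>2 \<partial>M) + 2 * t * (\<integral>x. f x \<bullet> g x \<partial>M) + t\<^sup>2 * (\<integral>x. (norm (g x))\<^sup>2 \<partial>M)" for t
    unfolding integral_norm_add_sq[OF f g, symmetric] by simp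
qed simp

section \<open>Limits and completeness in L2\<close>

lemma L2_limit_inner:
  assumes f: "\<And>n. sq_int M (f n)" and g: "sq_int M g" and h: "sq_int M h"
    and lim: "(\<lambda>n. \<integral>x. (norm (f n x - g x))\<^sup>2 \<partial>M) \<longlonglongrightarrow> 0"
  shows "(\<lambda>n. \<integral>x. f n x \<bullet> h x \<partial>M) \<longlonglongrightarrow> (\<integral>x. g x \<bullet> h x \<partial>M)"
proof -
  have fg: "sq_int M (\<lambda>x. f n x - g x)" for n by (rule sq_int_diff[OF f g])
  have eq: "(\<integral>x. f n x \<bullet> h x \<partial>M) - (\<integral>x. g x \<bullet> h x \<partial>M) = (\<integral>x. (f n x - g x) \<bullet> h x \<partial>M)" for n
    by (simp add: inner_diff_left Bochner_Integration.integral_diff[OF sq_int_inner[OF f h] sq_int_inner[OF g h]])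
  have up: "(\<lambda>n. sqrt ((\<integral>x. (norm (f n x - g x))\<^sup>2 \<partial>M) * (\<integral>x. (norm (h x))\<^sup>2 \<partial>M)))
      \<longlonglongrightarrow> sqrt (0 * (\<integral>x. (norm (h x))\<^sup>2 \<partial>M))"
    by (intro tendsto_intros lim)
  have le: "norm ((\<integral>x. f n x \<bullet> h x \<partial>M) - (\<integral>x. g x \<bullet> h x \<partial>M))
      \<le> sqrt ((\<integral>x. (norm (f n x - g x))\<^sup>2 \<partial>M) * (\<integral>x. (norm (h x))\<^sup>2 \<partial>M))" for n
    unfolding eq real_norm_def real_sqrt_abs[symmetric]
    by (intro real_sqrt_le_mono Cauchy_Schwarz_integral fg h)
  have "(\<lambda>n. (\<integral>x. f n x \<bullet> h x \<partial>M) - (\<integral>x. g x \<bullet> h x \<partial>M)) \<longlonglongrightarrow> 0"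
    by (rule Lim_null_comparison[OF always_eventually up[unfolded mult_zero_left real_sqrt_zero]])
       (intro allI le)
  then show ?thesis by (simp add: LIM_zero_iff)
qed

lemma sq_int_bounded:
  assumes "finite_measure M" "f \<in> borel_measurable M" "\<And>x. norm (f x) \<le> B"
  shows "sq_int M f"
  unfolding sq_int_def
proof
  show "integrable M (\<lambda>x. (norm (f x))\<^sup>2)"
  proof (rule finite_measure.integrable_const_bound[OF assms(1)])
    show "AE x in M. norm ((norm (f x))\<^sup>2) \<le> B\<^sup>2"
      using assms(3) by (intro AE_I2) (simp add: power_mono)
  qed (use assms(2) in measurable)
qed fact

lemma sq_int_integrable:
  fixes f :: "'a \<Rightarrow> real"
  assumes "finite_measure M" "sq_int M f"
  shows "integrable M f"
proof -
  have "sq_int M (\<lambda>x. 1::real)" by (rule sq_int_bounded[OF assms(1), of _ 1]) auto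
  from sq_int_inner[OF assms(2) this] show ?thesis by simp
qed

lemma integral_abs_le_L2:
  fixes f :: "'a \<Rightarrow> 'b::euclidean_space"
  assumes "finite_measure M" "sq_int M f"
  shows "integrable M (\<lambda>x. norm (f x))"
    "(\<integral>x. norm (f x) \<partial>M)\<^sup>2 \<le> (\<integral>x. (norm (f x))\<^sup>2 \<partial>M) * measure M (space M)"
proof -
  have 1: "sq_int M (\<lambda>x. 1::real)" by (rule sq_int_bounded[OF assms(1), of _ 1]) auto
  have f: "sq_int M (\<lambda>x. norm (f x))"
    using assms(2) by (auto simp: sq_int_def)
  show "integrable M (\<lambda>x. norm (f x))" by (rule sq_int_integrable[OF assms(1) f])
  show "(\<integral>x. norm (f x) \<partial>M)\<^sup>2 \<le> (\<integral>x. (norm (f x))\<^sup>2 \<partial>M) * measure M (space M)"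
    using Cauchy_Schwarz_integral[OF f 1] by simp
qed

text \<open>Riesz-Fischer for a sequence with a geometric rate. On a finite measure space the L1
  norms of successive differences are at most the square roots of the bounds, of order 2^-n, hence
  summable; this gives convergence almost everywhere. Fatou's lemma then passes the Cauchy bound to
  the limit with the same constant.\<close>

lemma L2_complete:
  fixes f :: "nat \<Rightarrow> 'a \<Rightarrow> 'b::euclidean_space"
  assumes fin: "finite_measure M" and f: "\<And>n. sq_int M (f n)"
    and Cauchy: "\<And>n k. n \<le> k \<Longrightarrow> (\<integral>x. (norm (f k x - f n x))\<^sup>2 \<partial>M) \<le> C * (1 / 4) ^ n"
  obtains g where "sq_int M g" "\<And>n. (\<integral>x. (norm (f n x - g x))\<^sup>2 \<partial>M) \<le> C * (1 / 4) ^ n"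
proof -
  have fm[measurable]: "f n \<in> borel_measurable M" for n using f by (rule sq_intD)
  have fd: "sq_int M (\<lambda>x. f k x - f n x)" for n k by (rule sq_int_diff[OF f f])
  define K where "K = sqrt (C * measure M (space M))"
  have C: "0 \<le> C" using order_trans[OF _ Cauchy[of 0 0]] by simp
  have L1: "(\<integral>x. norm (f (Suc n) x - f n x) \<partial>M) \<le> K * (1 / 2) ^ n" for n
  proof (rule power2_le_imp_le)
    have "(\<integral>x. norm (f (Suc n) x - f n x) \<partial>M)\<^sup>2
        \<le> (\<integral>x. (norm (f (Suc n) x - f n x))\<^sup>2 \<partial>M) * measure M (space M)"
      by (rule integral_abs_le_L2[OF fin fd])
    also have "\<dots> \<le> (C * (1 / 4) ^ n) * measure M (space M)"
      by (intro mult_right_mono Cauchy) auto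
    also have "\<dots> = (K * (1 / 2) ^ n)\<^sup>2"
    proof -
      have "((1 / 2) ^ n)\<^sup>2 = (1 / 4 :: real) ^ n"
        by (simp add: power_mult_distrib power2_eq_square flip: power_mult_distrib)
      then show ?thesis using C by (simp add: K_def power_mult_distrib)
    qed
    finally show "(\<integral>x. norm (f (Suc n) x - f n x) \<partial>M)\<^sup>2 \<le> (K * (1 / 2) ^ n)\<^sup>2" .
  qed (use C in \<open>simp add: K_def\<close>)
  have "(\<integral>\<^sup>+x. (\<Sum>n. ennreal (norm (f (Suc n) x - f n x))) \<partial>M)
      = (\<Sum>n. \<integral>\<^sup>+x. ennreal (norm (f (Suc n) x - f n x)) \<partial>M)"
    by (intro nn_integral_suminf) measurable
  also have "\<dots> = (\<Sum>n. ennreal (\<integral>x. norm (f (Suc n) x - f n x) \<partial>M))"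
    by (intro suminf_cong nn_integral_eq_integral integral_abs_le_L2[OF fin fd]) auto
  also have "\<dots> \<noteq> top"
  proof (rule ennreal_suminf_neq_top)
    show "summable (\<lambda>n. \<integral>x. norm (f (Suc n) x - f n x) \<partial>M)"
    proof (rule summable_comparison_test')
      show "summable (\<lambda>n. K * (1 / 2) ^ n)" by (intro summable_mult summable_geometric) simp
      show "norm (\<integral>x. norm (f (Suc n) x - f n x) \<partial>M) \<le> K * (1 / 2) ^ n" if "0 \<le> n" for n
        using L1[of n] by simp
    qed
  qed simp
  finally have "AE x in M. (\<Sum>n. ennreal (norm (f (Suc n) x - f n x))) \<noteq> \<infinity>"
    by (intro nn_integral_PInf_AE) (auto intro: borel_measurable_suminf)
  then have conv: "AE x in M. (\<lambda>n. f n x) \<longlonglongrightarrow> lim (\<lambda>n. f n x)"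
  proof eventually_elim
    case (elim x)
    then have "summable (\<lambda>n. norm (f (Suc n) x - f n x))"
      by (intro summable_suminf_not_top) auto
    then have "summable (\<lambda>n. f (Suc n) x - f n x)"
      by (rule summable_norm_cancel)
    then have "convergent (\<lambda>n. \<Sum>i<n. f (Suc i) x - f i x)"
      using summable_iff_convergent by blast
    then have "convergent (\<lambda>n. f n x - f 0 x)"
      by (simp only: sum_lessThan_telescope[of "\<lambda>n. f n x"])
    then have "convergent (\<lambda>n. (f n x - f 0 x) + f 0 x)"
      by (intro convergent_add convergent_const)
    then show ?case by (simp add: convergent_LIMSEQ_iff)
  qed
  define g where "g = (\<lambda>x. lim (\<lambda>n. f n x))"
  have gm[measurable]: "g \<in> borel_measurable M"
    unfolding g_def by (intro borel_measurable_lim_metric fm)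
  have bound: "(\<integral>\<^sup>+x. ennreal ((norm (g x - f n x))\<^sup>2) \<partial>M) \<le> ennreal (C * (1 / 4) ^ n)" for n
  proof -
    have "(\<integral>\<^sup>+x. ennreal ((norm (g x - f n x))\<^sup>2) \<partial>M)
        = (\<integral>\<^sup>+x. liminf (\<lambda>k. ennreal ((norm (f k x - f n x))\<^sup>2)) \<partial>M)"
    proof (rule nn_integral_cong_AE)
      show "AE x in M. ennreal ((norm (g x - f n x))\<^sup>2) = liminf (\<lambda>k. ennreal ((norm (f k x - f n x))\<^sup>2))"
        using conv
      proof eventually_elim
        case (elim x)
        then have "(\<lambda>k. f k x) \<longlonglongrightarrow> g x" by (simp add: g_def)
        then have "(\<lambda>k. ennreal ((norm (f k x - f n x))\<^sup>2)) \<longlonglongrightarrow> ennreal ((norm (g x - f n x))\<^sup>2)"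
          by (intro tendsto_ennrealI tendsto_intros)
        then show ?case by (rule lim_imp_Liminf[OF sequentially_bot, symmetric])
      qed
    qed
    also have "\<dots> \<le> liminf (\<lambda>k. \<integral>\<^sup>+x. ennreal ((norm (f k x - f n x))\<^sup>2) \<partial>M)"
      by (intro nn_integral_liminf) measurable
    also have "\<dots> = liminf (\<lambda>k. ennreal (\<integral>x. (norm (f k x - f n x))\<^sup>2 \<partial>M))"
      by (intro arg_cong[where f = liminf] ext nn_integral_eq_integral sq_intD(2)[OF fd]) simp
    also have "\<dots> \<le> ennreal (C * (1 / 4) ^ n)"
    proof (rule Liminf_le)
      show "eventually (\<lambda>k. ennreal (\<integral>x. (norm (f k x - f n x))\<^sup>2 \<partial>M) \<le> ennreal (C * (1 / 4) ^ n)) sequentially"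
        using eventually_ge_at_top[of n]
        by eventually_elim (intro ennreal_leI Cauchy)
    qed simp
    finally show ?thesis .
  qed
  have gf: "sq_int M (\<lambda>x. g x - f n x)" for n
  proof -
    have "(\<integral>\<^sup>+x. ennreal ((norm (g x - f n x))\<^sup>2) \<partial>M) < \<infinity>"
      using le_less_trans[OF bound[of n]] by simp
    then show ?thesis unfolding sq_int_def integrable_iff_bounded by simp
  qed
  show thesis
  proof
    show "sq_int M g" using sq_int_add[OF gf[of 0] f[of 0]] by simp
    fix n
    have "ennreal (\<integral>x. (norm (g x - f n x))\<^sup>2 \<partial>M) \<le> ennreal (C * (1 / 4) ^ n)"
      using bound[of n] nn_integral_eq_integral[OF sq_intD(2)[OF gf[of n]]] by simp
    then show "(\<integral>x. (norm (f n x - g x))\<^sup>2 \<partial>M) \<le> C * (1 / 4) ^ n"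
      using C by (simp add: norm_minus_commute)
  qed
qed

lemma L2_limit_norm:
  assumes f: "\<And>n. sq_int M (f n)" and g: "sq_int M g"
    and lim: "(\<lambda>n. \<integral>x. (norm (f n x - g x))\<^sup>2 \<partial>M) \<longlonglongrightarrow> 0"
  shows "(\<lambda>n. \<integral>x. (norm (f n x))\<^sup>2 \<partial>M) \<longlonglongrightarrow> (\<integral>x. (norm (g x))\<^sup>2 \<partial>M)"
proof -
  have eq: "(\<integral>x. (norm (f n x))\<^sup>2 \<partial>M) = (\<integral>x. (norm (f n x - g x))\<^sup>2 \<partial>M)
      + 2 * (\<integral>x. f n x \<bullet> g x \<partial>M) - (\<integral>x. (norm (g x))\<^sup>2 \<partial>M)" for n
  proof -
    have "(\<integral>x. (norm (f n x + (-1) *\<^sub>R g x))\<^sup>2 \<partial>M) = (\<integral>x. (norm (f n x))\<^sup>2 \<partial>M)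
        + 2 * (-1) * (\<integral>x. f n x \<bullet> g x \<partial>M) + (-1)\<^sup>2 * (\<integral>x. (norm (g x))\<^sup>2 \<partial>M)"
      by (rule integral_norm_add_sq[OF f g])
    then show ?thesis by simp
  qed
  have "(\<lambda>n. (\<integral>x. (norm (f n x - g x))\<^sup>2 \<partial>M)
      + 2 * (\<integral>x. f n x \<bullet> g x \<partial>M) - (\<integral>x. (norm (g x))\<^sup>2 \<partial>M))
      \<longlonglongrightarrow> 0 + 2 * (\<integral>x. g x \<bullet> g x \<partial>M) - (\<integral>x. (norm (g x))\<^sup>2 \<partial>M)"
    by (intro tendsto_intros lim L2_limit_inner[OF f g g lim])
  then show ?thesis
    unfolding eq by (simp add: power2_norm_eq_inner)
qed

lemma tendsto_geometric_quarter: "(\<lambda>n. C * (1 / 4) ^ n) \<longlonglongrightarrow> (0::real)"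
  using tendsto_mult_right_zero[OF LIMSEQ_power_zero[of "1/4::real"], of C] by simp

lemma L2_limit_AE_subseq:
  assumes f: "\<And>n. sq_int M (f n)" and g: "sq_int M g"
    and lim: "(\<lambda>n. \<integral>x. (norm (f n x - g x))\<^sup>2 \<partial>M) \<longlonglongrightarrow> 0"
  shows "\<exists>r::nat \<Rightarrow> nat. strict_mono r \<and> (AE x in M. (\<lambda>n. f (r n) x) \<longlonglongrightarrow> g x)"
proof -
  have "\<exists>r::nat\<Rightarrow>nat. strict_mono r \<and> (AE x in M. (\<lambda>n. (norm (f (r n) x - g x))\<^sup>2) \<longlonglongrightarrow> 0)"
  proof (rule tendsto_L1_AE_subseq)
    show "integrable M (\<lambda>x. (norm (f n x - g x))\<^sup>2)" for n
      by (rule sq_intD(2)[OF sq_int_diff[OF f g]])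
    show "(\<lambda>n. \<integral>x. norm ((norm (f n x - g x))\<^sup>2) \<partial>M) \<longlonglongrightarrow> 0"
      using lim by simp
  qed
  then obtain r :: "nat \<Rightarrow> nat" where r: "strict_mono r"
    and AE: "AE x in M. (\<lambda>n. (norm (f (r n) x - g x))\<^sup>2) \<longlonglongrightarrow> 0"
    by blast
  have "AE x in M. (\<lambda>n. f (r n) x) \<longlonglongrightarrow> g x"
    using AE
  proof eventually_elim
    case (elim x)
    then have "(\<lambda>n. sqrt ((norm (f (r n) x - g x))\<^sup>2)) \<longlonglongrightarrow> sqrt 0"
      by (rule tendsto_real_sqrt)
    then have "(\<lambda>n. norm (f (r n) x - g x)) \<longlonglongrightarrow> 0"
      by (simp only: real_sqrt_abs real_sqrt_zero abs_norm_cancel)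
    then have "(\<lambda>n. f (r n) x - g x) \<longlonglongrightarrow> 0"
      by (rule tendsto_norm_zero_cancel)
    then show ?case by (rule LIM_zero_cancel)
  qed
  with r show ?thesis by (intro exI conjI)
qed


section \<open>The first zero of the Bessel function\<close>

text \<open>The coefficients of the hypergeometric series 0F1(; a; -t). With a = \<nu> + 1 and t =
  x^2/4 it is J_\<nu>(x) stripped of the power of x/2 and the Gamma factor, so that both have the
  same positive zeros.\<close>

definition bessel_coeff :: "real \<Rightarrow> nat \<Rightarrow> real" where
  "bessel_coeff a k = (- 1) ^ k / (fact k * pochhammer a k)"

definition bessel_series :: "real \<Rightarrow> real \<Rightarrow> real" where
  "bessel_series a t = (\<Sum>k. bessel_coeff a k * t ^ k)"

definition bessel_series_deriv :: "real \<Rightarrow> real \<Rightarrow> real" where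
  "bessel_series_deriv a t = (\<Sum>k. diffs (bessel_coeff a) k * t ^ k)"

text \<open>A positive lower bound independent of k, so that the series is dominated by an
  exponential series.\<close>

lemma pochhammer_ge_min:
  fixes a :: real
  assumes "0 < a"
  shows "min 1 a \<le> pochhammer a k"
proof (cases k)
  case (Suc n)
  have "a \<le> pochhammer a (Suc n)"
  proof (induction n)
    case (Suc n)
    have "pochhammer a (Suc n) * 1 \<le> pochhammer a (Suc n) * (a + real (Suc n))"
      using assms by (intro mult_left_mono) (auto simp: pochhammer_nonneg)
    also have "\<dots> = pochhammer a (Suc (Suc n))" by (simp only: pochhammer_Suc)
    finally show ?case using Suc.IH by simp
  qed simp
  then show ?thesis using Suc by simp
qed simp

lemma summable_bessel_coeff:
  assumes "0 < a"
  shows "summable (\<lambda>k. bessel_coeff a k * t ^ k)"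
proof (rule summable_comparison_test')
  show "summable (\<lambda>k. (1 / min 1 a) * (inverse (fact k) * \<bar>t\<bar> ^ k))"
    by (intro summable_mult summable_exp)
  fix k :: nat
  have p: "0 < min 1 a" "min 1 a \<le> pochhammer a k" using assms pochhammer_ge_min by auto
  then have "norm (bessel_coeff a k * t ^ k) = (1 / pochhammer a k) * (inverse (fact k) * \<bar>t\<bar> ^ k)"
    by (simp add: bessel_coeff_def abs_mult power_abs divide_inverse)
  also have "\<dots> \<le> (1 / min 1 a) * (inverse (fact k) * \<bar>t\<bar> ^ k)"
    using p by (intro mult_right_mono divide_left_mono mult_pos_pos) auto
  finally show "norm (bessel_coeff a k * t ^ k) \<le> (1 / min 1 a) * (inverse (fact k) * \<bar>t\<bar> ^ k)" .
qed

lemma bessel_coeff_Suc: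
  assumes "0 < a"
  shows "real (Suc k) * (a + real k) * bessel_coeff a (Suc k) = - bessel_coeff a k"
proof -
  have "0 < pochhammer a k" using assms by (rule pochhammer_pos)
  then show ?thesis
    using assms by (simp add: bessel_coeff_def pochhammer_Suc divide_simps)
qed

lemma bessel_series_0: "bessel_series a 0 = 1"
  using powser_zero[of "bessel_coeff a"] by (simp add: bessel_series_def bessel_coeff_def)

lemma DERIV_bessel_series:
  "0 < a \<Longrightarrow> (bessel_series a has_real_derivative bessel_series_deriv a t) (at t)"
  unfolding bessel_series_def[abs_def] bessel_series_deriv_def
  by (intro termdiffs_strong_converges_everywhere summable_bessel_coeff)

lemma summable_diffs_bessel:
  assumes "0 < a"
  shows "summable (\<lambda>k. diffs (bessel_coeff a) k * t ^ k)"
    "summable (\<lambda>k. diffs (diffs (bessel_coeff a)) k * t ^ k)"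
proof -
  show 1: "summable (\<lambda>k. diffs (bessel_coeff a) k * t ^ k)" for t
    by (rule termdiff_converges_all) (rule summable_bessel_coeff[OF assms])
  show "summable (\<lambda>k. diffs (diffs (bessel_coeff a)) k * t ^ k)"
    by (rule termdiff_converges_all) (rule 1)
qed

text \<open>The Bessel equation in the variable \<open>t = x\<^sup>2 / 4\<close>.\<close>

lemma bessel_ode:
  assumes "0 < a"
  obtains h where "(bessel_series_deriv a has_real_derivative h) (at t)"
    "t * h + a * bessel_series_deriv a t = - bessel_series a t"
proof
  let ?c = "bessel_coeff a"
  let ?h = "\<Sum>k. diffs (diffs ?c) k * t ^ k"
  show "(bessel_series_deriv a has_real_derivative ?h) (at t)"
    unfolding bessel_series_deriv_def[abs_def]
    by (intro termdiffs_strong_converges_everywhere summable_diffs_bessel assms)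
  have s: "(\<lambda>k. diffs (diffs ?c) k * t ^ k) sums ?h"
    by (rule summable_sums[OF summable_diffs_bessel(2)[OF assms]])
  have "(\<lambda>k. t * (diffs (diffs ?c) k * t ^ k)) sums (t * ?h)"
    by (rule sums_mult[OF s])
  then have "(\<lambda>k. real (Suc k) * diffs ?c (Suc k) * t ^ Suc k) sums (t * ?h)"
    by (simp add: diffs_def mult_ac)
  then have "(\<lambda>k. real k * diffs ?c k * t ^ k) sums (t * ?h)"
    by (subst (asm) sums_Suc_iff) simp
  moreover have "(\<lambda>k. a * (diffs ?c k * t ^ k)) sums (a * bessel_series_deriv a t)"
    unfolding bessel_series_deriv_def
    by (intro sums_mult summable_sums summable_diffs_bessel assms)
  ultimately have "(\<lambda>k. real k * diffs ?c k * t ^ k + a * (diffs ?c k * t ^ k))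
      sums (t * ?h + a * bessel_series_deriv a t)"
    by (rule sums_add)
  moreover have "real k * diffs ?c k * t ^ k + a * (diffs ?c k * t ^ k) = - (?c k * t ^ k)" for k
  proof -
    have "real k * diffs ?c k * t ^ k + a * (diffs ?c k * t ^ k)
        = (real (Suc k) * (a + real k) * ?c (Suc k)) * t ^ k"
      by (simp add: diffs_def algebra_simps)
    also have "\<dots> = - (?c k * t ^ k)" by (simp only: bessel_coeff_Suc[OF assms] mult_minus_left)
    finally show ?thesis .
  qed
  ultimately have "(\<lambda>k. - (?c k * t ^ k)) sums (t * ?h + a * bessel_series_deriv a t)"
    by simp
  moreover have "(\<lambda>k. - (?c k * t ^ k)) sums (- bessel_series a t)"
    unfolding bessel_series_def
    by (intro sums_minus summable_sums summable_bessel_coeff assms)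
  ultimately show "t * ?h + a * bessel_series_deriv a t = - bessel_series a t"
    by (rule sums_unique2)
qed

text \<open>The ratio of consecutive terms has absolute value t / ((k+1)(a+k)), at most 1 for t < a.
  The series is thus alternating with decreasing terms and is bounded below by its first two, 1 -
  t/a. This is the source of 4a \<le> j^2: a zero at t = x^2/4 must satisfy t \<ge> a.\<close>

lemma bessel_series_pos:
  assumes "0 < a" "0 \<le> t" "t < a"
  shows "0 < bessel_series a t"
proof -
  let ?u = "\<lambda>k. t ^ k / (fact k * pochhammer a k)"
  have ppos: "0 < pochhammer a k" for k using assms(1) by (rule pochhammer_pos)
  have eq: "bessel_coeff a k * t ^ k = (- 1) ^ k * ?u k" for k by (simp add: bessel_coeff_def)
  have u_Suc: "?u (Suc k) = ?u k * (t / (real (Suc k) * (a + real k)))" for k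
    by (simp add: pochhammer_Suc mult_ac)
  have "summable (\<lambda>k. norm (bessel_coeff a k * t ^ k))"
  proof -
    have "norm (bessel_coeff a k * t ^ k) = bessel_coeff a k * (- t) ^ k" for k
    proof -
      have "bessel_coeff a k * (- t) ^ k = ((- 1) ^ k * (- 1) ^ k) * t ^ k / (fact k * pochhammer a k)"
        unfolding bessel_coeff_def power_minus[of t] by simp
      also have "(- 1 :: real) ^ k * (- 1) ^ k = 1"
        by (simp flip: power_mult_distrib)
      finally show ?thesis
        using ppos[of k] assms(2) by (simp add: bessel_coeff_def abs_mult)
    qed
    then show ?thesis using summable_bessel_coeff[OF assms(1), of "- t"] by simp
  qed
  then have "(\<lambda>k. norm (bessel_coeff a k * t ^ k)) \<longlonglongrightarrow> 0" by (rule summable_LIMSEQ_zero)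
  moreover have "norm (bessel_coeff a k * t ^ k) = ?u k" for k
    using ppos[of k] assms(2) by (simp add: bessel_coeff_def abs_mult)
  ultimately have lim: "?u \<longlonglongrightarrow> 0" by simp
  have nonneg: "0 \<le> ?u k" for k using ppos[of k] assms(2) by simp
  have mono: "?u (Suc k) \<le> ?u k" for k
  proof -
    have "a * 1 \<le> (a + real k) * real (Suc k)" using assms(1) by (intro mult_mono) auto
    then have "t \<le> real (Suc k) * (a + real k)" using assms(3) by (simp add: mult.commute)
    then have "t / (real (Suc k) * (a + real k)) \<le> 1"
      using assms(1) by (simp add: divide_le_eq_1)
    then show ?thesis unfolding u_Suc using nonneg[of k] by (intro mult_left_le)
  qed
  have "(\<Sum>k<2 * 1. (- 1) ^ k * ?u k) \<le> (\<Sum>k. (- 1) ^ k * ?u k)"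
    by (rule summable_Leibniz'(2)[OF lim nonneg mono])
  moreover have "(\<Sum>k<2 * 1. (- 1) ^ k * ?u k) = 1 - t / a"
    by (simp add: numeral_2_eq_2)
  ultimately have "1 - t / a \<le> bessel_series a t" by (simp add: bessel_series_def eq)
  moreover have "t / a < 1" using assms by simp
  ultimately show ?thesis by linarith
qed

lemma bessel_series_continuous: "0 < a \<Longrightarrow> isCont (bessel_series a) t"
  using DERIV_bessel_series DERIV_isCont by blast

text \<open>
  If the series \<open>G\<close> had no zero, then \<open>(t\<^sup>a G')' = - t\<^bsup>a-1\<^esup> G\<close> would force exponential decay of \<open>G\<close>
  through \<open>G' \<le> - G / a\<close>, but also \<open>G' \<le> - \<delta> t\<^bsup>-a\<^esup>\<close>, hence only polynomial decay.
\<close>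

lemma bessel_series_zero_exists:
  assumes a: "0 < a"
  shows "\<exists>t>0. bessel_series a t = 0"
proof (rule ccontr)
  let ?G = "bessel_series a" and ?H = "bessel_series_deriv a"
  assume "\<not> ?thesis"
  then have nz: "?G t \<noteq> 0" if "0 < t" for t using that by blast
  have pos: "0 < ?G t" if t: "0 < t" for t
  proof (rule ccontr)
    assume "\<not> 0 < ?G t"
    then have "?G t \<le> 0" "0 \<le> ?G 0" by (auto simp: bessel_series_0)
    then obtain s where "0 \<le> s" "s \<le> t" "?G s = 0"
      using IVT2[of ?G t 0 0] t bessel_series_continuous[OF a] by auto
    then show False using nz[of s] bessel_series_0[of a] by (cases "s = 0") auto
  qed
  \<comment> \<open>In terms of U the equation has divergence form, with right-hand side of one sign
    as long as the series is positive.\<close>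
  define U where "U = (\<lambda>t. t powr a * ?H t)"
  have dH: "\<exists>h. (?H has_real_derivative h) (at t)" for t using bessel_ode[OF a] by metis
  have dU: "(U has_real_derivative - (t powr (a - 1) * ?G t)) (at t)" if t: "0 < t" for t
  proof -
    obtain h where h: "(?H has_real_derivative h) (at t)" "t * h + a * ?H t = - ?G t"
      using bessel_ode[OF a] by metis
    have pw: "((\<lambda>t. t powr a) has_real_derivative a * t powr (a - 1)) (at t)"
      using t by (rule has_real_derivative_powr)
    have "(U has_real_derivative t powr a * h + a * t powr (a - 1) * ?H t) (at t)"
      unfolding U_def by (rule DERIV_mult'[OF pw h(1)])
    moreover have "t powr a = t powr (a - 1) * t"
      using t by (simp add: powr_diff)
    then have "t powr a * h + a * t powr (a - 1) * ?H t = t powr (a - 1) * (t * h + a * ?H t)"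
      by (simp add: algebra_simps)
    ultimately show ?thesis using h(2) by simp
  qed
  have cH: "continuous_on S ?H" for S
    using dH DERIV_isCont by (intro continuous_at_imp_continuous_on) blast
  have cG: "continuous_on S ?G" for S
    using bessel_series_continuous[OF a] by (intro continuous_at_imp_continuous_on) blast
  have cpow: "continuous_on {0..t} (\<lambda>t. t powr a)" for t
    using a by (intro continuous_on_powr' continuous_intros) auto
  have cU: "continuous_on {0..t} U" for t
    unfolding U_def by (intro continuous_on_mult cpow cH)
  have U_neg: "U t < 0" if t: "0 < t" for t
  proof -
    have "U t < U 0"
    proof (rule DERIV_neg_imp_decreasing_open[OF t _ cU])
      fix s assume "0 < s" "s < t"
      then show "\<exists>y. (U has_real_derivative y) (at s) \<and> y < 0"
        using dU[of s] pos[of s] by (intro exI[of _ "- (s powr (a - 1) * ?G s)"]) auto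
    qed
    then show ?thesis using a by (simp add: U_def)
  qed
  have H_le: "?H t \<le> - ?G t / a" if t: "0 < t" for t
  proof -
    \<comment> \<open>The coefficient 1/a is chosen so that the terms in t^(a-1) G cancel: V' = U/a
      < 0 and V(0) = 0, and V(t) < 0 is the inequality sought.\<close>
    define V where "V = (\<lambda>t. U t + t powr a * ?G t / a)"
    have "V t < V 0"
    proof (rule DERIV_neg_imp_decreasing_open[OF t])
      fix s assume s: "0 < s" "s < t"
      have "((\<lambda>t. t powr a) has_real_derivative a * s powr (a - 1)) (at s)"
        using s(1) by (rule has_real_derivative_powr)
      from DERIV_add[OF dU[OF s(1)] DERIV_cdivide[OF DERIV_mult'[OF this DERIV_bessel_series[OF a]], of a]]
      have "(V has_real_derivative - (s powr (a - 1) * ?G s)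
          + (s powr a * ?H s + a * s powr (a - 1) * ?G s) / a) (at s)"
        unfolding V_def .
      moreover have "- (s powr (a - 1) * ?G s) + (s powr a * ?H s + a * s powr (a - 1) * ?G s) / a = U s / a"
        using a by (simp add: U_def field_simps)
      moreover have "U s / a < 0" using U_neg[OF s(1)] a by (simp add: divide_neg_pos)
      ultimately show "\<exists>y. (V has_real_derivative y) (at s) \<and> y < 0" by metis
    next
      show "continuous_on {0..t} V"
        unfolding V_def using a by (intro continuous_intros cU cpow cG) auto
    qed
    then have "t powr a * (?H t + ?G t / a) < 0"
      using a by (simp add: V_def U_def algebra_simps)
    then have "?H t + ?G t / a < 0" by (simp add: mult_less_0_iff)
    then show ?thesis by simp
  qed
  have decay: "?G t \<le> exp (- t / a)" if t: "0 < t" for t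
  proof -
    have "?G t * exp (t / a) \<le> ?G 0 * exp (0 / a)"
    proof (rule DERIV_nonpos_imp_nonincreasing[of 0 t "\<lambda>s. ?G s * exp (s / a)"])
      show "0 \<le> t" using t by simp
      fix s assume s: "0 \<le> s" "s \<le> t"
      have "((\<lambda>s. exp (s / a)) has_real_derivative exp (s / a) / a) (at s)"
        using a by (auto intro!: derivative_eq_intros)
      from DERIV_mult'[OF DERIV_bessel_series[OF a] this]
      have "((\<lambda>s. ?G s * exp (s / a)) has_real_derivative (?H s + ?G s / a) * exp (s / a)) (at s)"
        by (rule DERIV_cong) (simp add: algebra_simps)
      moreover have "?H s + ?G s / a \<le> 0"
      proof (cases "s = 0")
        case True
        \<comment> \<open>The bound \<open>H_le\<close> covers positive arguments; at 0 the
          differential equation loses its second-order term and gives the value directly.\<close>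
        have "a * ?H 0 = - ?G 0" using bessel_ode[OF a, of 0] by (metis add_0 mult_zero_left)
        then show ?thesis using True a by (simp add: field_simps)
      next
        case False
        then show ?thesis using H_le[of s] s by simp
      qed
      ultimately show "\<exists>y. ((\<lambda>s. ?G s * exp (s / a)) has_real_derivative y) (at s) \<and> y \<le> 0"
        using mult_nonpos_nonneg[of "?H s + ?G s / a" "exp (s / a)"] by auto
    qed
    then have "?G t * exp (t / a) \<le> 1" by (simp add: bessel_series_0)
    then show ?thesis by (simp add: exp_minus field_simps)
  qed
  define \<delta> where "\<delta> = - U 1"
  have \<delta>: "0 < \<delta>" using U_neg[of 1] by (simp add: \<delta>_def)
  have lower: "\<delta> * 2 powr (- a) * t powr (1 - a) \<le> ?G t" if t: "1 \<le> t" for t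
  proof -
    \<comment> \<open>The mean value theorem on [t, 2t] turns the bound on the derivative into one
      on G: as G(2t) is positive, G(t) exceeds G(t) - G(2t) = -t G'(z), and z < 2t keeps z^(-a)
      comparable with t^(-a).\<close>
    have "\<exists>z. t < z \<and> z < 2 * t \<and> ?G (2 * t) - ?G t = (2 * t - t) * ?H z"
      using t DERIV_bessel_series[OF a] by (intro MVT2) auto
    then obtain z where z: "t < z" "z < 2 * t" "?G (2 * t) - ?G t = t * ?H z" by auto
    have "U z \<le> U 1"
    proof (rule DERIV_nonpos_imp_nonincreasing[of 1 z U])
      show "1 \<le> z" using z t by simp
      fix s assume "1 \<le> s" "s \<le> z"
      then show "\<exists>y. (U has_real_derivative y) (at s) \<and> y \<le> 0"
        using dU[of s] pos[of s] by (intro exI[of _ "- (s powr (a - 1) * ?G s)"]) auto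
    qed
    then have "\<delta> \<le> z powr a * (- ?H z)" by (simp add: \<delta>_def U_def)
    then have "\<delta> * z powr (- a) \<le> - ?H z"
      using z t by (simp add: powr_minus field_simps)
    moreover have "(2 * t) powr (- a) \<le> z powr (- a)"
      using z t a by (intro powr_mono2') auto
    then have "\<delta> * (2 * t) powr (- a) \<le> \<delta> * z powr (- a)"
      using \<delta> by (intro mult_left_mono) auto
    ultimately have "t * (\<delta> * (2 * t) powr (- a)) \<le> t * (- ?H z)"
      using t by (intro mult_left_mono) auto
    also have "\<dots> = ?G t - ?G (2 * t)" using z(3) by simp
    also have "\<dots> \<le> ?G t" using pos[of "2 * t"] t by simp
    also have "t * (\<delta> * (2 * t) powr (- a)) = \<delta> * 2 powr (- a) * t powr (1 - a)"
      using t by (simp add: powr_mult powr_diff powr_minus field_simps)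
    finally show ?thesis .
  qed
  have "((\<lambda>t. exp (- t / a) * t powr (a - 1)) \<longlongrightarrow> 0) at_top"
    using a by real_asymp
  moreover have "0 < \<delta> * 2 powr (- a)" using \<delta> by simp
  \<comment> \<open>The exponential upper bound, divided by the power in the lower bound, tends to 0
    and eventually falls below the positive constant of the lower bound.\<close>
  ultimately have "eventually (\<lambda>t. exp (- t / a) * t powr (a - 1) < \<delta> * 2 powr (- a)) at_top"
    by (rule order_tendstoD(2))
  with eventually_ge_at_top[of 1] have "eventually (\<lambda>t::real. False) at_top"
  proof eventually_elim
    case (elim t)
    have "\<delta> * 2 powr (- a) * t powr (1 - a) \<le> exp (- t / a)"
      using lower[of t] decay[of t] elim(1) by linarith
    then have "\<delta> * 2 powr (- a) * t powr (1 - a) * t powr (a - 1) \<le> exp (- t / a) * t powr (a - 1)"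
      by (rule mult_right_mono) simp
    moreover have "t powr (1 - a) * t powr (a - 1) = 1"
      using elim(1) by (simp flip: powr_add)
    ultimately have "\<delta> * 2 powr (- a) \<le> exp (- t / a) * t powr (a - 1)" by (simp add: mult.assoc)
    then show False using elim(2) by simp
  qed
  then show False by simp
qed

lemma bessel_J_eq:
  assumes a: "0 < a" and x: "0 < x"
  shows "bessel_J (a - 1) x = rGamma a * (x / 2) powr (a - 1) * bessel_series a ((x / 2)\<^sup>2)"
proof -
  have "(- 1) ^ k / fact k * rGamma (real k + (a - 1) + 1) * (x / 2) powr (2 * real k + (a - 1))
      = rGamma a * (x / 2) powr (a - 1) * (bessel_coeff a k * ((x / 2)\<^sup>2) ^ k)" for k
  proof -
    have "rGamma a = pochhammer a k * rGamma (a + real k)" using pochhammer_rGamma[of a k] by simp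
    then have "rGamma (real k + (a - 1) + 1) = rGamma a / pochhammer a k"
      using pochhammer_pos[OF a, of k] by (simp add: add.commute)
    moreover have "(x / 2) powr (2 * real k + (a - 1)) = ((x / 2)\<^sup>2) ^ k * (x / 2) powr (a - 1)"
    proof -
      have "(x / 2) powr (2 * real k) = (x / 2) ^ (2 * k)"
        using x powr_realpow[of "x / 2" "2 * k"] by simp
      then show ?thesis by (simp only: powr_add power_mult)
    qed
    ultimately show ?thesis by (simp add: bessel_coeff_def)
  qed
  then have "bessel_J (a - 1) x = (\<Sum>k. rGamma a * (x / 2) powr (a - 1) * (bessel_coeff a k * ((x / 2)\<^sup>2) ^ k))"
    unfolding bessel_J_def by simp
  also have "\<dots> = rGamma a * (x / 2) powr (a - 1) * bessel_series a ((x / 2)\<^sup>2)"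
    unfolding bessel_series_def by (rule suminf_mult[OF summable_bessel_coeff[OF a]])
  finally show ?thesis .
qed

text \<open>A \<open>LEAST\<close> over the reals is known only once a minimum is exhibited. By
  positivity of the series below a, the positive zeros form a closed subset of [2 sqrt a,
  \<infinity>), so that 0 is no limit point; being nonempty, the set contains its infimum.\<close>

lemma bessel_zero_sq_ge:
  assumes a: "0 < a"
  shows "4 * a \<le> (bessel_zero (a - 1))\<^sup>2"
proof -
  have "rGamma a \<noteq> 0" using Gamma_real_pos[OF a] by (simp add: rGamma_inverse_Gamma)
  then have zero_iff: "bessel_J (a - 1) x = 0 \<longleftrightarrow> bessel_series a ((x / 2)\<^sup>2) = 0" if "0 < x" for x
    using that by (simp add: bessel_J_eq[OF a])
  define Z where "Z = {2 * sqrt a..} \<inter> {x. bessel_series a ((x / 2)\<^sup>2) = 0}"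
  have Z: "x \<in> Z \<longleftrightarrow> 0 < x \<and> bessel_J (a - 1) x = 0" for x
  proof
    assume "x \<in> Z"
    then have "2 * sqrt a \<le> x" by (simp add: Z_def)
    moreover have "0 < 2 * sqrt a" using a by simp
    ultimately have "0 < x" by (rule less_le_trans[rotated])
    then show "0 < x \<and> bessel_J (a - 1) x = 0" using \<open>x \<in> Z\<close> by (simp add: Z_def zero_iff)
  next
    assume x: "0 < x \<and> bessel_J (a - 1) x = 0"
    then have G: "bessel_series a ((x / 2)\<^sup>2) = 0" using zero_iff[of x] by blast
    then have "a \<le> (x / 2)\<^sup>2"
      using bessel_series_pos[OF a zero_le_power2, of "x / 2"] by (cases "(x / 2)\<^sup>2 < a") linarith+
    then have "sqrt a \<le> sqrt ((x / 2)\<^sup>2)" by (rule real_sqrt_le_mono)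
    then have "sqrt a \<le> x / 2" using x by simp
    then show "x \<in> Z" using G by (simp add: Z_def)
  qed
  have "isCont (\<lambda>x. bessel_series a ((x / 2)\<^sup>2)) x" for x
    by (rule isCont_o2[OF _ bessel_series_continuous[OF a]]) simp
  then have "continuous_on UNIV (\<lambda>x. bessel_series a ((x / 2)\<^sup>2))"
    by (rule continuous_at_imp_continuous_on[rule_format])
  then have "closed {x. bessel_series a ((x / 2)\<^sup>2) = 0}"
    by (intro closed_Collect_eq continuous_on_const)
  then have "closed Z" unfolding Z_def by (intro closed_Int closed_atLeast)
  moreover have "Z \<noteq> {}"
  proof -
    obtain t where t: "0 < t" "bessel_series a t = 0" using bessel_series_zero_exists[OF a] by blast
    then have "2 * sqrt t \<in> Z" unfolding Z by (simp add: zero_iff)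
    then show ?thesis by blast
  qed
  moreover have bdd: "bdd_below Z" unfolding Z_def by (intro bdd_belowI[of _ "2 * sqrt a"]) auto
  ultimately have Inf: "Inf Z \<in> Z" by (intro closed_contains_Inf)
  have "bessel_zero (a - 1) = Inf Z"
    unfolding bessel_zero_def
  proof (rule Least_equality)
    show "0 < Inf Z \<and> bessel_J (a - 1) (Inf Z) = 0" using Inf unfolding Z .
    show "Inf Z \<le> y" if "0 < y \<and> bessel_J (a - 1) y = 0" for y
      using that unfolding Z[symmetric] by (intro cInf_lower bdd)
  qed
  then have "2 * sqrt a \<le> bessel_zero (a - 1)" using Inf by (simp add: Z_def)
  then have "(2 * sqrt a)\<^sup>2 \<le> (bessel_zero (a - 1))\<^sup>2" using a by (intro power_mono) auto
  then show ?thesis using a by (simp add: power_mult_distrib)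
qed


section \<open>Domains with a strong Hardy inequality\<close>

locale hardy_domain =
  fixes \<Omega> :: "'a::euclidean_space set" and c :: real
  assumes admissible: "admissible \<Omega>" and strong_hardy: "strong_hardy \<Omega> c"
begin

abbreviation M where "M \<equiv> lebesgue_on \<Omega>"
abbreviation d where "d \<equiv> bdry_dist \<Omega>"

lemma open_dom: "open \<Omega>" and emeasure_pos: "0 < emeasure lebesgue \<Omega>"
  and emeasure_finite: "emeasure lebesgue \<Omega> < \<infinity>" and c_pos: "0 < c"
  using admissible strong_hardy by (auto simp: admissible_def strong_hardy_def)

lemma sets_dom: "\<Omega> \<in> sets lebesgue"
  using open_dom by auto

lemma emeasure_M: "emeasure M (space M) = emeasure lebesgue \<Omega>"
  using sets_dom by (simp add: emeasure_restrict_space)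

lemma finite_M: "finite_measure M"
  using emeasure_M emeasure_finite by (intro finite_measureI) simp

text \<open>\<open>infdist\<close> to the empty set is 0 by convention, which would make
  \<open>d\<close> vanish identically; finite measure excludes this.\<close>

lemma compl_nonempty: "- \<Omega> \<noteq> {}"
proof
  assume "- \<Omega> = {}"
  then have "\<Omega> = UNIV" by auto
  then show False using emeasure_finite by simp
qed

section \<open>The distance to the boundary\<close>

lemma d_nonneg: "0 \<le> d x"
  by (simp add: bdry_dist_def infdist_nonneg)

lemma d_pos: "x \<in> \<Omega> \<Longrightarrow> 0 < d x"
  unfolding bdry_dist_def using open_dom compl_nonempty
  by (intro infdist_pos_not_in_closed) auto

lemma d_le_dist: "y \<notin> \<Omega> \<Longrightarrow> d x \<le> dist x y"
  by (simp add: bdry_dist_def infdist_le)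

lemma ball_subset: "ball x (d x) \<subseteq> \<Omega>"
  using d_le_dist[of _ x] by (force simp: not_le[symmetric])

lemma d_continuous: "continuous_on UNIV d"
  unfolding bdry_dist_def by (intro continuous_intros)

lemma d_borel: "d \<in> borel_measurable borel"
  by (intro borel_measurable_continuous_onI d_continuous)

lemma d_measurable [measurable]: "d \<in> borel_measurable (lebesgue_on S)"
  by (intro borel_imp_lebesgue_on d_borel)

text \<open>The ball of radius d(x) about x is contained in \<Omega>, so its volume, a multiple of
  d(x)^m, is at most that of \<Omega>. The maximum with 1 allows passing from the m-th power to d(x)
  itself.\<close>

lemma d_bounded: obtains D where "0 < D" "\<And>x. d x \<le> D"
proof
  let ?V = "unit_ball_vol (real DIM('a))"
  let ?D = "max 1 (measure lebesgue \<Omega> / ?V)"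
  show "0 < ?D" by simp
  fix x
  show "d x \<le> ?D"
  proof (cases "d x \<le> 1")
    case False
    have "?V * d x ^ DIM('a) = measure lebesgue (ball x (d x))"
      using d_nonneg[of x] by (simp add: content_ball)
    also have "\<dots> \<le> measure lebesgue \<Omega>"
      using sets_dom emeasure_finite ball_subset[of x]
      by (intro measure_mono_fmeasurable) (auto simp: fmeasurable_def)
    finally have "d x ^ DIM('a) \<le> measure lebesgue \<Omega> / ?V"
      by (simp add: field_simps)
    moreover have "d x ^ 1 \<le> d x ^ DIM('a)"
      using False by (intro power_increasing) (auto simp: Suc_le_eq)
    ultimately show ?thesis by simp
  qed simp
qed

section \<open>Test functions on the domain and the inequalities of Hardy and Poincare\<close>

lemma test_sq_int: "\<phi> \<in> test_functions \<Omega> \<Longrightarrow> sq_int M \<phi>"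
  by (rule test_bounded[of \<phi> \<Omega>], assumption)
     (rule sq_int_bounded[OF finite_M borel_imp_lebesgue_on[OF test_measurable]], assumption, simp)

lemma grad_sq_int:
  assumes "\<phi> \<in> test_functions \<Omega>"
  shows "sq_int M (grad \<phi>)"
proof -
  have summand: "sq_int M (\<lambda>x. partial_deriv b \<phi> x *\<^sub>R b)" if "b \<in> Basis" for b
  proof -
    have "sq_int M (partial_deriv b \<phi>)"
      by (rule test_sq_int[OF test_partial_deriv[OF assms that]])
    then show ?thesis using that by (auto simp: sq_int_def)
  qed
  have "sq_int M (\<lambda>x. \<Sum>b\<in>B. partial_deriv b \<phi> x *\<^sub>R b)" if "B \<subseteq> Basis" for B
    using finite_subset[OF that finite_Basis] that
  proof (induction B rule: finite_induct)
    case empty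
    show ?case by (simp add: sq_int_def)
  next
    case (insert b B)
    then have "sq_int M (\<lambda>x. partial_deriv b \<phi> x *\<^sub>R b + (\<Sum>b\<in>B. partial_deriv b \<phi> x *\<^sub>R b))"
      by (intro sq_int_add summand) simp_all
    then show ?case using insert.hyps by simp
  qed
  from this[OF order_refl] show ?thesis
    by (simp add: grad_def[abs_def])
qed

lemma test_integrable: "\<phi> \<in> test_functions \<Omega> \<Longrightarrow> integrable M \<phi>"
  by (rule test_integral(2)[OF _ sets_dom])

lemma hardy_test:
  assumes "w \<in> test_functions \<Omega>"
  shows "(\<integral>\<^sup>+x. ennreal ((w x)\<^sup>2 / (d x)\<^sup>2) \<partial>M) \<le> ennreal (c * (\<integral>x. (norm (grad w x))\<^sup>2 \<partial>M))"
proof -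
  let ?N = "\<integral>\<^sup>+x. ennreal ((w x)\<^sup>2 / (d x)\<^sup>2) \<partial>M"
  have "ennreal (1 / c) * ?N \<le> ennreal (\<integral>x. (norm (grad w x))\<^sup>2 \<partial>M)"
    using strong_hardy assms unfolding strong_hardy_def L2_norm_sq_eq[OF grad_sq_int[OF assms], symmetric]
    by blast
  then have "ennreal c * (ennreal (1 / c) * ?N) \<le> ennreal c * ennreal (\<integral>x. (norm (grad w x))\<^sup>2 \<partial>M)"
    by (rule mult_left_mono) simp
  moreover have "ennreal c * (ennreal (1 / c) * ?N) = ?N"
    using c_pos by (simp add: mult.assoc[symmetric] ennreal_mult[symmetric])
  ultimately show ?thesis
    using c_pos by (simp add: ennreal_mult)
qed

text \<open>Since d \<le> D, the square of w is at most D^2 times w^2/d^2, and Hardy's inequality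
  gives the constant P = D^2 c.\<close>

lemma poincare:
  obtains P where "0 \<le> P" "\<And>w. w \<in> test_functions \<Omega> \<Longrightarrow>
    (\<integral>x. (norm (w x))\<^sup>2 \<partial>M) \<le> P * (\<integral>x. (norm (grad w x))\<^sup>2 \<partial>M)"
proof -
  obtain D where D: "0 < D" "\<And>x. d x \<le> D" using d_bounded by blast
  have "(\<integral>x. (norm (w x))\<^sup>2 \<partial>M) \<le> D\<^sup>2 * c * (\<integral>x. (norm (grad w x))\<^sup>2 \<partial>M)"
    if w: "w \<in> test_functions \<Omega>" for w
  proof -
    have [measurable]: "w \<in> borel_measurable M" using sq_intD(1)[OF test_sq_int[OF w]] .
    have "ennreal (\<integral>x. (norm (w x))\<^sup>2 \<partial>M) = (\<integral>\<^sup>+x. ennreal ((w x)\<^sup>2) \<partial>M)"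
      using nn_integral_eq_integral[OF sq_intD(2)[OF test_sq_int[OF w]]] by simp
    also have "\<dots> \<le> (\<integral>\<^sup>+x. ennreal (D\<^sup>2) * ennreal ((w x)\<^sup>2 / (d x)\<^sup>2) \<partial>M)"
    proof (rule nn_integral_mono)
      fix x assume "x \<in> space M"
      then have "0 < d x" using d_pos by simp
      then have "(d x)\<^sup>2 \<le> D\<^sup>2" using D(2) by (intro power_mono) auto
      then have "(w x)\<^sup>2 \<le> D\<^sup>2 * ((w x)\<^sup>2 / (d x)\<^sup>2)"
        using \<open>0 < d x\<close> mult_right_mono[of "(d x)\<^sup>2" "D\<^sup>2" "(w x)\<^sup>2"] by (simp add: pos_le_divide_eq mult.commute)
      then show "ennreal ((w x)\<^sup>2) \<le> ennreal (D\<^sup>2) * ennreal ((w x)\<^sup>2 / (d x)\<^sup>2)"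
        by (simp add: ennreal_mult[symmetric] ennreal_leI)
    qed
    also have "\<dots> = ennreal (D\<^sup>2) * (\<integral>\<^sup>+x. ennreal ((w x)\<^sup>2 / (d x)\<^sup>2) \<partial>M)"
      by (intro nn_integral_cmult) measurable
    also have "\<dots> \<le> ennreal (D\<^sup>2) * ennreal (c * (\<integral>x. (norm (grad w x))\<^sup>2 \<partial>M))"
      by (intro mult_left_mono hardy_test w) simp
    also have "\<dots> = ennreal (D\<^sup>2 * c * (\<integral>x. (norm (grad w x))\<^sup>2 \<partial>M))"
      using c_pos by (simp add: ennreal_mult[symmetric] mult.assoc)
    finally show ?thesis
      using c_pos by (subst (asm) ennreal_le_iff) auto
  qed
  moreover have "0 \<le> D\<^sup>2 * c" using c_pos by simp
  ultimately show thesis using that by blast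
qed

text \<open>\<open>weak_grad\<close> is an arbitrary choice; this identifies it, almost everywhere,
  with a gradient constructed as a limit. The difference of two weak gradients is orthogonal to all
  test functions in every coordinate.\<close>

lemma weak_gradient_unique:
  assumes g: "is_weak_gradient \<Omega> u g" and h: "is_weak_gradient \<Omega> u h"
  shows "AE x in M. g x = h x"
proof -
  have sq: "sq_int M g" "sq_int M h"
    using g h by (simp_all add: is_weak_gradient_def L2_space_iff)
  then have diff: "sq_int M (\<lambda>x. g x - h x)" by (rule sq_int_diff)
  have const: "sq_int M (\<lambda>x. b)" for b :: 'a
    by (rule sq_int_bounded[OF finite_M, of _ "norm b"]) auto
  have *: "AE x in M. (g x - h x) \<bullet> b = 0" if "b \<in> Basis" for b
  proof (rule AE_eq_0_if_test_orthogonal[OF open_dom])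
    show "integrable M (\<lambda>x. (g x - h x) \<bullet> b)"
      by (rule sq_int_inner[OF diff const])
    fix \<phi> assume \<phi>: "\<phi> \<in> test_functions \<Omega>"
    have sb: "sq_int M (\<lambda>x. \<phi> x *\<^sub>R b)"
      using test_sq_int[OF \<phi>] that by (auto simp: sq_int_def)
    have "(\<integral>x. (g x \<bullet> b) * \<phi> x \<partial>M) = (\<integral>x. (h x \<bullet> b) * \<phi> x \<partial>M)"
      using g h \<phi> that by (simp add: is_weak_gradient_def)
    moreover have "integrable M (\<lambda>x. (g x \<bullet> b) * \<phi> x)" "integrable M (\<lambda>x. (h x \<bullet> b) * \<phi> x)"
      using sq_int_inner[OF sq(1) sb] sq_int_inner[OF sq(2) sb] by (simp_all add: mult.commute)
    ultimately show "(\<integral>x. (g x - h x) \<bullet> b * \<phi> x \<partial>M) = 0"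
      by (simp add: inner_diff_left left_diff_distrib)
  qed
  have "AE x in M. \<forall>b\<in>Basis. (g x - h x) \<bullet> b = 0"
    using * by (intro AE_finite_allI) auto
  then show ?thesis
    by eventually_elim (simp add: euclidean_eq_iff[of "g _"] inner_diff_left)
qed

text \<open>Integration by parts holds for each approximant and passes to the L2 limit, so the limit
  of the gradients is a weak gradient. By uniqueness it may be replaced by the chosen one in the
  definition of \<open>H10\<close>.\<close>

lemma H10_I:
  assumes v: "sq_int M v" and g: "sq_int M g" and \<phi>: "\<And>n. \<phi> n \<in> test_functions \<Omega>"
    and lim_v: "(\<lambda>n. \<integral>x. (norm (\<phi> n x - v x))\<^sup>2 \<partial>M) \<longlonglongrightarrow> 0"
    and lim_g: "(\<lambda>n. \<integral>x. (norm (grad (\<phi> n) x - g x))\<^sup>2 \<partial>M) \<longlonglongrightarrow> 0"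
  shows "v \<in> H10 \<Omega>" "AE x in M. weak_grad \<Omega> v x = g x"
proof -
  have wg: "is_weak_gradient \<Omega> v g"
    unfolding is_weak_gradient_def
  proof (intro conjI ballI)
    show "g \<in> L2_space \<Omega>" using g by (simp add: L2_space_iff)
    fix \<psi> :: "'a \<Rightarrow> real" and b :: 'a assume \<psi>: "\<psi> \<in> test_functions \<Omega>" and b: "b \<in> Basis"
    have sb: "sq_int M (\<lambda>x. \<psi> x *\<^sub>R b)"
      using test_sq_int[OF \<psi>] b by (auto simp: sq_int_def)
    have "(\<lambda>n. \<integral>x. \<phi> n x \<bullet> partial_deriv b \<psi> x \<partial>M) \<longlonglongrightarrow> (\<integral>x. v x \<bullet> partial_deriv b \<psi> x \<partial>M)"
      by (rule L2_limit_inner[OF test_sq_int[OF \<phi>] v test_sq_int[OF test_partial_deriv[OF \<psi> b]] lim_v])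
    moreover have "(\<lambda>n. - (\<integral>x. grad (\<phi> n) x \<bullet> (\<psi> x *\<^sub>R b) \<partial>M)) \<longlonglongrightarrow> - (\<integral>x. g x \<bullet> (\<psi> x *\<^sub>R b) \<partial>M)"
      by (intro tendsto_minus L2_limit_inner[OF grad_sq_int[OF \<phi>] g sb lim_g])
    moreover have "(\<integral>x. \<phi> n x \<bullet> partial_deriv b \<psi> x \<partial>M) = - (\<integral>x. grad (\<phi> n) x \<bullet> (\<psi> x *\<^sub>R b) \<partial>M)" for n
      using integral_by_parts[OF \<psi> test_cont_diff[OF \<phi>] sets_dom b, of n]
      by (simp add: grad_inner_Basis[OF b] mult.commute)
    ultimately have "(\<integral>x. v x \<bullet> partial_deriv b \<psi> x \<partial>M) = - (\<integral>x. g x \<bullet> (\<psi> x *\<^sub>R b) \<partial>M)"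
      using LIMSEQ_unique by simp
    then show "(\<integral>x. v x * partial_deriv b \<psi> x \<partial>M) = - (\<integral>x. (g x \<bullet> b) * \<psi> x \<partial>M)"
      by (simp add: mult.commute)
  qed
  then have wg': "is_weak_gradient \<Omega> v (weak_grad \<Omega> v)"
    unfolding weak_grad_def by (rule someI[of "is_weak_gradient \<Omega> v"])
  show AE: "AE x in M. weak_grad \<Omega> v x = g x"
    by (rule weak_gradient_unique[OF wg' wg])
  have 1: "L2_norm_sq \<Omega> (\<lambda>x. \<phi> n x - v x) = ennreal (\<integral>x. (norm (\<phi> n x - v x))\<^sup>2 \<partial>M)" for n
    by (rule L2_norm_sq_eq[OF sq_int_diff[OF test_sq_int[OF \<phi>] v]])
  have 2: "L2_norm_sq \<Omega> (\<lambda>x. grad (\<phi> n) x - weak_grad \<Omega> v x)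
      = ennreal (\<integral>x. (norm (grad (\<phi> n) x - g x))\<^sup>2 \<partial>M)" for n
  proof -
    have "L2_norm_sq \<Omega> (\<lambda>x. grad (\<phi> n) x - weak_grad \<Omega> v x) = L2_norm_sq \<Omega> (\<lambda>x. grad (\<phi> n) x - g x)"
      unfolding L2_norm_sq_def
      by (rule nn_integral_cong_AE) (use AE in \<open>eventually_elim, simp\<close>)
    also have "\<dots> = ennreal (\<integral>x. (norm (grad (\<phi> n) x - g x))\<^sup>2 \<partial>M)"
      by (rule L2_norm_sq_eq[OF sq_int_diff[OF grad_sq_int[OF \<phi>] g]])
    finally show ?thesis .
  qed
  have "(\<lambda>n. L2_norm_sq \<Omega> (\<lambda>x. \<phi> n x - v x) + L2_norm_sq \<Omega> (\<lambda>x. grad (\<phi> n) x - weak_grad \<Omega> v x))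
      \<longlonglongrightarrow> ennreal 0 + ennreal 0"
    unfolding 1 2 by (intro tendsto_add tendsto_ennrealI lim_v lim_g)
  then show "v \<in> H10 \<Omega>"
    using v wg \<phi> unfolding H10_def H1_def by (auto simp: L2_space_iff)
qed

lemma H10_E:
  assumes "u \<in> H10 \<Omega>"
  obtains \<phi> where "sq_int M u" "sq_int M (weak_grad \<Omega> u)" "\<forall>n::nat. \<phi> n \<in> test_functions \<Omega>"
    "(\<lambda>n. \<integral>x. (norm (\<phi> n x - u x))\<^sup>2 \<partial>M) \<longlonglongrightarrow> 0"
    "(\<lambda>n. \<integral>x. (norm (grad (\<phi> n) x - weak_grad \<Omega> u x))\<^sup>2 \<partial>M) \<longlonglongrightarrow> 0"
proof -
  have u: "sq_int M u" and ex: "\<exists>g. is_weak_gradient \<Omega> u g"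
    using assms by (auto simp: H10_def H1_def L2_space_iff)
  have "is_weak_gradient \<Omega> u (weak_grad \<Omega> u)"
    unfolding weak_grad_def using ex by (rule someI_ex[of "is_weak_gradient \<Omega> u"])
  then have g: "sq_int M (weak_grad \<Omega> u)" by (simp add: is_weak_gradient_def L2_space_iff)
  obtain \<phi> where \<phi>: "\<And>n::nat. \<phi> n \<in> test_functions \<Omega>"
    and lim: "(\<lambda>n. L2_norm_sq \<Omega> (\<lambda>x. \<phi> n x - u x)
           + L2_norm_sq \<Omega> (\<lambda>x. grad (\<phi> n) x - weak_grad \<Omega> u x)) \<longlonglongrightarrow> 0"
    using assms unfolding H10_def by auto
  have 1: "L2_norm_sq \<Omega> (\<lambda>x. \<phi> n x - u x) = ennreal (\<integral>x. (norm (\<phi> n x - u x))\<^sup>2 \<partial>M)" for n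
    by (rule L2_norm_sq_eq[OF sq_int_diff[OF test_sq_int[OF \<phi>] u]])
  have 2: "L2_norm_sq \<Omega> (\<lambda>x. grad (\<phi> n) x - weak_grad \<Omega> u x)
      = ennreal (\<integral>x. (norm (grad (\<phi> n) x - weak_grad \<Omega> u x))\<^sup>2 \<partial>M)" for n
    by (rule L2_norm_sq_eq[OF sq_int_diff[OF grad_sq_int[OF \<phi>] g]])
  let ?a = "\<lambda>n. \<integral>x. (norm (\<phi> n x - u x))\<^sup>2 \<partial>M"
  let ?b = "\<lambda>n. \<integral>x. (norm (grad (\<phi> n) x - weak_grad \<Omega> u x))\<^sup>2 \<partial>M"
  have "(\<lambda>n. ennreal (?a n + ?b n)) \<longlonglongrightarrow> ennreal 0"
    using lim unfolding 1 2 by simp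
  then have sum: "(\<lambda>n. ?a n + ?b n) \<longlonglongrightarrow> 0"
    by (subst (asm) tendsto_ennreal_iff) auto
  have "?a \<longlonglongrightarrow> 0"
    by (rule tendsto_sandwich[OF _ _ tendsto_const sum]) auto
  moreover have "?b \<longlonglongrightarrow> 0"
    by (rule tendsto_sandwich[OF _ _ tendsto_const sum]) auto
  ultimately show thesis by (rule that[OF u g allI[OF \<phi>]])
qed

section \<open>Existence of the torsion function by Dirichlet's principle\<close>

definition energy :: "('a \<Rightarrow> real) \<Rightarrow> real" where
  "energy \<phi> = (\<integral>x. (norm (grad \<phi> x))\<^sup>2 \<partial>M) / 2 - (\<integral>x. \<phi> x \<partial>M)"

text \<open>Cauchy-Schwarz and Poincare bound the linear term by sqrt(K G), with G the Dirichlet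
  integral and K = P times the volume; by the arithmetic-geometric mean this is at most (K + G)/2,
  and G/2 is absorbed by the quadratic term.\<close>

lemma energy_bdd_below: "bdd_below (energy ` test_functions \<Omega>)"
proof -
  obtain P where P: "0 \<le> P" "\<And>w. w \<in> test_functions \<Omega> \<Longrightarrow>
    (\<integral>x. (norm (w x))\<^sup>2 \<partial>M) \<le> P * (\<integral>x. (norm (grad w x))\<^sup>2 \<partial>M)"
    using poincare by metis
  define K where "K = P * measure M (space M)"
  have K: "0 \<le> K" using P by (simp add: K_def)
  have "- K / 2 \<le> energy \<phi>" if \<phi>: "\<phi> \<in> test_functions \<Omega>" for \<phi>
  proof -
    let ?G = "\<integral>x. (norm (grad \<phi> x))\<^sup>2 \<partial>M"
    have G: "0 \<le> ?G" by (rule Bochner_Integration.integral_nonneg) simp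
    have "(\<integral>x. norm (\<phi> x) \<partial>M)\<^sup>2 \<le> (\<integral>x. (norm (\<phi> x))\<^sup>2 \<partial>M) * measure M (space M)"
      by (rule integral_abs_le_L2[OF finite_M test_sq_int[OF \<phi>]])
    also have "\<dots> \<le> P * ?G * measure M (space M)"
      by (intro mult_right_mono P(2) \<phi>) simp
    also have "\<dots> = K * ?G" by (simp add: K_def mult_ac)
    also have "\<dots> \<le> ((K + ?G) / 2)\<^sup>2"
      using zero_le_power2[of "K - ?G"] by (simp add: power2_eq_square algebra_simps)
    finally have "(\<integral>x. norm (\<phi> x) \<partial>M) \<le> (K + ?G) / 2"
      by (rule power2_le_imp_le) (intro divide_nonneg_nonneg add_nonneg_nonneg K G zero_le_numeral)
    moreover have "(\<integral>x. \<phi> x \<partial>M) \<le> (\<integral>x. norm (\<phi> x) \<partial>M)"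
      by (rule order_trans[OF abs_ge_self integral_norm_bound[of M \<phi>, unfolded real_norm_def],
            folded real_norm_def])
    moreover have "- K / 2 \<le> G / 2 - y" if "x \<le> (K + G) / 2" "y \<le> x" for x y G :: real
      using that by (simp add: field_simps)
    ultimately show ?thesis unfolding energy_def by blast
  qed
  then show ?thesis by (intro bdd_belowI2[of _ "- K / 2"])
qed

text \<open>The second-order expansion is exact because the functional is quadratic. It is used with
  t = 1/2 for the energy of a midpoint and with free t for the first variation.\<close>

lemma energy_add_cmult:
  assumes \<phi>: "\<phi> \<in> test_functions \<Omega>" and \<psi>: "\<psi> \<in> test_functions \<Omega>"
  shows "energy (\<lambda>x. \<phi> x + t * \<psi> x)
    = energy \<phi> + t * ((\<integral>x. grad \<phi> x \<bullet> grad \<psi> x \<partial>M) - (\<integral>x. \<psi> x \<partial>M))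
      + t\<^sup>2 * ((\<integral>x. (norm (grad \<psi> x))\<^sup>2 \<partial>M) / 2)"
proof -
  have "(\<integral>x. (norm (grad (\<lambda>x. \<phi> x + t * \<psi> x) x))\<^sup>2 \<partial>M) = (\<integral>x. (norm (grad \<phi> x))\<^sup>2 \<partial>M)
      + 2 * t * (\<integral>x. grad \<phi> x \<bullet> grad \<psi> x \<partial>M) + t\<^sup>2 * (\<integral>x. (norm (grad \<psi> x))\<^sup>2 \<partial>M)"
    unfolding grad_add_cmult[OF \<phi> \<psi>]
    by (rule integral_norm_add_sq[OF grad_sq_int[OF \<phi>] grad_sq_int[OF \<psi>]])
  moreover have "(\<integral>x. \<phi> x + t * \<psi> x \<partial>M) = (\<integral>x. \<phi> x \<partial>M) + t * (\<integral>x. \<psi> x \<partial>M)"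
    using test_integrable[OF \<phi>] test_integrable[OF \<psi>] by simp
  ultimately show ?thesis by (simp add: energy_def field_simps)
qed

text \<open>
  By the parallelogram law the gradients of a sequence minimising the energy over the test functions
  form a Cauchy sequence.
\<close>

lemma torsion_function_exists: "\<exists>v. is_torsion_function \<Omega> v"
proof -
  obtain P where P: "0 \<le> P" "\<And>w. w \<in> test_functions \<Omega> \<Longrightarrow>
    (\<integral>x. (norm (w x))\<^sup>2 \<partial>M) \<le> P * (\<integral>x. (norm (grad w x))\<^sup>2 \<partial>M)"
    using poincare by metis
  define I where "I = Inf (energy ` test_functions \<Omega>)"
  have I_le: "I \<le> energy \<phi>" if "\<phi> \<in> test_functions \<Omega>" for \<phi>
    unfolding I_def using that by (intro cInf_lower energy_bdd_below imageI)
  have "\<exists>\<phi>\<in>test_functions \<Omega>. energy \<phi> < I + (1 / 4) ^ n" for n :: nat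
  proof -
    have "\<exists>e\<in>energy ` test_functions \<Omega>. e < I + (1 / 4) ^ n"
      using test_zero[of \<Omega>] unfolding I_def by (intro cInf_lessD) auto
    then show ?thesis by auto
  qed
  then obtain \<phi> where \<phi>: "\<And>n::nat. \<phi> n \<in> test_functions \<Omega>"
    and E: "\<And>n::nat. energy (\<phi> n) < I + (1 / 4) ^ n"
    by metis
  \<comment> \<open>The mean of the two energies exceeds the energy of the midpoint by one eighth of
    the integral on the left. The midpoint has energy at least I and both energies are at most I +
    4^-n, whence the factor 8.\<close>
  have Cg: "(\<integral>x. (norm (grad (\<phi> k) x - grad (\<phi> n) x))\<^sup>2 \<partial>M) \<le> 8 * (1 / 4) ^ n" if "n \<le> k" for n k
  proof -
    let ?A = "\<integral>x. (norm (grad (\<phi> k) x))\<^sup>2 \<partial>M" and ?B = "\<integral>x. (norm (grad (\<phi> n) x))\<^sup>2 \<partial>M"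
    let ?X = "\<integral>x. grad (\<phi> k) x \<bullet> grad (\<phi> n) x \<partial>M"
    have diff: "(\<integral>x. (norm (grad (\<phi> k) x + (-1) *\<^sub>R grad (\<phi> n) x))\<^sup>2 \<partial>M) = ?A + 2 * (-1) * ?X + (-1)\<^sup>2 * ?B"
      by (rule integral_norm_add_sq[OF grad_sq_int[OF \<phi>] grad_sq_int[OF \<phi>]])
    define \<mu> where "\<mu> = (\<lambda>x. (1/2) * \<phi> k x)"
    have \<mu>: "\<mu> \<in> test_functions \<Omega>" unfolding \<mu>_def by (rule test_cmult[OF \<phi>])
    \<comment> \<open>Halving is written as adding a multiple so that the rule for gradients of sums
      applies.\<close>
    have \<mu>_eq: "\<mu> = (\<lambda>x. \<phi> k x + (-1/2) * \<phi> k x)" by (auto simp: \<mu>_def)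
    have "grad \<mu> x = grad (\<phi> k) x + (-1/2) *\<^sub>R grad (\<phi> k) x" for x
      unfolding \<mu>_eq by (rule grad_add_cmult[OF \<phi> \<phi>])
    then have g\<mu>: "grad \<mu> x = (1/2) *\<^sub>R grad (\<phi> k) x" for x
      using scaleR_left_distrib[of 1 "-1/2" "grad (\<phi> k) x"] by simp
    have "energy (\<lambda>x. \<mu> x + (1/2) * \<phi> n x) = energy \<mu> + (1/2) * ((\<integral>x. grad \<mu> x \<bullet> grad (\<phi> n) x \<partial>M) - (\<integral>x. \<phi> n x \<partial>M))
      + (1/2)\<^sup>2 * (?B / 2)"
      by (rule energy_add_cmult[OF \<mu> \<phi>])
    moreover have "energy \<mu> = ?A / 8 - (\<integral>x. \<phi> k x \<partial>M) / 2"
    proof -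
      have "(norm ((1/2) *\<^sub>R z))\<^sup>2 = (1/4) * (norm z)\<^sup>2" for z :: 'a
        by (simp add: power2_eq_square)
      note half = this
      show ?thesis unfolding energy_def g\<mu> half by (simp add: \<mu>_def)
    qed
    moreover have "(\<integral>x. grad \<mu> x \<bullet> grad (\<phi> n) x \<partial>M) = ?X / 2"
      unfolding g\<mu> by simp
    moreover have "I \<le> energy (\<lambda>x. \<mu> x + (1/2) * \<phi> n x)"
      by (intro I_le test_add test_cmult \<mu> \<phi>)
    ultimately have "I \<le> ?A / 8 - (\<integral>x. \<phi> k x \<partial>M) / 2 + (?X / 2 - (\<integral>x. \<phi> n x \<partial>M)) / 2 + ?B / 8"
      by (simp add: power2_eq_square)
    moreover have "?A / 2 - (\<integral>x. \<phi> k x \<partial>M) \<le> I + (1 / 4) ^ n"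
    proof -
      have "(1 / 4 :: real) ^ k \<le> (1 / 4) ^ n" using that by (intro power_decreasing) auto
      then have "energy (\<phi> k) \<le> I + (1 / 4) ^ n" using E[of k] by linarith
      then show ?thesis unfolding energy_def .
    qed
    moreover have "?B / 2 - (\<integral>x. \<phi> n x \<partial>M) \<le> I + (1 / 4) ^ n"
      using less_imp_le[OF E[of n]] unfolding energy_def .
    moreover have "A - 2 * X + B \<le> 8 * e"
      if "I \<le> A / 8 - p / 2 + (X / 2 - q) / 2 + B / 8" "A / 2 - p \<le> I + e" "B / 2 - q \<le> I + e"
      for A B X p q e :: real
      using that by (simp add: field_simps)
    ultimately have "?A - 2 * ?X + ?B \<le> 8 * (1 / 4) ^ n"
      by blast
    then show ?thesis using diff by simp
  qed
  have Cv: "(\<integral>x. (norm (\<phi> k x - \<phi> n x))\<^sup>2 \<partial>M) \<le> (P * 8) * (1 / 4) ^ n" if "n \<le> k" for n k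
  proof -
    have eq: "(\<lambda>x. \<phi> k x - \<phi> n x) = (\<lambda>x. \<phi> k x + (-1) * \<phi> n x)" by simp
    have g: "grad (\<lambda>x. \<phi> k x - \<phi> n x) x = grad (\<phi> k) x - grad (\<phi> n) x" for x
      unfolding eq grad_add_cmult[OF \<phi> \<phi>] by simp
    have "(\<integral>x. (norm (\<phi> k x - \<phi> n x))\<^sup>2 \<partial>M) \<le> P * (\<integral>x. (norm (grad (\<phi> k) x - grad (\<phi> n) x))\<^sup>2 \<partial>M)"
      using P(2)[OF test_diff[OF \<phi> \<phi>], of k n] unfolding g .
    also have "\<dots> \<le> P * (8 * (1 / 4) ^ n)"
      by (intro mult_left_mono Cg that P)
    finally show ?thesis by (simp add: mult.assoc)
  qed
  obtain g where g: "sq_int M g" and gb: "\<And>n. (\<integral>x. (norm (grad (\<phi> n) x - g x))\<^sup>2 \<partial>M) \<le> 8 * (1 / 4) ^ n"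
    using L2_complete[OF finite_M grad_sq_int[OF \<phi>] Cg] by blast
  obtain v where v: "sq_int M v" and vb: "\<And>n. (\<integral>x. (norm (\<phi> n x - v x))\<^sup>2 \<partial>M) \<le> (P * 8) * (1 / 4) ^ n"
    using L2_complete[OF finite_M test_sq_int[OF \<phi>] Cv] by blast
  have lim_v: "(\<lambda>n. \<integral>x. (norm (\<phi> n x - v x))\<^sup>2 \<partial>M) \<longlonglongrightarrow> 0"
    by (rule tendsto_sandwich[OF _ always_eventually[OF allI[OF vb]] tendsto_const tendsto_geometric_quarter]) simp
  have lim_g: "(\<lambda>n. \<integral>x. (norm (grad (\<phi> n) x - g x))\<^sup>2 \<partial>M) \<longlonglongrightarrow> 0"
    by (rule tendsto_sandwich[OF _ always_eventually[OF allI[OF gb]] tendsto_const tendsto_geometric_quarter]) simp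
  note H = H10_I[OF v g \<phi> lim_v lim_g]
  have lim_E: "(\<lambda>n. energy (\<phi> n)) \<longlonglongrightarrow> I"
  proof (rule tendsto_sandwich[OF _ _ tendsto_const])
    show "(\<lambda>n. I + (1 / 4) ^ n) \<longlonglongrightarrow> I"
      using tendsto_add[OF tendsto_const[of I] tendsto_geometric_quarter[of 1]] by simp
    show "eventually (\<lambda>n. energy (\<phi> n) \<le> I + (1 / 4) ^ n) sequentially"
      using E by (simp add: less_imp_le)
  qed (simp add: I_le \<phi>)
  have "(\<integral>x. weak_grad \<Omega> v x \<bullet> grad \<psi> x \<partial>M) = (\<integral>x. \<psi> x \<partial>M)" if \<psi>: "\<psi> \<in> test_functions \<Omega>" for \<psi>
  proof -
    let ?b = "(\<integral>x. g x \<bullet> grad \<psi> x \<partial>M) - (\<integral>x. \<psi> x \<partial>M)"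
    let ?c = "(\<integral>x. (norm (grad \<psi> x))\<^sup>2 \<partial>M) / 2"
    \<comment> \<open>First variation: perturbing the minimising sequence by t times the test
      function keeps the energy at least I, and in the limit a quadratic in t without constant term
      is nonnegative, so its linear coefficient must vanish.\<close>
    have "0 \<le> 0 + 2 * t * (?b / 2) + t\<^sup>2 * ?c" for t
    proof -
      have "(\<lambda>n. energy (\<phi> n) + t * ((\<integral>x. grad (\<phi> n) x \<bullet> grad \<psi> x \<partial>M) - (\<integral>x. \<psi> x \<partial>M)) + t\<^sup>2 * ?c)
          \<longlonglongrightarrow> I + t * ?b + t\<^sup>2 * ?c"
        by (intro tendsto_intros lim_E L2_limit_inner[OF grad_sq_int[OF \<phi>] g grad_sq_int[OF \<psi>] lim_g])
      moreover have "I \<le> energy (\<phi> n) + t * ((\<integral>x. grad (\<phi> n) x \<bullet> grad \<psi> x \<partial>M) - (\<integral>x. \<psi> x \<partial>M)) + t\<^sup>2 * ?c" for n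
        unfolding energy_add_cmult[OF \<phi> \<psi>, symmetric] by (intro I_le test_add test_cmult \<phi> \<psi>)
      ultimately have "I \<le> I + t * ?b + t\<^sup>2 * ?c"
        by (intro LIMSEQ_le_const) auto
      then show ?thesis by simp
    qed
    then have "(?b / 2)\<^sup>2 \<le> 0 * ?c"
      by (rule nonneg_quadratic_imp_discrim) simp
    then have "(\<integral>x. g x \<bullet> grad \<psi> x \<partial>M) = (\<integral>x. \<psi> x \<partial>M)" by simp
    moreover have "(\<integral>x. weak_grad \<Omega> v x \<bullet> grad \<psi> x \<partial>M) = (\<integral>x. g x \<bullet> grad \<psi> x \<partial>M)"
    proof (rule integral_cong_AE)
      have "sq_int M (weak_grad \<Omega> v)" using H(1) by (rule H10_E)
      then show "(\<lambda>x. weak_grad \<Omega> v x \<bullet> grad \<psi> x) \<in> borel_measurable M"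
        using grad_sq_int[OF \<psi>] by (intro borel_measurable_inner sq_intD)
      show "(\<lambda>x. g x \<bullet> grad \<psi> x) \<in> borel_measurable M"
        using g grad_sq_int[OF \<psi>] by (intro borel_measurable_inner sq_intD)
      show "AE x in M. weak_grad \<Omega> v x \<bullet> grad \<psi> x = g x \<bullet> grad \<psi> x"
        using H(2) by eventually_elim simp
    qed
    ultimately show ?thesis by simp
  qed
  with H(1) show ?thesis unfolding is_torsion_function_def by blast
qed

lemma torsion: "is_torsion_function \<Omega> (torsion \<Omega>)"
  unfolding torsion_def using torsion_function_exists by (rule someI_ex[of "is_torsion_function \<Omega>"])

text \<open>A subsequence of the approximants converges almost everywhere, so Fatou's lemma handles
  the weighted integral, while the Dirichlet integrals converge.\<close>

lemma hardy_H10: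
  assumes "u \<in> H10 \<Omega>"
  shows "(\<integral>\<^sup>+x. ennreal ((u x)\<^sup>2 / (d x)\<^sup>2) \<partial>M) \<le> ennreal (c * (\<integral>x. (norm (weak_grad \<Omega> u x))\<^sup>2 \<partial>M))"
proof -
  obtain \<phi> where u: "sq_int M u" and g: "sq_int M (weak_grad \<Omega> u)"
    and \<phi>_all: "\<forall>n::nat. \<phi> n \<in> test_functions \<Omega>"
    and lim_u: "(\<lambda>n. \<integral>x. (norm (\<phi> n x - u x))\<^sup>2 \<partial>M) \<longlonglongrightarrow> 0"
    and lim_g: "(\<lambda>n. \<integral>x. (norm (grad (\<phi> n) x - weak_grad \<Omega> u x))\<^sup>2 \<partial>M) \<longlonglongrightarrow> 0"
    using assms by (rule H10_E)
  note \<phi> = \<phi>_all[rule_format]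
  have [measurable]: "\<phi> n \<in> borel_measurable M" for n using sq_intD(1)[OF test_sq_int[OF \<phi>]] .
  obtain r :: "nat \<Rightarrow> nat" where r: "strict_mono r" and AE: "AE x in M. (\<lambda>n. \<phi> (r n) x) \<longlonglongrightarrow> u x"
    using L2_limit_AE_subseq[OF test_sq_int[OF \<phi>] u lim_u] by blast
  let ?G = "\<lambda>n. \<integral>x. (norm (grad (\<phi> n) x))\<^sup>2 \<partial>M"
  have "(\<integral>\<^sup>+x. ennreal ((u x)\<^sup>2 / (d x)\<^sup>2) \<partial>M)
      = (\<integral>\<^sup>+x. liminf (\<lambda>n. ennreal ((\<phi> (r n) x)\<^sup>2 / (d x)\<^sup>2)) \<partial>M)"
  proof (rule nn_integral_cong_AE)
    show "AE x in M. ennreal ((u x)\<^sup>2 / (d x)\<^sup>2) = liminf (\<lambda>n. ennreal ((\<phi> (r n) x)\<^sup>2 / (d x)\<^sup>2))"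
      using AE AE_space
    proof eventually_elim
      case (elim x)
      then have "d x \<noteq> 0" using d_pos[of x] by simp
      then have "(\<lambda>n. ennreal ((\<phi> (r n) x)\<^sup>2 / (d x)\<^sup>2)) \<longlonglongrightarrow> ennreal ((u x)\<^sup>2 / (d x)\<^sup>2)"
        by (intro tendsto_ennrealI tendsto_intros elim(1)) simp
      then show ?case by (rule lim_imp_Liminf[OF sequentially_bot, symmetric])
    qed
  qed
  also have "\<dots> \<le> liminf (\<lambda>n. \<integral>\<^sup>+x. ennreal ((\<phi> (r n) x)\<^sup>2 / (d x)\<^sup>2) \<partial>M)"
    by (intro nn_integral_liminf) measurable
  also have "\<dots> \<le> liminf (\<lambda>n. ennreal (c * ?G (r n)))"
    by (intro Liminf_mono always_eventually allI hardy_test \<phi>)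
  also have "\<dots> = ennreal (c * (\<integral>x. (norm (weak_grad \<Omega> u x))\<^sup>2 \<partial>M))"
  proof (rule lim_imp_Liminf[OF sequentially_bot])
    have "(\<lambda>n. ?G (r n)) \<longlonglongrightarrow> (\<integral>x. (norm (weak_grad \<Omega> u x))\<^sup>2 \<partial>M)"
      using LIMSEQ_subseq_LIMSEQ[OF L2_limit_norm[OF grad_sq_int[OF \<phi>] g lim_g] r]
      by (simp add: comp_def)
    then show "(\<lambda>n. ennreal (c * ?G (r n))) \<longlonglongrightarrow> ennreal (c * (\<integral>x. (norm (weak_grad \<Omega> u x))\<^sup>2 \<partial>M))"
      by (intro tendsto_ennrealI tendsto_intros)
  qed
  finally show ?thesis .
qed

section \<open>The torsion function and its comparison with paraboloids\<close>

lemma torsion_H10: "torsion \<Omega> \<in> H10 \<Omega>"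
  using torsion by (simp add: is_torsion_function_def)

lemma torsion_sq_int: "sq_int M (torsion \<Omega>)"
  using torsion_H10 by (rule H10_E)

lemma torsion_integrable: "integrable M (torsion \<Omega>)"
  by (rule sq_int_integrable[OF finite_M torsion_sq_int])

lemma torsion_eq:
  "\<phi> \<in> test_functions \<Omega> \<Longrightarrow> (\<integral>x. weak_grad \<Omega> (torsion \<Omega>) x \<bullet> grad \<phi> x \<partial>M) = (\<integral>x. \<phi> x \<partial>M)"
  using torsion by (simp add: is_torsion_function_def)

text \<open>This is the equation tested with v itself. As v need not be a test function, the
  equation is tested with approximants, and both sides converge.\<close>

lemma integral_torsion:
  "(\<integral>x. torsion \<Omega> x \<partial>M) = (\<integral>x. (norm (weak_grad \<Omega> (torsion \<Omega>) x))\<^sup>2 \<partial>M)"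
proof -
  let ?v = "torsion \<Omega>" and ?g = "weak_grad \<Omega> (torsion \<Omega>)"
  obtain \<phi> where v: "sq_int M ?v" and g: "sq_int M ?g"
    and \<phi>_all: "\<forall>n::nat. \<phi> n \<in> test_functions \<Omega>"
    and lim_v: "(\<lambda>n. \<integral>x. (norm (\<phi> n x - ?v x))\<^sup>2 \<partial>M) \<longlonglongrightarrow> 0"
    and lim_g: "(\<lambda>n. \<integral>x. (norm (grad (\<phi> n) x - ?g x))\<^sup>2 \<partial>M) \<longlonglongrightarrow> 0"
    using torsion_H10 by (rule H10_E)
  note \<phi> = \<phi>_all[rule_format]
  have one: "sq_int M (\<lambda>x. 1::real)" by (rule sq_int_bounded[OF finite_M, of _ 1]) auto
  have 1: "(\<lambda>n. \<integral>x. \<phi> n x \<partial>M) \<longlonglongrightarrow> (\<integral>x. ?v x \<partial>M)"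
    using L2_limit_inner[OF test_sq_int[OF \<phi>] v one lim_v] by simp
  have "(\<lambda>n. \<integral>x. grad (\<phi> n) x \<bullet> ?g x \<partial>M) \<longlonglongrightarrow> (\<integral>x. ?g x \<bullet> ?g x \<partial>M)"
    by (rule L2_limit_inner[OF grad_sq_int[OF \<phi>] g g lim_g])
  moreover have "(\<integral>x. grad (\<phi> n) x \<bullet> ?g x \<partial>M) = (\<integral>x. \<phi> n x \<partial>M)" for n
    using torsion_eq[OF \<phi>[of n]] by (simp add: inner_commute)
  ultimately have 2: "(\<lambda>n. \<integral>x. \<phi> n x \<partial>M) \<longlonglongrightarrow> (\<integral>x. ?g x \<bullet> ?g x \<partial>M)"
    by simp
  show ?thesis
    using LIMSEQ_unique[OF 1 2] by (simp add: power2_norm_eq_inner)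
qed

text \<open>
  The weak maximum principle, without a chain rule in the Sobolev space: if the test functions \<open>\<phi>\<^sub>n\<close>
  approximate the torsion function and \<open>w\<close> is the paraboloid, then \<open>flat 0 (w - \<phi>\<^sub>n - \<delta>)\<close> is itself a
  test function, since \<open>w \<ge> \<delta>\<close> only on a compact subset of the ball.
\<close>

lemma paraboloid_le_torsion_add:
  assumes r: "0 < r" and ball: "ball x0 r \<subseteq> \<Omega>" and \<delta>: "0 < \<delta>"
  shows "AE y in M. (r\<^sup>2 - (dist y x0)\<^sup>2) / (2 * real DIM('a)) \<le> torsion \<Omega> y + \<delta>"
proof -
  let ?v = "torsion \<Omega>" and ?g = "weak_grad \<Omega> (torsion \<Omega>)" and ?N = "real DIM('a)"
  obtain \<phi> where v: "sq_int M ?v" and g: "sq_int M ?g"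
    and \<phi>_all: "\<forall>n::nat. \<phi> n \<in> test_functions \<Omega>"
    and lim_v: "(\<lambda>n. \<integral>x. (norm (\<phi> n x - ?v x))\<^sup>2 \<partial>M) \<longlonglongrightarrow> 0"
    and lim_g: "(\<lambda>n. \<integral>x. (norm (grad (\<phi> n) x - ?g x))\<^sup>2 \<partial>M) \<longlonglongrightarrow> 0"
    using torsion_H10 by (rule H10_E)
  note \<phi> = \<phi>_all[rule_format]
  have N: "0 < ?N" by simp
  \<comment> \<open>The torsion function of the ball, continued as a polynomial to the whole space:
    it vanishes on the sphere of radius r and satisfies -\<Delta>w = 1 everywhere.\<close>
  define w where "w = (\<lambda>y. (1 / (2 * ?N)) * (r\<^sup>2 - (dist y x0)\<^sup>2))"
  have w: "cont_diff k w" for k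
    unfolding w_def by (intro cont_diff_cmult cont_diff_diff cont_diff_const cont_diff_dist_sq)
  have w_diff: "w differentiable (at y)" for y using w[of "Suc 0"] by simp
  have dw: "partial_deriv b w = (\<lambda>y. (- 1 / ?N) * (y \<bullet> b - x0 \<bullet> b))" for b
  proof
    fix y
    have "((\<lambda>y. (1 / (2 * ?N)) * (r\<^sup>2 - (y - x0) \<bullet> (y - x0))) has_derivative
        (\<lambda>h. (- 1 / ?N) * (h \<bullet> (y - x0)))) (at y)"
      by (auto intro!: derivative_eq_intros simp: inner_commute field_simps)
    then have "(w has_derivative (\<lambda>h. (- 1 / ?N) * (h \<bullet> (y - x0)))) (at y)"
      by (simp add: w_def dist_norm power2_norm_eq_inner)
    then show "partial_deriv b w y = (- 1 / ?N) * (y \<bullet> b - x0 \<bullet> b)"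
      by (subst partial_deriv_eq) (auto simp: inner_diff_right inner_commute)
  qed
  have ddw: "partial_deriv b (partial_deriv b w) y = - 1 / ?N" if "b \<in> Basis" for b y
  proof -
    have "((\<lambda>y. (- 1 / ?N) * (y \<bullet> b - x0 \<bullet> b)) has_derivative (\<lambda>h. (- 1 / ?N) * (h \<bullet> b))) (at y)"
      by (auto intro!: derivative_eq_intros)
    from partial_deriv_eq[OF this] show ?thesis
      unfolding dw using that by simp
  qed
  \<comment> \<open>The weak form of -\<Delta>w = 1: each of the m pure second derivatives equals
    -1/m, and integration by parts in every coordinate sums these to 1.\<close>
  have w_int: "integrable M (\<lambda>x. grad w x \<bullet> grad \<psi> x)"
      "(\<integral>x. grad w x \<bullet> grad \<psi> x \<partial>M) = (\<integral>x. \<psi> x \<partial>M)" if \<psi>: "\<psi> \<in> test_functions \<Omega>" for \<psi>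
  proof -
    have eq: "grad w x \<bullet> grad \<psi> x = (\<Sum>b\<in>Basis. partial_deriv b w x * partial_deriv b \<psi> x)" for x
      unfolding grad_inner[of w] by (intro sum.cong refl) (simp only: grad_inner_Basis)
    have dwk: "cont_diff k (partial_deriv b w)" if "b \<in> Basis" for b k
      using w[of "Suc k"] that by simp
    have i: "integrable M (\<lambda>x. partial_deriv b w x * partial_deriv b \<psi> x)" if "b \<in> Basis" for b
      by (intro test_integrable test_smooth_mult test_partial_deriv \<psi> dwk that)
    show "integrable M (\<lambda>x. grad w x \<bullet> grad \<psi> x)"
      unfolding eq by (rule Bochner_Integration.integrable_sum) (rule i)
    have "(\<integral>x. grad w x \<bullet> grad \<psi> x \<partial>M) = (\<Sum>b\<in>Basis. \<integral>x. partial_deriv b w x * partial_deriv b \<psi> x \<partial>M)"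
      unfolding eq by (rule Bochner_Integration.integral_sum) (rule i)
    also have "\<dots> = (\<Sum>b\<in>(Basis::'a set). (1 / ?N) * (\<integral>x. \<psi> x \<partial>M))"
    proof (rule sum.cong[OF refl])
      fix b :: 'a assume b: "b \<in> Basis"
      show "(\<integral>x. partial_deriv b w x * partial_deriv b \<psi> x \<partial>M) = (1 / ?N) * (\<integral>x. \<psi> x \<partial>M)"
        unfolding integral_by_parts[OF \<psi> dwk[OF b] sets_dom b] ddw[OF b] by simp
    qed
    also have "\<dots> = (\<integral>x. \<psi> x \<partial>M)" by simp
    finally show "(\<integral>x. grad w x \<bullet> grad \<psi> x \<partial>M) = (\<integral>x. \<psi> x \<partial>M)" .
  qed
  define s where "s = (\<lambda>n y. w y - \<phi> n y - \<delta>)"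
  have s: "cont_diff k (s n)" for k n
    unfolding s_def by (intro cont_diff_diff w test_cont_diff[OF \<phi>] cont_diff_const)
  define \<psi> where "\<psi> = (\<lambda>n y. flat 0 (s n y))"
  have \<psi>: "\<psi> n \<in> test_functions \<Omega>" for n
  proof -
    obtain K where K: "compact K" "K \<subseteq> \<Omega>" "\<And>x. x \<notin> K \<Longrightarrow> \<phi> n x = 0"
      using \<phi>[of n] by (metis test_functionsE)
    \<comment> \<open>Outside the closed ball of this radius w < \<delta>; since \<delta> > 0 it is
      strictly smaller than r, which leaves a compact subset of \<Omega>.\<close>
    define \<rho> where "\<rho> = sqrt (max 0 (r\<^sup>2 - 2 * ?N * \<delta>))"
    have "\<rho> < r"
    proof -
      have "max 0 (r\<^sup>2 - 2 * ?N * \<delta>) < r\<^sup>2" using r \<delta> by simp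
      then have "\<rho> < sqrt (r\<^sup>2)" unfolding \<rho>_def by (rule real_sqrt_less_mono)
      then show ?thesis using r by simp
    qed
    show ?thesis
    proof (rule test_functionsI)
      show "cont_diff k (\<psi> n)" for k
        unfolding \<psi>_def by (intro cont_diff_flat s)
      show "compact (K \<union> cball x0 \<rho>)" using K(1) by (intro compact_Un compact_cball)
      have "cball x0 \<rho> \<subseteq> ball x0 r" using \<open>\<rho> < r\<close> by (auto simp: subset_eq)
      then show "K \<union> cball x0 \<rho> \<subseteq> \<Omega>" using K(2) ball by (simp add: subset_trans[of _ "ball x0 r"])
      fix y assume "y \<notin> K \<union> cball x0 \<rho>"
      then have "\<phi> n y = 0" "\<rho> < dist y x0" using K(3) by (auto simp: dist_commute)
      have "\<rho>\<^sup>2 < (dist y x0)\<^sup>2"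
        using \<open>\<rho> < dist y x0\<close> by (intro power_strict_mono) (auto simp: \<rho>_def)
      moreover have "r\<^sup>2 - 2 * ?N * \<delta> \<le> \<rho>\<^sup>2"
        unfolding \<rho>_def by (subst real_sqrt_pow2) simp_all
      ultimately have "r\<^sup>2 - (dist y x0)\<^sup>2 < 2 * ?N * \<delta>"
        by linarith
      then have "w y < \<delta>" unfolding w_def using N by (simp add: field_simps)
      then show "\<psi> n y = 0" using \<open>\<phi> n y = 0\<close> by (simp add: \<psi>_def s_def flat_def)
    qed
  qed
  have grad_\<psi>: "grad (\<psi> n) y = flat 2 (s n y) *\<^sub>R (grad w y - grad (\<phi> n) y)" for n y
  proof -
    have "s n differentiable (at y)" using s[of "Suc 0" n] by simp
    then have "partial_deriv b (\<psi> n) y = flat 2 (s n y) * partial_deriv b (s n) y" for b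
      unfolding \<psi>_def by (subst partial_deriv_flat) (simp_all add: numeral_2_eq_2)
    moreover have "partial_deriv b (s n) y = partial_deriv b w y - partial_deriv b (\<phi> n) y" for b
    proof -
      have "(s n has_derivative (\<lambda>h. frechet_derivative w (at y) h - frechet_derivative (\<phi> n) (at y) h)) (at y)"
        unfolding s_def
        using has_derivative_frechet[OF w_diff[of y]]
          has_derivative_frechet[OF test_differentiable[OF \<phi>[of n], of y]]
        by (auto intro!: derivative_eq_intros)
      then show ?thesis by (simp add: partial_deriv_eq) (simp add: partial_deriv_def)
    qed
    ultimately show ?thesis
      by - (rule euclidean_eqI, simp add: grad_inner_Basis inner_diff_left)
  qed
  let ?e = "\<lambda>n. \<integral>x. (norm (grad (\<phi> n) x - ?g x))\<^sup>2 \<partial>M"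
  \<comment> \<open>The gradient of the truncation is h times the difference of the gradients of w
    and \<open>\<phi> n\<close>, with 0 \<le> h \<le> 1, so its square is at most its inner product
    with that difference. Since w and v satisfy the same weak equation, the gradient of w may be
    replaced by that of v, and Cauchy-Schwarz leaves only the approximation error.\<close>
  have Q: "(\<integral>x. (norm (grad (\<psi> n) x))\<^sup>2 \<partial>M) \<le> ?e n" for n
  proof -
    let ?Q = "\<integral>x. (norm (grad (\<psi> n) x))\<^sup>2 \<partial>M"
    have G: "sq_int M (grad (\<phi> n))" "sq_int M (grad (\<psi> n))" using grad_sq_int \<phi> \<psi> by auto
    have G': "sq_int M (\<lambda>x. ?g x - grad (\<phi> n) x)" by (rule sq_int_diff[OF g G(1)])
    have "?Q \<le> (\<integral>x. grad w x \<bullet> grad (\<psi> n) x - grad (\<phi> n) x \<bullet> grad (\<psi> n) x \<partial>M)"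
    proof (rule integral_mono)
      show "integrable M (\<lambda>x. (norm (grad (\<psi> n) x))\<^sup>2)" by (rule sq_intD(2)[OF G(2)])
      show "integrable M (\<lambda>x. grad w x \<bullet> grad (\<psi> n) x - grad (\<phi> n) x \<bullet> grad (\<psi> n) x)"
        by (intro Bochner_Integration.integrable_diff w_int(1)[OF \<psi>] sq_int_inner[OF G])
      fix x
      let ?a = "grad w x - grad (\<phi> n) x" and ?h = "flat 2 (s n x)"
      have "(norm (?h *\<^sub>R ?a))\<^sup>2 = ?h * (?h * (norm ?a)\<^sup>2)"
        by (simp add: power2_eq_square flat_nonneg)
      also have "\<dots> \<le> 1 * (?h * (norm ?a)\<^sup>2)"
        using flat_2_le_1 flat_nonneg by (intro mult_right_mono) simp_all
      also have "\<dots> = ?a \<bullet> (?h *\<^sub>R ?a)" by (simp add: power2_norm_eq_inner)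
      finally show "(norm (grad (\<psi> n) x))\<^sup>2 \<le> grad w x \<bullet> grad (\<psi> n) x - grad (\<phi> n) x \<bullet> grad (\<psi> n) x"
        unfolding grad_\<psi> by (simp only: inner_diff_left)
    qed
    also have "\<dots> = (\<integral>x. \<psi> n x \<partial>M) - (\<integral>x. grad (\<phi> n) x \<bullet> grad (\<psi> n) x \<partial>M)"
      by (simp only: Bochner_Integration.integral_diff[OF w_int(1)[OF \<psi>] sq_int_inner[OF G]] w_int(2)[OF \<psi>])
    also have "\<dots> = (\<integral>x. ?g x \<bullet> grad (\<psi> n) x \<partial>M) - (\<integral>x. grad (\<phi> n) x \<bullet> grad (\<psi> n) x \<partial>M)"
      by (simp only: torsion_eq[OF \<psi>])
    also have "\<dots> = (\<integral>x. (?g x - grad (\<phi> n) x) \<bullet> grad (\<psi> n) x \<partial>M)"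
      by (simp only: inner_diff_left
          Bochner_Integration.integral_diff[OF sq_int_inner[OF g G(2)] sq_int_inner[OF G]])
    finally have "?Q\<^sup>2 \<le> (\<integral>x. (?g x - grad (\<phi> n) x) \<bullet> grad (\<psi> n) x \<partial>M)\<^sup>2"
      by (rule power_mono) simp
    also have "\<dots> \<le> (\<integral>x. (norm (?g x - grad (\<phi> n) x))\<^sup>2 \<partial>M) * ?Q"
      by (rule Cauchy_Schwarz_integral[OF G' G(2)])
    finally have "?Q\<^sup>2 \<le> ?e n * ?Q" by (simp only: norm_minus_commute)
    moreover have "0 \<le> ?Q" "0 \<le> ?e n" by (simp_all only: Bochner_Integration.integral_nonneg zero_le_power2)
    moreover have "q \<le> e" if "q\<^sup>2 \<le> e * q" "0 \<le> q" "0 \<le> e" for q e :: real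
      using that by (cases "q = 0") (simp_all add: power2_eq_square)
    ultimately show ?thesis by blast
  qed
  obtain P where P: "0 \<le> P" "\<And>w. w \<in> test_functions \<Omega> \<Longrightarrow>
    (\<integral>x. (norm (w x))\<^sup>2 \<partial>M) \<le> P * (\<integral>x. (norm (grad w x))\<^sup>2 \<partial>M)"
    using poincare by metis
  have \<psi>_bound: "(\<integral>x. (norm (\<psi> n x))\<^sup>2 \<partial>M) \<le> P * ?e n" for n
    using P(2)[OF \<psi>] mult_left_mono[OF Q P(1)] by (rule order_trans)
  have lim_\<psi>: "(\<lambda>n. \<integral>x. (norm (\<psi> n x - 0))\<^sup>2 \<partial>M) \<longlonglongrightarrow> 0"
  proof (rule tendsto_sandwich[OF _ _ tendsto_const])
    show "(\<lambda>n. P * ?e n) \<longlonglongrightarrow> 0" by (rule tendsto_mult_right_zero[OF lim_g])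
    show "eventually (\<lambda>n. (\<integral>x. (norm (\<psi> n x - 0))\<^sup>2 \<partial>M) \<le> P * ?e n) sequentially"
      using \<psi>_bound by (intro always_eventually allI) (simp only: diff_zero)
  qed simp
  obtain r1 :: "nat \<Rightarrow> nat" where r1: "strict_mono r1" and AE1: "AE x in M. (\<lambda>n. \<phi> (r1 n) x) \<longlonglongrightarrow> ?v x"
    using L2_limit_AE_subseq[OF test_sq_int[OF \<phi>] v lim_v] by blast
  have zero: "sq_int M (\<lambda>x. 0::real)" by (simp add: sq_int_def)
  have lim_\<psi>1: "(\<lambda>n. \<integral>x. (norm (\<psi> (r1 n) x - 0))\<^sup>2 \<partial>M) \<longlonglongrightarrow> 0"
    using LIMSEQ_subseq_LIMSEQ[OF lim_\<psi> r1] by (simp only: comp_def)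
  obtain r2 :: "nat \<Rightarrow> nat" where r2: "strict_mono r2" and AE2: "AE x in M. (\<lambda>n. \<psi> (r1 (r2 n)) x) \<longlonglongrightarrow> 0"
    using L2_limit_AE_subseq[of M "\<lambda>n. \<psi> (r1 n)", OF test_sq_int[OF \<psi>] zero lim_\<psi>1] by blast
  from AE1 AE2 show ?thesis
  proof eventually_elim
    case (elim y)
    have "(\<lambda>n. \<phi> (r1 (r2 n)) y) \<longlonglongrightarrow> ?v y"
      using LIMSEQ_subseq_LIMSEQ[OF elim(1) r2] by (simp only: comp_def)
    then have "(\<lambda>n. s (r1 (r2 n)) y) \<longlonglongrightarrow> w y - ?v y - \<delta>"
      unfolding s_def by (intro tendsto_intros)
    then have "(\<lambda>n. \<psi> (r1 (r2 n)) y) \<longlonglongrightarrow> flat 0 (w y - ?v y - \<delta>)"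
      unfolding \<psi>_def by (rule isCont_tendsto_compose[OF continuous_flat])
    with elim(2) have "flat 0 (w y - ?v y - \<delta>) = 0" by (rule LIMSEQ_unique[symmetric])
    \<comment> \<open>\<open>flat 0\<close> vanishes exactly on the nonpositive reals, so a limit of
      0 determines the sign of the argument.\<close>
    then have "w y - ?v y - \<delta> \<le> 0" by (simp add: flat_def split: if_splits)
    then show ?case by (simp add: w_def)
  qed
qed

text \<open>Let \<delta> run through 1/(k+1): countably many exceptional null sets have a null
  union, and \<delta> can be removed outside it.\<close>

lemma paraboloid_le_torsion:
  assumes "0 < r" "ball x0 r \<subseteq> \<Omega>"
  shows "AE y in M. (r\<^sup>2 - (dist y x0)\<^sup>2) / (2 * real DIM('a)) \<le> torsion \<Omega> y"
proof -
  have "AE y in M. \<forall>k. (r\<^sup>2 - (dist y x0)\<^sup>2) / (2 * real DIM('a)) \<le> torsion \<Omega> y + inverse (real (Suc k))"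
    unfolding AE_all_countable using assms by (intro allI paraboloid_le_torsion_add) auto
  then show ?thesis
  proof eventually_elim
    case (elim y)
    show ?case
    proof (rule field_le_epsilon)
      fix e :: real assume "0 < e"
      then obtain k where "inverse (real (Suc k)) < e" using reals_Archimedean by blast
      then show "(r\<^sup>2 - (dist y x0)\<^sup>2) / (2 * real DIM('a)) \<le> torsion \<Omega> y + e"
        using elim[rule_format, of k] by linarith
    qed
  qed
qed

text \<open>The ball of radius d(y) centred at y would give the bound at y, but the exceptional null
  set depends on the ball. Balls with centres in a countable dense set and rational radii have one
  common null set, and off it the ideal ball is approximated from inside.\<close>

lemma dist_sq_le_torsion: "AE y in M. (d y)\<^sup>2 / (2 * real DIM('a)) \<le> torsion \<Omega> y"
proof -
  obtain X :: "'a set" where X: "countable X" "\<And>U. open U \<Longrightarrow> U \<noteq> {} \<Longrightarrow> \<exists>x\<in>X. x \<in> U"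
    using countable_dense_exists by blast
  define I where "I = {(x, q). x \<in> X \<and> q \<in> \<rat> \<and> 0 < q \<and> ball x q \<subseteq> \<Omega>}"
  have "I \<subseteq> X \<times> \<rat>" by (auto simp: I_def)
  then have "countable I"
    by (rule countable_subset) (intro countable_SIGMA X(1) countable_rat)
  then have "AE y in M. \<forall>p\<in>I. ((snd p)\<^sup>2 - (dist y (fst p))\<^sup>2) / (2 * real DIM('a)) \<le> torsion \<Omega> y"
    by (subst AE_ball_countable) (auto simp: I_def intro!: paraboloid_le_torsion)
  with AE_space show ?thesis
  proof eventually_elim
    case (elim y)
    then have dy: "0 < d y" using d_pos by simp
    let ?N = "2 * real DIM('a)"
    have *: "((d y - 2 * t)\<^sup>2 - t\<^sup>2) / ?N \<le> torsion \<Omega> y" if t: "0 < t" "t < d y / 2" for t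
    proof -
      obtain x where x: "x \<in> X" "x \<in> ball y t" using X(2)[of "ball y t"] t by auto
      \<comment> \<open>With the centre within t of y, a radius below d(y) - t keeps the ball inside
        the one of radius d(y) about y, and a radius above d(y) - 2t loses nothing as t tends to
        0.\<close>
      obtain q where q: "q \<in> \<rat>" "d y - 2 * t < q" "q < d y - t"
        using Rats_dense_in_real[of "d y - 2 * t" "d y - t"] t by auto
      have xy: "dist y x < t" using x(2) by simp
      have "ball x q \<subseteq> ball y (d y)"
      proof
        fix z assume "z \<in> ball x q"
        then have "dist x z < q" by simp
        then show "z \<in> ball y (d y)" using dist_triangle[of y z x] xy q(3) by simp
      qed
      then have "ball x q \<subseteq> \<Omega>" using ball_subset by (rule subset_trans)
      then have "(x, q) \<in> I"
        using x(1) q t unfolding I_def by simp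
      from bspec[OF elim(2) this] have le: "(q\<^sup>2 - (dist y x)\<^sup>2) / ?N \<le> torsion \<Omega> y"
        by simp
      have "(d y - 2 * t)\<^sup>2 \<le> q\<^sup>2" using q t by (intro power_mono) auto
      moreover have "(dist y x)\<^sup>2 \<le> t\<^sup>2" using xy by (intro power_mono) auto
      ultimately have "((d y - 2 * t)\<^sup>2 - t\<^sup>2) / ?N \<le> (q\<^sup>2 - (dist y x)\<^sup>2) / ?N"
        by (intro divide_right_mono) auto
      then show ?thesis using le by (rule order_trans)
    qed
    have "((\<lambda>t. ((d y - 2 * t)\<^sup>2 - t\<^sup>2) / ?N) \<longlongrightarrow> ((d y - 2 * 0)\<^sup>2 - 0\<^sup>2) / ?N) (at_right 0)"
      by (intro tendsto_intros) simp
    moreover have "eventually (\<lambda>t. ((d y - 2 * t)\<^sup>2 - t\<^sup>2) / ?N \<le> torsion \<Omega> y) (at_right 0)"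
      unfolding eventually_at_right_field using * dy by (intro exI[of _ "d y / 2"]) auto
    ultimately have "((d y - 2 * 0)\<^sup>2 - 0\<^sup>2) / ?N \<le> torsion \<Omega> y"
      by (rule tendsto_upperbound) (rule trivial_limit_at_right_real)
    then show ?case by simp
  qed
qed

lemma torsion_nonneg: "AE y in M. 0 \<le> torsion \<Omega> y"
  using dist_sq_le_torsion
  by eventually_elim (rule order_trans[rotated], assumption, simp)

section \<open>Integrals of d^2 and of the torsion function over subsets\<close>

lemma integral_subset:
  fixes f :: "'a \<Rightarrow> real"
  assumes "A \<in> sets lebesgue" "A \<subseteq> \<Omega>"
  shows "(\<integral>x. f x \<partial>lebesgue_on A) = (\<integral>x. indicator A x * f x \<partial>M)"
proof -
  have "(\<integral>x. indicator A x * f x \<partial>M) = (\<integral>x. (if x \<in> A then f x else 0) \<partial>M)"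
    by (intro Bochner_Integration.integral_cong) auto
  also have "\<dots> = (\<integral>x. f x \<partial>lebesgue_on A)"
    by (rule integral_restrict) (use assms sets_dom in auto)
  finally show ?thesis by simp
qed

lemma indicator_measurable [measurable]:
  "A \<in> sets lebesgue \<Longrightarrow> indicat_real A \<in> borel_measurable M"
  by (intro measurable_restrict_space1) simp

lemma d_sq_int_on:
  assumes "A \<in> sets lebesgue"
  shows "sq_int M (\<lambda>x. indicator A x * d x)"
proof -
  obtain D where D: "0 < D" "\<And>x. d x \<le> D" using d_bounded by blast
  have m: "(\<lambda>x. indicat_real A x * d x) \<in> borel_measurable M"
    using indicator_measurable[OF assms] by measurable
  show ?thesis
  proof (rule sq_int_bounded[OF finite_M m])
    show "norm (indicat_real A x * d x) \<le> D" for x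
      using D d_nonneg[of x] by (auto simp: indicator_def less_imp_le)
  qed
qed

lemma d_sq_on:
  assumes "A \<in> sets lebesgue" "A \<subseteq> \<Omega>"
  shows "(\<integral>x. (norm (indicator A x * d x))\<^sup>2 \<partial>M) = (\<integral>x. (d x)\<^sup>2 \<partial>lebesgue_on A)"
    "integrable (lebesgue_on A) (\<lambda>x. (d x)\<^sup>2)"
    "(\<integral>\<^sup>+x. ennreal ((d x)\<^sup>2) \<partial>lebesgue_on A) = ennreal (\<integral>x. (d x)\<^sup>2 \<partial>lebesgue_on A)"
proof -
  have eq: "(norm (indicator A x * d x))\<^sup>2 = indicator A x * (d x)\<^sup>2" for x
    by (auto simp: indicator_def)
  show "(\<integral>x. (norm (indicator A x * d x))\<^sup>2 \<partial>M) = (\<integral>x. (d x)\<^sup>2 \<partial>lebesgue_on A)"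
    unfolding eq integral_subset[OF assms] ..
  obtain D where D: "0 < D" "\<And>x. d x \<le> D" using d_bounded by blast
  have "emeasure lebesgue A \<le> emeasure lebesgue \<Omega>" using assms sets_dom by (intro emeasure_mono)
  then have "emeasure (lebesgue_on A) (space (lebesgue_on A)) \<noteq> \<infinity>"
    using assms emeasure_finite by (auto simp: emeasure_restrict_space top_unique)
  then have "finite_measure (lebesgue_on A)" by (rule finite_measureI)
  then have "sq_int (lebesgue_on A) d"
    by (rule sq_int_bounded[OF _ d_measurable, of _ D]) (use D d_nonneg in simp)
  then show i: "integrable (lebesgue_on A) (\<lambda>x. (d x)\<^sup>2)"
    using sq_intD(2) by fastforce
  show "(\<integral>\<^sup>+x. ennreal ((d x)\<^sup>2) \<partial>lebesgue_on A) = ennreal (\<integral>x. (d x)\<^sup>2 \<partial>lebesgue_on A)"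
    by (rule nn_integral_eq_integral[OF i]) simp
qed

lemma integral_d_sq_pos: "0 < (\<integral>x. (d x)\<^sup>2 \<partial>M)"
proof -
  have "(\<integral>x. (d x)\<^sup>2 \<partial>M) \<noteq> 0"
  proof
    assume "(\<integral>x. (d x)\<^sup>2 \<partial>M) = 0"
    then have "AE x in M. (d x)\<^sup>2 = 0"
      using d_sq_on(2)[OF sets_dom order_refl] by (subst (asm) integral_nonneg_eq_0_iff_AE) auto
    then have "AE x in M. False"
      using AE_space by eventually_elim (use d_pos in force)
    then show False using emeasure_M emeasure_pos by (simp add: eventually_False ae_filter_eq_bot_iff)
  qed
  moreover have "0 \<le> (\<integral>x. (d x)\<^sup>2 \<partial>M)" by simp
  ultimately show ?thesis by (rule le_neq_trans[OF _ not_sym, rotated])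
qed

lemma integral_d_sq_le: "(\<integral>x. (d x)\<^sup>2 \<partial>M) \<le> 2 * real DIM('a) * (\<integral>x. torsion \<Omega> x \<partial>M)"
proof -
  have "(\<integral>x. (d x)\<^sup>2 / (2 * real DIM('a)) \<partial>M) \<le> (\<integral>x. torsion \<Omega> x \<partial>M)"
    using d_sq_on(2)[OF sets_dom order_refl]
    by (intro integral_mono_AE torsion_integrable dist_sq_le_torsion) simp
  then have "(\<integral>x. (d x)\<^sup>2 \<partial>M) / (2 * real DIM('a)) \<le> (\<integral>x. torsion \<Omega> x \<partial>M)"
    by simp
  then show ?thesis by (subst (asm) pos_divide_le_eq) (simp_all add: mult.commute)
qed

lemma integral_torsion_pos: "0 < (\<integral>x. torsion \<Omega> x \<partial>M)"
proof -
  have "0 < 2 * real DIM('a) * (\<integral>x. torsion \<Omega> x \<partial>M)"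
    using integral_d_sq_pos integral_d_sq_le by (rule less_le_trans)
  then show ?thesis by (simp add: zero_less_mult_iff)
qed

text \<open>Write v as (v/d) d. Hardy's inequality controls the first factor on all of \<Omega>, and
  the indicator of A is attached to the second one only.\<close>

lemma integral_torsion_on_sq_le:
  assumes "A \<in> sets lebesgue" "A \<subseteq> \<Omega>"
  shows "(\<integral>x. torsion \<Omega> x \<partial>lebesgue_on A)\<^sup>2
    \<le> c * (\<integral>x. torsion \<Omega> x \<partial>M) * (\<integral>x. (d x)\<^sup>2 \<partial>lebesgue_on A)"
proof -
  let ?f = "\<lambda>x. torsion \<Omega> x / d x" and ?I = "\<integral>x. torsion \<Omega> x \<partial>M"
  have [measurable]: "torsion \<Omega> \<in> borel_measurable M" by (rule sq_intD(1)[OF torsion_sq_int])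
  have bound: "(\<integral>\<^sup>+x. ennreal ((norm (?f x))\<^sup>2) \<partial>M) \<le> ennreal (c * ?I)"
    using hardy_H10[OF torsion_H10] unfolding integral_torsion by (simp add: power_divide)
  have f: "sq_int M ?f"
    unfolding sq_int_def integrable_iff_bounded
    using le_less_trans[OF bound] by simp
  have "ennreal (\<integral>x. (norm (?f x))\<^sup>2 \<partial>M) \<le> ennreal (c * ?I)"
    using bound nn_integral_eq_integral[OF sq_intD(2)[OF f]] by simp
  then have le: "(\<integral>x. (norm (?f x))\<^sup>2 \<partial>M) \<le> c * ?I"
    using c_pos integral_torsion_pos by (subst (asm) ennreal_le_iff) auto
  have "(\<integral>x. torsion \<Omega> x \<partial>lebesgue_on A) = (\<integral>x. ?f x \<bullet> (indicator A x * d x) \<partial>M)"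
    unfolding integral_subset[OF assms] using d_pos
    by (intro Bochner_Integration.integral_cong) (auto simp: less_imp_neq[symmetric])
  then have "(\<integral>x. torsion \<Omega> x \<partial>lebesgue_on A)\<^sup>2
      \<le> (\<integral>x. (norm (?f x))\<^sup>2 \<partial>M) * (\<integral>x. (norm (indicator A x * d x))\<^sup>2 \<partial>M)"
    using Cauchy_Schwarz_integral[OF f d_sq_int_on[OF assms(1)]] by (simp only:)
  also have "\<dots> \<le> c * ?I * (\<integral>x. (norm (indicator A x * d x))\<^sup>2 \<partial>M)"
    by (intro mult_right_mono le) simp
  finally show ?thesis unfolding d_sq_on(1)[OF assms] .
qed

lemma integral_torsion_le: "(\<integral>x. torsion \<Omega> x \<partial>M) \<le> c * (\<integral>x. (d x)\<^sup>2 \<partial>M)"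
proof -
  have "(\<integral>x. torsion \<Omega> x \<partial>M) * (\<integral>x. torsion \<Omega> x \<partial>M)
      \<le> (\<integral>x. torsion \<Omega> x \<partial>M) * (c * (\<integral>x. (d x)\<^sup>2 \<partial>M))"
    using integral_torsion_on_sq_le[OF sets_dom order_refl]
    by (simp only: power2_eq_square mult_ac)
  then show ?thesis using integral_torsion_pos by (rule mult_left_le_imp_le)
qed

section \<open>Norms, the first eigenvalue and the two bounds on the efficiency\<close>

lemma L1_norm_torsion: "L1_norm \<Omega> (torsion \<Omega>) = ennreal (\<integral>x. torsion \<Omega> x \<partial>M)"
proof -
  have "L1_norm \<Omega> (torsion \<Omega>) = (\<integral>\<^sup>+x. ennreal (torsion \<Omega> x) \<partial>M)"
    unfolding L1_norm_def
    by (rule nn_integral_cong_AE) (use torsion_nonneg in \<open>eventually_elim, simp\<close>)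
  also have "\<dots> = ennreal (\<integral>x. torsion \<Omega> x \<partial>M)"
    by (rule nn_integral_eq_integral[OF torsion_integrable torsion_nonneg])
  finally show ?thesis .
qed

lemma L1_norm_d_sq: "L1_norm \<Omega> (\<lambda>x. (d x)\<^sup>2) = ennreal (\<integral>x. (d x)\<^sup>2 \<partial>M)"
  using d_sq_on(3)[OF sets_dom order_refl] by (simp add: L1_norm_def)

lemma AE_le_Linf: "AE x in M. ennreal \<bar>f x\<bar> \<le> Linf_norm \<Omega> f"
  unfolding Linf_norm_def by (rule esssup_AE)

lemma Linf_d_sq_finite: "Linf_norm \<Omega> (\<lambda>x. (d x)\<^sup>2) < \<infinity>"
proof -
  obtain D where D: "0 < D" "\<And>x. d x \<le> D" using d_bounded by blast
  have "Linf_norm \<Omega> (\<lambda>x. (d x)\<^sup>2) \<le> ennreal (D\<^sup>2)"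
    unfolding Linf_norm_def using D d_nonneg
    by (intro esssup_I AE_I2 ennreal_leI) (auto intro!: power_mono)
  then show ?thesis by (rule le_less_trans) simp
qed

lemma Linf_d_sq_pos: "0 < Linf_norm \<Omega> (\<lambda>x. (d x)\<^sup>2)"
proof (rule ccontr)
  assume "\<not> ?thesis"
  then have "AE x in M. ennreal \<bar>(d x)\<^sup>2\<bar> \<le> 0" using AE_le_Linf[of "\<lambda>x. (d x)\<^sup>2"] by simp
  then have "AE x in M. False"
    using AE_space by eventually_elim (use d_pos in force)
  then show False using emeasure_M emeasure_pos by (simp add: eventually_False ae_filter_eq_bot_iff)
qed

lemma Linf_d_sq_le: "Linf_norm \<Omega> (\<lambda>x. (d x)\<^sup>2) \<le> ennreal (2 * real DIM('a)) * Linf_norm \<Omega> (torsion \<Omega>)"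
  unfolding Linf_norm_def[of _ "\<lambda>x. (d x)\<^sup>2"]
proof (rule esssup_I)
  show "AE x in M. ennreal \<bar>(d x)\<^sup>2\<bar> \<le> ennreal (2 * real DIM('a)) * Linf_norm \<Omega> (torsion \<Omega>)"
    using dist_sq_le_torsion AE_le_Linf[of "torsion \<Omega>"]
  proof eventually_elim
    case (elim x)
    then have "(d x)\<^sup>2 \<le> 2 * real DIM('a) * \<bar>torsion \<Omega> x\<bar>"
      by (subst (asm) pos_divide_le_eq) (auto simp: mult.commute intro: order_trans mult_left_mono)
    then have "ennreal \<bar>(d x)\<^sup>2\<bar> \<le> ennreal (2 * real DIM('a)) * ennreal \<bar>torsion \<Omega> x\<bar>"
      by (simp add: ennreal_mult[symmetric] ennreal_leI)
    also have "\<dots> \<le> ennreal (2 * real DIM('a)) * Linf_norm \<Omega> (torsion \<Omega>)"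
      by (intro mult_left_mono elim(2)) simp
    finally show ?case .
  qed
qed simp

text \<open>On \<Omega> the square of u is d^2 times u^2/d^2, and d^2 is at most its essential
  supremum almost everywhere; Hardy's inequality on H10 then bounds every Rayleigh quotient. The
  product form can be multiplied by a possibly infinite norm without dividing in
  \<open>ennreal\<close>.\<close>

lemma first_eigenvalue_ge: "1 \<le> first_eigenvalue \<Omega> * (ennreal c * Linf_norm \<Omega> (\<lambda>x. (d x)\<^sup>2))"
proof -
  let ?L = "Linf_norm \<Omega> (\<lambda>x. (d x)\<^sup>2)"
  have K: "0 < ennreal c * ?L" "ennreal c * ?L < \<infinity>"
    using c_pos Linf_d_sq_pos Linf_d_sq_finite
    by (auto simp: ennreal_zero_less_mult_iff ennreal_mult_less_top)
  have "1 / (ennreal c * ?L) \<le> first_eigenvalue \<Omega>"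
    unfolding first_eigenvalue_def
  proof (rule INF_greatest)
    fix u assume "u \<in> {\<phi> \<in> H10 \<Omega>. L2_norm_sq \<Omega> \<phi> \<noteq> 0}"
    then have u: "u \<in> H10 \<Omega>" and nz: "L2_norm_sq \<Omega> u \<noteq> 0" by auto
    have sq: "sq_int M u" "sq_int M (weak_grad \<Omega> u)" using u by - (rule H10_E, assumption+)+
    have [measurable]: "u \<in> borel_measurable M" by (rule sq_intD(1)[OF sq(1)])
    have "L2_norm_sq \<Omega> u \<le> (\<integral>\<^sup>+x. ?L * ennreal ((u x)\<^sup>2 / (d x)\<^sup>2) \<partial>M)"
      unfolding L2_norm_sq_def
    proof (rule nn_integral_mono_AE)
      show "AE x in M. ennreal ((norm (u x))\<^sup>2) \<le> ?L * ennreal ((u x)\<^sup>2 / (d x)\<^sup>2)"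
        using AE_le_Linf[of "\<lambda>x. (d x)\<^sup>2"] AE_space
      proof eventually_elim
        case (elim x)
        then have "d x \<noteq> 0" using d_pos[of x] by simp
        then have "ennreal ((norm (u x))\<^sup>2) = ennreal \<bar>(d x)\<^sup>2\<bar> * ennreal ((u x)\<^sup>2 / (d x)\<^sup>2)"
          by (simp add: ennreal_mult[symmetric])
        also have "\<dots> \<le> ?L * ennreal ((u x)\<^sup>2 / (d x)\<^sup>2)"
          by (intro mult_right_mono elim(1)) simp
        finally show ?case .
      qed
    qed
    also have "\<dots> = ?L * (\<integral>\<^sup>+x. ennreal ((u x)\<^sup>2 / (d x)\<^sup>2) \<partial>M)"
      by (intro nn_integral_cmult) measurable
    also have "\<dots> \<le> ?L * ennreal (c * (\<integral>x. (norm (weak_grad \<Omega> u x))\<^sup>2 \<partial>M))"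
      by (intro mult_left_mono hardy_H10 u) simp
    also have "\<dots> = L2_norm_sq \<Omega> (weak_grad \<Omega> u) * (ennreal c * ?L)"
      unfolding L2_norm_sq_eq[OF sq(2)] using c_pos by (simp add: ennreal_mult mult_ac)
    finally have le: "L2_norm_sq \<Omega> u \<le> L2_norm_sq \<Omega> (weak_grad \<Omega> u) * (ennreal c * ?L)" .
    have fin: "L2_norm_sq \<Omega> u < \<infinity>" unfolding L2_norm_sq_eq[OF sq(1)] by simp
    have "1 = L2_norm_sq \<Omega> u / L2_norm_sq \<Omega> u"
      using nz fin by (simp add: ennreal_divide_self)
    also have "\<dots> \<le> L2_norm_sq \<Omega> (weak_grad \<Omega> u) * (ennreal c * ?L) / L2_norm_sq \<Omega> u"
      by (intro divide_right_mono_ennreal le)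
    also have "\<dots> = (ennreal c * ?L) * (L2_norm_sq \<Omega> (weak_grad \<Omega> u) / L2_norm_sq \<Omega> u)"
      by (subst ennreal_times_divide) (simp only: mult_ac)
    finally have "1 \<le> (ennreal c * ?L) * (L2_norm_sq \<Omega> (weak_grad \<Omega> u) / L2_norm_sq \<Omega> u)" .
    then show "1 / (ennreal c * ?L) \<le> L2_norm_sq \<Omega> (weak_grad \<Omega> u) / L2_norm_sq \<Omega> u"
      using K by (intro divide_le_posI_ennreal) auto
  qed
  then have "1 / (ennreal c * ?L) * (ennreal c * ?L) \<le> first_eigenvalue \<Omega> * (ennreal c * ?L)"
    by (rule mult_right_mono) simp
  moreover have "1 / (ennreal c * ?L) * (ennreal c * ?L) = 1"
  proof -
    have "(ennreal c * ?L) / (ennreal c * ?L) = 1" using K by (intro ennreal_divide_self) auto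
    then show ?thesis by (simp only: ennreal_divide_times mult_1)
  qed
  ultimately show ?thesis by simp
qed

text \<open>Multiply the eigenvalue bound by the supremum norm of v: the product of that norm with
  the first eigenvalue is one of the quantities over which \<open>torsion_const\<close> is the
  supremum.\<close>

lemma Linf_torsion_le:
  "Linf_norm \<Omega> (torsion \<Omega>) \<le> torsion_const TYPE('a) * (ennreal c * Linf_norm \<Omega> (\<lambda>x. (d x)\<^sup>2))"
proof -
  let ?E = "Linf_norm \<Omega> (torsion \<Omega>)" and ?K = "ennreal c * Linf_norm \<Omega> (\<lambda>x. (d x)\<^sup>2)"
  have "?E * 1 \<le> ?E * (first_eigenvalue \<Omega> * ?K)"
    by (intro mult_left_mono first_eigenvalue_ge) simp
  also have "\<dots> = (first_eigenvalue \<Omega> * ?E) * ?K" by (simp only: mult_ac)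
  also have "\<dots> \<le> torsion_const TYPE('a) * ?K"
    unfolding torsion_const_def using admissible by (intro mult_right_mono SUP_upper) auto
  finally show ?thesis by simp
qed

lemma emeasure_dom_cases:
  obtains w where "emeasure lebesgue \<Omega> = ennreal w" "0 < w"
  using emeasure_pos emeasure_finite by (cases "emeasure lebesgue \<Omega>") (auto simp: ennreal_less_zero_iff)

lemma Linf_d_sq_real:
  obtains l where "Linf_norm \<Omega> (\<lambda>x. (d x)\<^sup>2) = ennreal l" "0 < l"
  using Linf_d_sq_pos Linf_d_sq_finite by (cases "Linf_norm \<Omega> (\<lambda>x. (d x)\<^sup>2)") auto

text \<open>The numerator is bounded below by the integral of d^2 over 2m, and the supremum norm in
  the denominator is bounded above by \<open>Linf_torsion_le\<close>.\<close>

lemma efficiency_ge: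
  "1 / (2 * of_nat DIM('a) * torsion_const TYPE('a) * ennreal c)
      * (L1_norm \<Omega> (\<lambda>x. (d x)\<^sup>2) / (emeasure lebesgue \<Omega> * Linf_norm \<Omega> (\<lambda>x. (d x)\<^sup>2)))
    \<le> efficiency \<Omega>"
proof (cases "torsion_const TYPE('a)")
  \<comment> \<open>In \<open>ennreal\<close>, 1 / top = 0, so the left-hand side vanishes.\<close>
  case top
  then have "2 * of_nat DIM('a) * torsion_const TYPE('a) * ennreal c = top"
    using c_pos by (simp add: ennreal_mult_top ennreal_top_mult)
  then show ?thesis by simp
next
  case (real t)
  obtain w where w: "emeasure lebesgue \<Omega> = ennreal w" "0 < w" by (rule emeasure_dom_cases)
  obtain l where l: "Linf_norm \<Omega> (\<lambda>x. (d x)\<^sup>2) = ennreal l" "0 < l" by (rule Linf_d_sq_real)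
  let ?m = "real DIM('a)" and ?S = "\<integral>x. (d x)\<^sup>2 \<partial>M" and ?I = "\<integral>x. torsion \<Omega> x \<partial>M"
  have le: "Linf_norm \<Omega> (torsion \<Omega>) \<le> ennreal (t * (c * l))"
    using Linf_torsion_le real l c_pos by (simp add: ennreal_mult)
  then obtain e where e: "Linf_norm \<Omega> (torsion \<Omega>) = ennreal e" "0 \<le> e"
    by (cases "Linf_norm \<Omega> (torsion \<Omega>)") (auto simp: top_unique)
  have "ennreal l \<le> ennreal (2 * ?m * e)"
    using Linf_d_sq_le e l by (simp add: ennreal_mult)
  then have "l \<le> 2 * ?m * e" using e(2) by (subst (asm) ennreal_le_iff) auto
  with l(2) have "0 < 2 * ?m * e" by (rule less_le_trans)
  then have e0: "0 < e" by (simp add: zero_less_mult_iff)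
  have ele: "e \<le> t * (c * l)" using le e real l c_pos by (subst (asm) e(1)) (auto simp: ennreal_le_iff)
  with e0 have "0 < t * (c * l)" by (rule less_le_trans)
  then have t: "0 < t" using mult_pos_pos[OF c_pos l(2)] by (rule zero_less_mult_pos2)
  have S: "0 < ?S" and I: "0 < ?I" by (rule integral_d_sq_pos integral_torsion_pos)+
  have "1 / (2 * ?m * t * c) * (?S / (w * l)) = ?S / (2 * ?m) / (w * (t * (c * l)))"
    using t c_pos l w by (simp add: field_simps)
  also have "\<dots> \<le> ?I / (w * e)"
  proof (rule frac_le)
    show "?S / (2 * ?m) \<le> ?I"
      using integral_d_sq_le by (subst pos_divide_le_eq) (simp_all add: mult.commute)
  qed (use I w e0 ele in auto)
  finally have main: "1 / (2 * ?m * t * c) * (?S / (w * l)) \<le> ?I / (w * e)" .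
  have "2 * of_nat DIM('a) * torsion_const TYPE('a) * ennreal c = ennreal (2 * ?m * t * c)"
    using real t c_pos by (simp add: ennreal_mult ennreal_of_nat_eq_real_of_nat)
  moreover have "ennreal 1 / ennreal (2 * ?m * t * c) = ennreal (1 / (2 * ?m * t * c))"
    using t c_pos by (intro divide_ennreal) auto
  ultimately have "1 / (2 * of_nat DIM('a) * torsion_const TYPE('a) * ennreal c) = ennreal (1 / (2 * ?m * t * c))"
    by simp
  moreover have "L1_norm \<Omega> (\<lambda>x. (d x)\<^sup>2) / (emeasure lebesgue \<Omega> * Linf_norm \<Omega> (\<lambda>x. (d x)\<^sup>2)) = ennreal (?S / (w * l))"
    unfolding L1_norm_d_sq w(1) l(1) using w l S by (simp add: ennreal_mult[symmetric] divide_ennreal)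
  moreover have "efficiency \<Omega> = ennreal (?I / (w * e))"
    unfolding efficiency_def L1_norm_torsion w(1) e(1) using w e0 I by (simp add: ennreal_mult[symmetric] divide_ennreal)
  ultimately show ?thesis
    using main t c_pos S w l by (simp add: ennreal_mult[symmetric] ennreal_leI)
qed

text \<open>The integral of v is at most c times that of d^2, while the supremum norm of v is at
  least that of d^2 divided by 2m, hence at least that of d^2 divided by j.\<close>

lemma efficiency_le:
  assumes j: "2 * real DIM('a) \<le> j"
  shows "efficiency \<Omega> \<le> ennreal (c * j)
      * (L1_norm \<Omega> (\<lambda>x. (d x)\<^sup>2) / (emeasure lebesgue \<Omega> * Linf_norm \<Omega> (\<lambda>x. (d x)\<^sup>2)))"
proof (cases "Linf_norm \<Omega> (torsion \<Omega>)")
  \<comment> \<open>An infinite supremum norm makes the efficiency 0, by division by top.\<close>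
  case top
  then have "emeasure lebesgue \<Omega> * Linf_norm \<Omega> (torsion \<Omega>) = top"
    using emeasure_pos by (simp add: ennreal_mult_top)
  then have "efficiency \<Omega> = 0" unfolding efficiency_def L1_norm_torsion by simp
  then show ?thesis by simp
next
  case (real e)
  obtain w where w: "emeasure lebesgue \<Omega> = ennreal w" "0 < w" by (rule emeasure_dom_cases)
  obtain l where l: "Linf_norm \<Omega> (\<lambda>x. (d x)\<^sup>2) = ennreal l" "0 < l" by (rule Linf_d_sq_real)
  let ?m = "real DIM('a)" and ?S = "\<integral>x. (d x)\<^sup>2 \<partial>M" and ?I = "\<integral>x. torsion \<Omega> x \<partial>M"
  have S: "0 < ?S" and I: "0 < ?I" by (rule integral_d_sq_pos integral_torsion_pos)+
  have "ennreal l \<le> ennreal (2 * ?m * e)"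
    using Linf_d_sq_le real l by (simp add: ennreal_mult)
  then have lm: "l \<le> 2 * ?m * e" using real(1) by (subst (asm) ennreal_le_iff) auto
  with l(2) have "0 < 2 * ?m * e" by (rule less_le_trans)
  then have e0: "0 < e" by (simp add: zero_less_mult_iff)
  have j0: "0 < j" using j by (rule less_le_trans[rotated]) simp
  have lj: "l \<le> j * e" using lm mult_right_mono[OF j, of e] e0 by linarith
  have "?I / (w * e) \<le> (c * ?S) / (w * e)"
    using integral_torsion_le w e0 by (intro divide_right_mono) auto
  also have "\<dots> = (c * ?S * j) / (w * (j * e))" using j0 by simp
  also have "\<dots> \<le> (c * ?S * j) / (w * l)"
    using lj w l c_pos S j0 e0 by (intro divide_left_mono mult_left_mono mult_pos_pos mult_nonneg_nonneg) auto
  also have "\<dots> = c * j * (?S / (w * l))" by simp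
  finally have main: "?I / (w * e) \<le> c * j * (?S / (w * l))" .
  have "L1_norm \<Omega> (\<lambda>x. (d x)\<^sup>2) / (emeasure lebesgue \<Omega> * Linf_norm \<Omega> (\<lambda>x. (d x)\<^sup>2)) = ennreal (?S / (w * l))"
    unfolding L1_norm_d_sq w(1) l(1) using w l S by (simp add: ennreal_mult[symmetric] divide_ennreal)
  moreover have "efficiency \<Omega> = ennreal (?I / (w * e))"
    unfolding efficiency_def L1_norm_torsion w(1) real(2) using w e0 I by (simp add: ennreal_mult[symmetric] divide_ennreal)
  ultimately show ?thesis
    using main j0 c_pos S w l by (simp add: ennreal_mult[symmetric] ennreal_leI)
qed

section \<open>The share of the total torsion carried by a subset\<close>

definition mass :: "'a set \<Rightarrow> real" where
  "mass A = (\<integral>x. torsion \<Omega> x \<partial>lebesgue_on A) / (\<integral>x. torsion \<Omega> x \<partial>M)"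

lemma mass_ereal:
  "ereal (\<integral>x. torsion \<Omega> x \<partial>lebesgue_on A) / enn2ereal (L1_norm \<Omega> (torsion \<Omega>)) = ereal (mass A)"
  using integral_torsion_pos unfolding L1_norm_torsion mass_def by simp

lemma mass_sq_le:
  assumes "A \<in> sets lebesgue" "A \<subseteq> \<Omega>"
  shows "(mass A)\<^sup>2 \<le> c * (\<integral>x. (d x)\<^sup>2 \<partial>lebesgue_on A) / (\<integral>x. torsion \<Omega> x \<partial>M)"
proof -
  let ?I = "\<integral>x. torsion \<Omega> x \<partial>M"
  have "(mass A)\<^sup>2 \<le> (c * ?I * (\<integral>x. (d x)\<^sup>2 \<partial>lebesgue_on A)) / ?I\<^sup>2"
    unfolding mass_def power_divide by (intro divide_right_mono integral_torsion_on_sq_le assms) simp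
  also have "\<dots> = c * (\<integral>x. (d x)\<^sup>2 \<partial>lebesgue_on A) / ?I"
    using integral_torsion_pos by (simp add: power2_eq_square)
  finally show ?thesis .
qed

lemma mass_sq_le_d_sq:
  assumes "A \<in> sets lebesgue" "A \<subseteq> \<Omega>"
  shows "(mass A)\<^sup>2 \<le> 2 * real DIM('a) * c * ((\<integral>x. (d x)\<^sup>2 \<partial>lebesgue_on A) / (\<integral>x. (d x)\<^sup>2 \<partial>M))"
proof -
  let ?I = "\<integral>x. torsion \<Omega> x \<partial>M" and ?S = "\<integral>x. (d x)\<^sup>2 \<partial>M" and ?Q = "\<integral>x. (d x)\<^sup>2 \<partial>lebesgue_on A"
  have "?S / (2 * real DIM('a)) \<le> ?I"
    using integral_d_sq_le by (subst pos_divide_le_eq) (simp_all add: mult.commute)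
  then have "c * ?Q / ?I \<le> c * ?Q / (?S / (2 * real DIM('a)))"
    using c_pos integral_d_sq_pos integral_torsion_pos
    by (intro divide_left_mono mult_nonneg_nonneg mult_pos_pos divide_pos_pos) auto
  also have "\<dots> = 2 * real DIM('a) * c * (?Q / ?S)" by simp
  finally show ?thesis using mass_sq_le[OF assms] by linarith
qed

lemma mass_diff:
  assumes "A \<in> sets lebesgue" "A \<subseteq> \<Omega>"
  shows "mass (\<Omega> - A) = 1 - mass A"
proof -
  have i: "integrable M (\<lambda>x. indicat_real A x * torsion \<Omega> x)"
    using integrable_mult_indicator[of A M "torsion \<Omega>"] torsion_integrable assms sets_dom
    by (simp add: sets_restrict_space_iff)
  have "(\<integral>x. indicator (\<Omega> - A) x * torsion \<Omega> x \<partial>M) = (\<integral>x. torsion \<Omega> x - indicator A x * torsion \<Omega> x \<partial>M)"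
    using assms(2) by (intro Bochner_Integration.integral_cong) (auto simp: indicator_def)
  also have "\<dots> = (\<integral>x. torsion \<Omega> x \<partial>M) - (\<integral>x. indicator A x * torsion \<Omega> x \<partial>M)"
    by (rule Bochner_Integration.integral_diff[OF torsion_integrable i])
  finally have "(\<integral>x. torsion \<Omega> x \<partial>lebesgue_on (\<Omega> - A))
      = (\<integral>x. torsion \<Omega> x \<partial>M) - (\<integral>x. torsion \<Omega> x \<partial>lebesgue_on A)"
    using assms sets_dom integral_subset[of "\<Omega> - A"] integral_subset[of A] by simp
  then show ?thesis unfolding mass_def using integral_torsion_pos by (simp add: diff_divide_distrib)
qed

lemma superlevel_sets: "{x \<in> \<Omega>. \<eta> \<le> d x} \<in> sets lebesgue"
proof -
  have "closed {x. \<eta> \<le> d x}" by (intro closed_Collect_le continuous_on_const d_continuous)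
  then have "{x. \<eta> \<le> d x} \<in> sets lebesgue" by auto
  then have "\<Omega> \<inter> {x. \<eta> \<le> d x} \<in> sets lebesgue" using sets_dom by auto
  moreover have "\<Omega> \<inter> {x. \<eta> \<le> d x} = {x \<in> \<Omega>. \<eta> \<le> d x}" by auto
  ultimately show ?thesis by (simp only:)
qed

text \<open>The complement of A is estimated: there d < \<eta>, so the integral of d^2 over it is at
  most \<eta>^2 times the volume of \<Omega>. The integral of v in the denominator is bounded below
  by 1/(2m) times the integral of d^2 over A.\<close>

lemma mass_superlevel:
  assumes "0 < \<eta>" and A: "A = {x \<in> \<Omega>. \<eta> \<le> d x}"
    and Q: "0 < (\<integral>x. (d x)\<^sup>2 \<partial>lebesgue_on A)"
  shows "(1 - mass A)\<^sup>2 \<le> 2 * real DIM('a) * c * (\<eta>\<^sup>2 * measure lebesgue \<Omega> / (\<integral>x. (d x)\<^sup>2 \<partial>lebesgue_on A))"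
proof -
  let ?I = "\<integral>x. torsion \<Omega> x \<partial>M" and ?S = "\<integral>x. (d x)\<^sup>2 \<partial>M" and ?Q = "\<integral>x. (d x)\<^sup>2 \<partial>lebesgue_on A"
  have As: "A \<in> sets lebesgue" "A \<subseteq> \<Omega>" using superlevel_sets A by auto
  have Bs: "\<Omega> - A \<in> sets lebesgue" "\<Omega> - A \<subseteq> \<Omega>" using As sets_dom by auto
  have le1: "(\<integral>x. (d x)\<^sup>2 \<partial>lebesgue_on (\<Omega> - A)) \<le> \<eta>\<^sup>2 * measure lebesgue \<Omega>"
  proof -
    have i: "integrable M (\<lambda>x. indicator (\<Omega> - A) x * (d x)\<^sup>2)"
    proof -
      have "integrable M (\<lambda>x. indicator (\<Omega> - A) x *\<^sub>R (d x)\<^sup>2)"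
        using Bs sets_dom by (intro integrable_mult_indicator d_sq_on(2)) (auto simp: sets_restrict_space_iff)
      then show ?thesis by simp
    qed
    have "(\<integral>x. indicator (\<Omega> - A) x * (d x)\<^sup>2 \<partial>M) \<le> (\<integral>x. \<eta>\<^sup>2 \<partial>M)"
    proof (rule integral_mono[OF i])
      show "integrable M (\<lambda>x. \<eta>\<^sup>2)" using finite_measure.integrable_const[OF finite_M] .
      fix x assume "x \<in> space M"
      then show "indicator (\<Omega> - A) x * (d x)\<^sup>2 \<le> \<eta>\<^sup>2"
        using d_nonneg[of x] A by (auto simp: indicator_def intro: power_mono)
    qed
    also have "\<dots> = \<eta>\<^sup>2 * measure lebesgue \<Omega>"
      using sets_dom by (simp add: measure_restrict_space)
    finally show ?thesis using integral_subset[OF Bs] by simp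
  qed
  have "?Q = (\<integral>x. indicator A x * (d x)\<^sup>2 \<partial>M)" by (rule integral_subset[OF As])
  also have "\<dots> \<le> ?S"
  proof (rule integral_mono)
    have "integrable M (\<lambda>x. indicator A x *\<^sub>R (d x)\<^sup>2)"
      using As sets_dom by (intro integrable_mult_indicator d_sq_on(2)) (auto simp: sets_restrict_space_iff)
    then show "integrable M (\<lambda>x. indicator A x * (d x)\<^sup>2)" by simp
    show "integrable M (\<lambda>x. (d x)\<^sup>2)" by (rule d_sq_on(2)[OF sets_dom order_refl])
  qed (auto simp: indicator_def)
  finally have "?Q \<le> 2 * real DIM('a) * ?I" using integral_d_sq_le by (rule order_trans)
  then have QI: "?Q / (2 * real DIM('a)) \<le> ?I" by (subst pos_divide_le_eq) (simp_all add: mult.commute)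
  have "(1 - mass A)\<^sup>2 \<le> c * (\<integral>x. (d x)\<^sup>2 \<partial>lebesgue_on (\<Omega> - A)) / ?I"
    using mass_sq_le[OF Bs] unfolding mass_diff[OF As] .
  also have "\<dots> \<le> c * (\<eta>\<^sup>2 * measure lebesgue \<Omega>) / ?I"
    using c_pos integral_torsion_pos le1 by (intro divide_right_mono mult_left_mono) auto
  also have "\<dots> \<le> c * (\<eta>\<^sup>2 * measure lebesgue \<Omega>) / (?Q / (2 * real DIM('a)))"
    using c_pos Q QI integral_torsion_pos
    by (intro divide_left_mono mult_nonneg_nonneg mult_pos_pos divide_pos_pos) auto
  also have "\<dots> = 2 * real DIM('a) * c * (\<eta>\<^sup>2 * measure lebesgue \<Omega> / ?Q)" by simp
  finally show ?thesis .
qed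

end


section \<open>Localisation\<close>

text \<open>The mass outside A_n is at most the square root of a constant times the quotient assumed
  to vanish; the bound on the Hardy constants makes that constant uniform in n.\<close>

lemma localises_along_superlevel:
  fixes \<Omega> :: "nat \<Rightarrow> 'a::euclidean_space set"
  assumes adm: "\<And>n. admissible (\<Omega> n)" and hardy: "\<And>n. strong_hardy (\<Omega> n) (c n)"
    and bdd: "bdd_above (range c)" and \<eta>: "\<And>n. 0 < \<eta> n"
    and A: "\<And>n. A n = {x \<in> \<Omega> n. \<eta> n \<le> bdry_dist (\<Omega> n) x}"
    and vanish: "(\<lambda>n. emeasure lebesgue (A n) / emeasure lebesgue (\<Omega> n)) \<longlonglongrightarrow> 0"
    and lim: "(\<lambda>n. ennreal ((\<eta> n)\<^sup>2) * emeasure lebesgue (\<Omega> n)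
        / (\<integral>\<^sup>+x. ennreal ((bdry_dist (\<Omega> n) x)\<^sup>2) \<partial>lebesgue_on (A n))) \<longlonglongrightarrow> 0"
  shows "localises_along \<Omega> A"
proof -
  have H: "hardy_domain (\<Omega> n) (c n)" for n
    by (rule hardy_domain.intro[OF adm hardy])
  have As: "A n \<in> sets lebesgue" "A n \<subseteq> \<Omega> n" for n
    using hardy_domain.superlevel_sets[OF H] by (auto simp: A)
  obtain C where C: "\<And>n. c n \<le> C" using bdd by (auto simp: bdd_above_def)
  let ?Q = "\<lambda>n. \<integral>x. (bdry_dist (\<Omega> n) x)\<^sup>2 \<partial>lebesgue_on (A n)"
  let ?r = "\<lambda>n. hardy_domain.mass (\<Omega> n) (A n)"
  define X where "X = (\<lambda>n. ennreal ((\<eta> n)\<^sup>2) * emeasure lebesgue (\<Omega> n) / ennreal (?Q n))"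
  have X: "X \<longlonglongrightarrow> 0"
    using lim unfolding X_def hardy_domain.d_sq_on(3)[OF H As] .
  then have "X \<longlonglongrightarrow> ennreal 0" by simp
  then have x: "(\<lambda>n. enn2real (X n)) \<longlonglongrightarrow> 0"
    by (rule tendsto_enn2real) simp
  \<comment> \<open>If the integral of d^2 over A_n were 0, the quotient would be a positive number
    over 0, which is top in \<open>ennreal\<close>. Its smallness excludes this for large n, and
    from there on everything is real.\<close>
  have "eventually (\<lambda>n. X n < 1) sequentially"
    using X by (rule order_tendstoD(2)) simp
  then have bound: "eventually (\<lambda>n. \<bar>1 - ?r n\<bar> \<le> sqrt (2 * real DIM('a) * C * enn2real (X n))) sequentially"
  proof eventually_elim
    case (elim n)
    obtain w where w: "emeasure lebesgue (\<Omega> n) = ennreal w" "0 < w"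
      by (rule hardy_domain.emeasure_dom_cases[OF H])
    have num: "0 < (\<eta> n)\<^sup>2 * w" using \<eta>[of n] w by simp
    have Q: "0 < ?Q n"
    proof (rule ccontr)
      assume "\<not> ?thesis"
      then have Q0: "ennreal (?Q n) = 0" by (simp add: ennreal_eq_0_iff)
      have "ennreal ((\<eta> n)\<^sup>2) \<noteq> 0" "ennreal w \<noteq> 0" using \<eta>[of n] w(2) by (auto simp: ennreal_eq_0_iff)
      then have "X n = top"
        unfolding X_def w(1) Q0 by (simp add: ennreal_divide_zero)
      then show False using elim by simp
    qed
    have wm: "measure lebesgue (\<Omega> n) = w" using w by (simp add: measure_def)
    have "X n = ennreal ((\<eta> n)\<^sup>2 * w / ?Q n)"
      unfolding X_def w(1) using Q w by (simp add: ennreal_mult[symmetric] divide_ennreal)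
    then have xn: "enn2real (X n) = (\<eta> n)\<^sup>2 * w / ?Q n" using Q w by simp
    have "(1 - ?r n)\<^sup>2 \<le> 2 * real DIM('a) * c n * enn2real (X n)"
      using hardy_domain.mass_superlevel[OF H \<eta> A Q] unfolding wm xn .
    also have "\<dots> \<le> 2 * real DIM('a) * C * enn2real (X n)"
      by (intro mult_right_mono mult_left_mono C) auto
    finally show ?case by (rule real_le_rsqrt[of "\<bar>_\<bar>", unfolded power2_abs])
  qed
  have "(\<lambda>n. sqrt (2 * real DIM('a) * C * enn2real (X n))) \<longlonglongrightarrow> sqrt (2 * real DIM('a) * C * 0)"
    by (intro tendsto_intros x)
  then have lim0: "(\<lambda>n. sqrt (2 * real DIM('a) * C * enn2real (X n))) \<longlonglongrightarrow> 0" by simp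
  have "(\<lambda>n. 1 - ?r n) \<longlonglongrightarrow> 0"
    by (rule Lim_null_comparison[OF _ lim0]) (use bound in simp)
  then have "(\<lambda>n. 1 - (1 - ?r n)) \<longlonglongrightarrow> 1 - 0" by (intro tendsto_diff tendsto_const)
  then have "(\<lambda>n. ereal (?r n)) \<longlonglongrightarrow> ereal 1" by (intro tendsto_ereal) simp
  then have "mass_limsup \<Omega> A = 1"
    unfolding mass_limsup_def hardy_domain.mass_ereal[OF H]
    by (simp add: lim_imp_Limsup one_ereal_def)
  moreover have "A \<in> vanishing_seqs \<Omega>"
    unfolding vanishing_seqs_def using As vanish by simp
  ultimately show ?thesis by (simp add: localises_along_def)
qed

text \<open>The squared share of A_n is at most 2m C times the corresponding share of d^2, with C
  bounding all Hardy constants, so it tends to 0 along every vanishing sequence.\<close>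

lemma not_localises_if_d_sq_not_localises:
  fixes \<Omega> :: "nat \<Rightarrow> 'a::euclidean_space set"
  assumes adm: "\<And>n. admissible (\<Omega> n)" and hardy: "\<And>n. strong_hardy (\<Omega> n) (c n)"
    and bdd: "bdd_above (range c)"
    and lim: "\<And>A. A \<in> vanishing_seqs \<Omega> \<Longrightarrow>
      (\<lambda>n. (\<integral>\<^sup>+x. ennreal ((bdry_dist (\<Omega> n) x)\<^sup>2) \<partial>lebesgue_on (A n))
         / (\<integral>\<^sup>+x. ennreal ((bdry_dist (\<Omega> n) x)\<^sup>2) \<partial>lebesgue_on (\<Omega> n))) \<longlonglongrightarrow> 0"
  shows "not_localises \<Omega>"
proof -
  have H: "hardy_domain (\<Omega> n) (c n)" for n
    by (rule hardy_domain.intro[OF adm hardy])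
  obtain C where C: "\<And>n. c n \<le> C" using bdd by (auto simp: bdd_above_def)
  have "mass_limsup \<Omega> A = 0" if A: "A \<in> vanishing_seqs \<Omega>" for A
  proof -
    have As: "A n \<in> sets lebesgue" "A n \<subseteq> \<Omega> n" for n
      using A by (auto simp: vanishing_seqs_def)
    let ?Q = "\<lambda>n. \<integral>x. (bdry_dist (\<Omega> n) x)\<^sup>2 \<partial>lebesgue_on (A n)"
    let ?S = "\<lambda>n. \<integral>x. (bdry_dist (\<Omega> n) x)\<^sup>2 \<partial>lebesgue_on (\<Omega> n)"
    let ?r = "\<lambda>n. hardy_domain.mass (\<Omega> n) (A n)"
    have S: "0 < ?S n" for n by (rule hardy_domain.integral_d_sq_pos[OF H])
    have Q: "0 \<le> ?Q n" for n by simp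
    have "(\<lambda>n. ennreal (?Q n) / ennreal (?S n)) \<longlonglongrightarrow> 0"
      using lim[OF A]
      unfolding hardy_domain.d_sq_on(3)[OF H As]
        hardy_domain.d_sq_on(3)[OF H hardy_domain.sets_dom[OF H] order_refl] .
    then have "(\<lambda>n. ennreal (?Q n / ?S n)) \<longlonglongrightarrow> ennreal 0"
      by (simp add: divide_ennreal[OF Q S])
    then have x: "(\<lambda>n. ?Q n / ?S n) \<longlonglongrightarrow> 0"
      by (subst (asm) tendsto_ennreal_iff) (use Q S in \<open>auto intro!: divide_nonneg_pos\<close>)
    have bound: "\<bar>?r n\<bar> \<le> sqrt (2 * real DIM('a) * C * (?Q n / ?S n))" for n
    proof -
      have "(?r n)\<^sup>2 \<le> 2 * real DIM('a) * c n * (?Q n / ?S n)"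
        by (rule hardy_domain.mass_sq_le_d_sq[OF H As])
      also have "\<dots> \<le> 2 * real DIM('a) * C * (?Q n / ?S n)"
        using divide_nonneg_pos[OF Q[of n] S[of n]] by (intro mult_right_mono mult_left_mono C) auto
      finally show ?thesis by (rule real_le_rsqrt[of "\<bar>_\<bar>", unfolded power2_abs])
    qed
    have "(\<lambda>n. sqrt (2 * real DIM('a) * C * (?Q n / ?S n))) \<longlonglongrightarrow> sqrt (2 * real DIM('a) * C * 0)"
      by (intro tendsto_intros x)
    then have lim0: "(\<lambda>n. sqrt (2 * real DIM('a) * C * (?Q n / ?S n))) \<longlonglongrightarrow> 0" by simp
    have "?r \<longlonglongrightarrow> 0"
      by (rule Lim_null_comparison[OF _ lim0]) (use bound in simp)
    then have "(\<lambda>n. ereal (?r n)) \<longlonglongrightarrow> ereal 0" by (intro tendsto_ereal)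
    then show ?thesis
      unfolding mass_limsup_def hardy_domain.mass_ereal[OF H]
      by (simp add: lim_imp_Limsup zero_ereal_def)
  qed
  \<comment> \<open>The supremum defining \<open>kappa\<close> would be -\<infinity> over an empty
    family; the sequence of empty sets shows that the family is nonempty.\<close>
  moreover have "(\<lambda>n. {}) \<in> vanishing_seqs \<Omega>" by (simp add: vanishing_seqs_def)
  ultimately have "kappa \<Omega> = 0"
    unfolding kappa_def by (intro SUP_eq_const) auto
  then show ?thesis by (simp add: not_localises_def)
qed

theorem theorem1:
  shows "(\<forall>(\<Omega> :: (real ^ 'm::finite) set) c.
            admissible \<Omega> \<and> strong_hardy \<Omega> c \<longrightarrow>
              1 / (2 * of_nat CARD('m) * torsion_const TYPE(real ^ 'm) * ennreal c)
                * (L1_norm \<Omega> (\<lambda>x. (bdry_dist \<Omega> x)\<^sup>2)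
                    / (emeasure lebesgue \<Omega> * Linf_norm \<Omega> (\<lambda>x. (bdry_dist \<Omega> x)\<^sup>2)))
                \<le> efficiency \<Omega> \<and>
              efficiency \<Omega>
                \<le> ennreal (c * (bessel_zero ((real CARD('m) - 2) / 2))\<^sup>2)
                  * (L1_norm \<Omega> (\<lambda>x. (bdry_dist \<Omega> x)\<^sup>2)
                      / (emeasure lebesgue \<Omega> * Linf_norm \<Omega> (\<lambda>x. (bdry_dist \<Omega> x)\<^sup>2))))
       \<and> (\<forall>(\<Omega> :: nat \<Rightarrow> (real ^ 'm) set) (c :: nat \<Rightarrow> real) (\<eta> :: nat \<Rightarrow> real).
            (\<forall>n. admissible (\<Omega> n)) \<and> (\<forall>n. strong_hardy (\<Omega> n) (c n)) \<and> bdd_above (range c) \<and>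
            (\<forall>n. 0 < \<eta> n) \<and>
            (\<lambda>n. emeasure lebesgue {x \<in> \<Omega> n. \<eta> n \<le> bdry_dist (\<Omega> n) x}
                   / emeasure lebesgue (\<Omega> n)) \<longlonglongrightarrow> 0 \<and>
            (\<lambda>n. ennreal ((\<eta> n)\<^sup>2) * emeasure lebesgue (\<Omega> n)
                   / (\<integral>\<^sup>+x. ennreal ((bdry_dist (\<Omega> n) x)\<^sup>2)
                        \<partial>lebesgue_on {x \<in> \<Omega> n. \<eta> n \<le> bdry_dist (\<Omega> n) x})) \<longlonglongrightarrow> 0
            \<longrightarrow> localises_along \<Omega> (\<lambda>n. {x \<in> \<Omega> n. \<eta> n \<le> bdry_dist (\<Omega> n) x}))
       \<and> (\<forall>(\<Omega> :: nat \<Rightarrow> (real ^ 'm) set) (c :: nat \<Rightarrow> real).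
            (\<forall>n. admissible (\<Omega> n)) \<and> (\<forall>n. strong_hardy (\<Omega> n) (c n)) \<and> bdd_above (range c) \<and>
            (\<forall>A. (\<forall>n. A n \<in> sets lebesgue \<and> A n \<subseteq> \<Omega> n) \<and>
                 (\<lambda>n. emeasure lebesgue (A n) / emeasure lebesgue (\<Omega> n)) \<longlonglongrightarrow> 0 \<longrightarrow>
                 (\<lambda>n. (\<integral>\<^sup>+x. ennreal ((bdry_dist (\<Omega> n) x)\<^sup>2) \<partial>lebesgue_on (A n))
                       / (\<integral>\<^sup>+x. ennreal ((bdry_dist (\<Omega> n) x)\<^sup>2) \<partial>lebesgue_on (\<Omega> n))) \<longlonglongrightarrow> 0)
            \<longrightarrow> not_localises \<Omega>)"
proof (intro conjI allI impI)
  fix \<Omega> :: "(real ^ 'm) set" and c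
  assume "admissible \<Omega> \<and> strong_hardy \<Omega> c"
  then interpret hardy_domain \<Omega> c by (intro hardy_domain.intro) simp_all
  show "1 / (2 * of_nat CARD('m) * torsion_const TYPE(real ^ 'm) * ennreal c)
      * (L1_norm \<Omega> (\<lambda>x. (bdry_dist \<Omega> x)\<^sup>2)
          / (emeasure lebesgue \<Omega> * Linf_norm \<Omega> (\<lambda>x. (bdry_dist \<Omega> x)\<^sup>2)))
      \<le> efficiency \<Omega>"
    using efficiency_ge by simp
  \<comment> \<open>The series parameter is a = m/2, so that the order a - 1 is (m-2)/2 and 4a =
    2m.\<close>
  have "4 * (real CARD('m) / 2) \<le> (bessel_zero (real CARD('m) / 2 - 1))\<^sup>2"
    by (rule bessel_zero_sq_ge) simp
  then have "2 * real DIM(real ^ 'm) \<le> (bessel_zero ((real CARD('m) - 2) / 2))\<^sup>2"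
    by (simp add: diff_divide_distrib)
  then show "efficiency \<Omega>
      \<le> ennreal (c * (bessel_zero ((real CARD('m) - 2) / 2))\<^sup>2)
        * (L1_norm \<Omega> (\<lambda>x. (bdry_dist \<Omega> x)\<^sup>2)
            / (emeasure lebesgue \<Omega> * Linf_norm \<Omega> (\<lambda>x. (bdry_dist \<Omega> x)\<^sup>2)))"
    by (rule efficiency_le)
next
  fix \<Omega> :: "nat \<Rightarrow> (real ^ 'm) set" and c \<eta> :: "nat \<Rightarrow> real"
  assume A: "(\<forall>n. admissible (\<Omega> n)) \<and> (\<forall>n. strong_hardy (\<Omega> n) (c n)) \<and> bdd_above (range c) \<and>
    (\<forall>n. 0 < \<eta> n) \<and>
    (\<lambda>n. emeasure lebesgue {x \<in> \<Omega> n. \<eta> n \<le> bdry_dist (\<Omega> n) x}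
           / emeasure lebesgue (\<Omega> n)) \<longlonglongrightarrow> 0 \<and>
    (\<lambda>n. ennreal ((\<eta> n)\<^sup>2) * emeasure lebesgue (\<Omega> n)
           / (\<integral>\<^sup>+x. ennreal ((bdry_dist (\<Omega> n) x)\<^sup>2)
                \<partial>lebesgue_on {x \<in> \<Omega> n. \<eta> n \<le> bdry_dist (\<Omega> n) x})) \<longlonglongrightarrow> 0"
  show "localises_along \<Omega> (\<lambda>n. {x \<in> \<Omega> n. \<eta> n \<le> bdry_dist (\<Omega> n) x})"
    by (rule localises_along_superlevel[where c = c and \<eta> = \<eta>]) (use A in simp_all)
next
  fix \<Omega> :: "nat \<Rightarrow> (real ^ 'm) set" and c :: "nat \<Rightarrow> real"
  assume A: "(\<forall>n. admissible (\<Omega> n)) \<and> (\<forall>n. strong_hardy (\<Omega> n) (c n)) \<and> bdd_above (range c) \<and>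
    (\<forall>A. (\<forall>n. A n \<in> sets lebesgue \<and> A n \<subseteq> \<Omega> n) \<and>
         (\<lambda>n. emeasure lebesgue (A n) / emeasure lebesgue (\<Omega> n)) \<longlonglongrightarrow> 0 \<longrightarrow>
         (\<lambda>n. (\<integral>\<^sup>+x. ennreal ((bdry_dist (\<Omega> n) x)\<^sup>2) \<partial>lebesgue_on (A n))
               / (\<integral>\<^sup>+x. ennreal ((bdry_dist (\<Omega> n) x)\<^sup>2) \<partial>lebesgue_on (\<Omega> n))) \<longlonglongrightarrow> 0)"
  show "not_localises \<Omega>"
  proof (rule not_localises_if_d_sq_not_localises[where c = c])
    fix A assume "A \<in> vanishing_seqs \<Omega>"
    then have "(\<forall>n. A n \<in> sets lebesgue \<and> A n \<subseteq> \<Omega> n) \<and>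
         (\<lambda>n. emeasure lebesgue (A n) / emeasure lebesgue (\<Omega> n)) \<longlonglongrightarrow> 0"
      unfolding vanishing_seqs_def by (rule CollectD)
    with A show "(\<lambda>n. (\<integral>\<^sup>+x. ennreal ((bdry_dist (\<Omega> n) x)\<^sup>2) \<partial>lebesgue_on (A n))
        / (\<integral>\<^sup>+x. ennreal ((bdry_dist (\<Omega> n) x)\<^sup>2) \<partial>lebesgue_on (\<Omega> n))) \<longlonglongrightarrow> 0"
      by blast
  qed (use A in simp_all)
qed

end
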